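(* Let $f:(M,h)\to(N,g)$ be a pluri-harmonic map from a Hermitian manifold $(M,h)$ to a Riemannian manifold $(N,g)$. Then the following inequality of real $(1,1)$-forms holds on $\mathbb P(T_M)$: $$\sqrt{-1}\,\partial\bar\partial\,\mathscr Y\ \ge\ \left(\sqrt{-1}\,\partial\bar\partial\log\mathscr H^{-1}\right)\cdot\mathscr Y-\frac{\sqrt{-1}\,R_{i\ell kj}\,f^i_\alpha f^j_{\bar\beta}f^k_\gamma f^\ell_{\bar\delta}\,W^\gamma\overline{W^\delta}\,dz^\alpha\wedge d\bar z^\beta}{\mathscr H}.$$
   Context: $\{z^\alpha\}_{\alpha=1}^m$ are local holomorphic coordinates on $M$, $\{x^i\}_{i=1}^n$ local real coordinates on $N$; $h=(h_{\alpha\bar\beta})$, $g=(g_{ij})$; $f^i_\alpha=\partial f^i/\partial z^\alpha$, $f^i_{\bar\beta}=\partial f^i/\partial\bar z^\beta=\overline{f^i_\beta}$. Repeated indices are summed. A smooth map $f:M\to(N,g)$ from a complex manifold to a Riemannian manifold is pluri-harmonic if $\frac{\partial^2f^i}{\partial z^\alpha\partial\bar z^\beta}+\Gamma^i_{jk}\frac{\partial f^j}{\partial\bar z^\beta}\frac{\partial f^k}{\partial z^\alpha}=0$ for all $i,\alpha,\beta$, with $\Gamma^i_{jk}$ the Christoffel symbols of the Levi-Civita connection of $g$. $\mathbb P(T_M)\to M$ is the bundle whose fiber over $p$ is the set of complex lines in $T_pM=T^{1,0}_pM$; $(W^1,\dots,W^m)$ are the holomorphic fiber coordinates on $T_pM$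 with respect to $\partial/\partial z^\alpha$. Set $\mathscr H=h_{\gamma\bar\delta}W^\gamma\overline{W^\delta}$ and $$\mathscr Y=g_{ij}f^i_\alpha\overline{f^j_\beta}\,\frac{W^\alpha\overline{W^\beta}}{\sum h_{\gamma\bar\delta}W^\gamma\overline{W^\delta}},$$ a function on $\mathbb P(T_M)$. The form $\partial\bar\partial\log\mathscr H^{-1}$ is well defined on $\mathbb P(T_M)$, and $dz^\alpha$ is pulled back to it. Curvature convention on $N$: $R(X,Y)Z=\nabla_X\nabla_YZ-\nabla_Y\nabla_XZ-\nabla_{[X,Y]}Z$ and $g(R(X,Y)Z,W)=R_{ijk\ell}X^iY^jZ^kW^\ell$. For real $(1,1)$-forms, $A\ge B$ means that $A-B$ is semi-positive. *)

theory Defs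
  imports "HOL-Analysis.Analysis"
begin

section \<open>Smooth maps and Wirtinger derivatives on Euclidean spaces\<close>

(* Used on open sets only. *)
primrec Ck_on :: "nat \<Rightarrow> ('e::euclidean_space \<Rightarrow> 'v::real_normed_vector) \<Rightarrow> 'e set \<Rightarrow> bool" where
  "Ck_on 0 F S \<longleftrightarrow> continuous_on S F"
| "Ck_on (Suc k) F S \<longleftrightarrow>
     (\<forall>x\<in>S. F differentiable (at x)) \<and> (\<forall>v. Ck_on k (\<lambda>x. frechet_derivative F (at x) v) S)"

definition Cinf_on :: "('e::euclidean_space \<Rightarrow> 'v::real_normed_vector) \<Rightarrow> 'e set \<Rightarrow> bool" where
  "Cinf_on F S \<longleftrightarrow> (\<forall>k. Ck_on k F S)"

definition holomorphic_map_on :: "(complex^'m::finite \<Rightarrow> complex^'k::finite) \<Rightarrow> (complex^'m) set \<Rightarrow> bool" where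
  "holomorphic_map_on F S \<longleftrightarrow> Cinf_on F S \<and>
     (\<forall>z\<in>S. \<forall>s v. frechet_derivative F (at z) (s *s v) = s *s frechet_derivative F (at z) v)"

definition partial :: "(real^'n::finite \<Rightarrow> 'v::real_normed_vector) \<Rightarrow> 'n \<Rightarrow> real^'n \<Rightarrow> 'v" where
  "partial F j y = frechet_derivative F (at y) (axis j 1)"

(* d/dz^a = (d/dx^a - i d/dy^a) / 2  and  d/d(conj z^a) = (d/dx^a + i d/dy^a) / 2 *)
definition dz :: "(complex^'k::finite \<Rightarrow> complex) \<Rightarrow> 'k \<Rightarrow> complex^'k \<Rightarrow> complex" where
  "dz F a z = (frechet_derivative F (at z) (axis a 1) - \<i> * frechet_derivative F (at z) (axis a \<i>)) / 2"

definition dzbar :: "(complex^'k::finite \<Rightarrow> complex) \<Rightarrow> 'k \<Rightarrow> complex^'k \<Rightarrow> complex" where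
  "dzbar F a z = (frechet_derivative F (at z) (axis a 1) + \<i> * frechet_derivative F (at z) (axis a \<i>)) / 2"


section \<open>Manifolds\<close>

(* A manifold is a Hausdorff second countable type together with an atlas.  A chart is a pair
   of its domain and its coordinate map; the latter is irrelevant outside the domain. *)
type_synonym ('a, 'e) chart = "'a set \<times> ('a \<Rightarrow> 'e)"

abbreviation cdom :: "('a, 'e) chart \<Rightarrow> 'a set" where "cdom c \<equiv> fst c"
abbreviation coord :: "('a, 'e) chart \<Rightarrow> 'a \<Rightarrow> 'e" where "coord c \<equiv> snd c"

definition cinv :: "('a, 'e) chart \<Rightarrow> 'e \<Rightarrow> 'a" where
  "cinv c = inv_into (cdom c) (coord c)"

definition crange :: "('a, 'e) chart \<Rightarrow> 'e set" where
  "crange c = coord c ` cdom c"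

definition is_chart :: "('a::topological_space, 'e::euclidean_space) chart \<Rightarrow> bool" where
  "is_chart c \<longleftrightarrow> open (cdom c) \<and> open (crange c) \<and>
     homeomorphism (cdom c) (crange c) (coord c) (cinv c)"

definition transition :: "('a, 'e) chart \<Rightarrow> ('a, 'e) chart \<Rightarrow> 'e \<Rightarrow> 'e" where
  "transition c d = coord d \<circ> cinv c"

definition smooth_atlas ::
  "('a::{t2_space, second_countable_topology}, real^'n::finite) chart set \<Rightarrow> bool" where
  "smooth_atlas B \<longleftrightarrow> (\<forall>c\<in>B. is_chart c) \<and> (\<Union>c\<in>B. cdom c) = UNIV \<and>
     (\<forall>c\<in>B. \<forall>d\<in>B. Cinf_on (transition c d) (coord c ` (cdom c \<inter> cdom d)))"

definition complex_atlas ::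
  "('a::{t2_space, second_countable_topology}, complex^'m::finite) chart set \<Rightarrow> bool" where
  "complex_atlas A \<longleftrightarrow> (\<forall>c\<in>A. is_chart c) \<and> (\<Union>c\<in>A. cdom c) = UNIV \<and>
     (\<forall>c\<in>A. \<forall>d\<in>A. holomorphic_map_on (transition c d) (coord c ` (cdom c \<inter> cdom d)))"


section \<open>Metrics\<close>

(* Metrics are given by their components: h c z $ \<alpha> $ \<beta> is h_{\<alpha> \<beta>bar} at the point with
   coordinates z in the chart c, and similarly for g. *)
type_synonym ('a, 'm) hmetric = "('a, complex^'m) chart \<Rightarrow> complex^'m \<Rightarrow> complex^'m^'m"
type_synonym ('b, 'n) rmetric = "('b, real^'n) chart \<Rightarrow> real^'n \<Rightarrow> real^'n^'n"

definition hermitian_metric ::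
  "('a::{t2_space, second_countable_topology}, complex^'m::finite) chart set \<Rightarrow> ('a, 'm) hmetric \<Rightarrow> bool" where
  "hermitian_metric A h \<longleftrightarrow>
     (\<forall>c\<in>A. Cinf_on (h c) (crange c)) \<and>
     (\<forall>c\<in>A. \<forall>z\<in>crange c. \<forall>\<alpha> \<beta>. h c z $ \<beta> $ \<alpha> = cnj (h c z $ \<alpha> $ \<beta>)) \<and>
     (\<forall>c\<in>A. \<forall>z\<in>crange c. \<forall>W. W \<noteq> 0 \<longrightarrow>
        0 < Re (\<Sum>\<alpha>\<in>UNIV. \<Sum>\<beta>\<in>UNIV. h c z $ \<alpha> $ \<beta> * W $ \<alpha> * cnj (W $ \<beta>))) \<and>
     (\<forall>c\<in>A. \<forall>d\<in>A. \<forall>p\<in>cdom c \<inter> cdom d. \<forall>\<alpha> \<beta>.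
        (let J = frechet_derivative (transition c d) (at (coord c p)) in
         h c (coord c p) $ \<alpha> $ \<beta> =
           (\<Sum>\<gamma>\<in>UNIV. \<Sum>\<delta>\<in>UNIV. h d (coord d p) $ \<gamma> $ \<delta> * J (axis \<alpha> 1) $ \<gamma> * cnj (J (axis \<beta> 1) $ \<delta>))))"

definition riemannian_metric ::
  "('b::{t2_space, second_countable_topology}, real^'n::finite) chart set \<Rightarrow> ('b, 'n) rmetric \<Rightarrow> bool" where
  "riemannian_metric B g \<longleftrightarrow>
     (\<forall>c\<in>B. Cinf_on (g c) (crange c)) \<and>
     (\<forall>c\<in>B. \<forall>y\<in>crange c. \<forall>i j. g c y $ i $ j = g c y $ j $ i) \<and>
     (\<forall>c\<in>B. \<forall>y\<in>crange c. \<forall>v. v \<noteq> 0 \<longrightarrow>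
        0 < (\<Sum>i\<in>UNIV. \<Sum>j\<in>UNIV. g c y $ i $ j * v $ i * v $ j)) \<and>
     (\<forall>c\<in>B. \<forall>d\<in>B. \<forall>q\<in>cdom c \<inter> cdom d. \<forall>i j.
        (let J = frechet_derivative (transition c d) (at (coord c q)) in
         g c (coord c q) $ i $ j =
           (\<Sum>k\<in>UNIV. \<Sum>l\<in>UNIV. g d (coord d q) $ k $ l * J (axis i 1) $ k * J (axis j 1) $ l)))"

definition hermitian_manifold ::
  "('a::{t2_space, second_countable_topology}, complex^'m::finite) chart set \<Rightarrow> ('a, 'm) hmetric \<Rightarrow> bool" where
  "hermitian_manifold A h \<longleftrightarrow> complex_atlas A \<and> hermitian_metric A h"

definition riemannian_manifold ::
  "('b::{t2_space, second_countable_topology}, real^'n::finite) chart set \<Rightarrow> ('b, 'n) rmetric \<Rightarrow> bool" where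
  "riemannian_manifold B g \<longleftrightarrow> smooth_atlas B \<and> riemannian_metric B g"


section \<open>Levi-Civita connection and curvature in a chart\<close>

(* Here G is the matrix function of a Riemannian metric in some chart. *)
definition christoffel :: "(real^'n::finite \<Rightarrow> real^'n^'n) \<Rightarrow> 'n \<Rightarrow> 'n \<Rightarrow> 'n \<Rightarrow> real^'n \<Rightarrow> real" where
  "christoffel G i j k y = (1/2) * (\<Sum>l\<in>UNIV. matrix_inv (G y) $ i $ l *
     (partial (\<lambda>x. G x $ k $ l) j y + partial (\<lambda>x. G x $ j $ l) k y - partial (\<lambda>x. G x $ j $ k) l y))"

definition covariant_deriv ::
  "(real^'n::finite \<Rightarrow> real^'n^'n) \<Rightarrow> (real^'n \<Rightarrow> real^'n) \<Rightarrow> (real^'n \<Rightarrow> real^'n) \<Rightarrow> real^'n \<Rightarrow> real^'n" where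
  "covariant_deriv G X Y y = frechet_derivative Y (at y) (X y) +
     (\<chi> i. \<Sum>j\<in>UNIV. \<Sum>k\<in>UNIV. christoffel G i j k y * X y $ j * Y y $ k)"

definition lie_bracket ::
  "(real^'n::finite \<Rightarrow> real^'n) \<Rightarrow> (real^'n \<Rightarrow> real^'n) \<Rightarrow> real^'n \<Rightarrow> real^'n" where
  "lie_bracket X Y y = frechet_derivative Y (at y) (X y) - frechet_derivative X (at y) (Y y)"

definition curvature_op ::
  "(real^'n::finite \<Rightarrow> real^'n^'n) \<Rightarrow> (real^'n \<Rightarrow> real^'n) \<Rightarrow> (real^'n \<Rightarrow> real^'n) \<Rightarrow>
   (real^'n \<Rightarrow> real^'n) \<Rightarrow> real^'n \<Rightarrow> real^'n" where
  "curvature_op G X Y Z y =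
     covariant_deriv G X (covariant_deriv G Y Z) y - covariant_deriv G Y (covariant_deriv G X Z) y
     - covariant_deriv G (lie_bracket X Y) Z y"

(* R_{ijkl} = g(R(d_i, d_j) d_k, d_l) *)
definition curvature ::
  "(real^'n::finite \<Rightarrow> real^'n^'n) \<Rightarrow> 'n \<Rightarrow> 'n \<Rightarrow> 'n \<Rightarrow> 'n \<Rightarrow> real^'n \<Rightarrow> real" where
  "curvature G i j k l y =
     (\<Sum>s\<in>UNIV. G y $ s $ l *
        curvature_op G (\<lambda>_. axis i 1) (\<lambda>_. axis j 1) (\<lambda>_. axis k 1) y $ s)"


section \<open>Pluri-harmonic maps\<close>

definition local_rep :: "('a, 'e) chart \<Rightarrow> ('b, 'f) chart \<Rightarrow> ('a \<Rightarrow> 'b) \<Rightarrow> 'e \<Rightarrow> 'f" where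
  "local_rep c d f = coord d \<circ> f \<circ> cinv c"

definition smooth_map ::
  "('a::topological_space, 'e::euclidean_space) chart set \<Rightarrow>
   ('b::topological_space, 'f::euclidean_space) chart set \<Rightarrow> ('a \<Rightarrow> 'b) \<Rightarrow> bool" where
  "smooth_map A B f \<longleftrightarrow> continuous_on UNIV f \<and>
     (\<forall>c\<in>A. \<forall>d\<in>B. Cinf_on (local_rep c d f) (coord c ` (cdom c \<inter> f -` cdom d)))"

definition cmap ::
  "('a, complex^'m) chart \<Rightarrow> ('b, real^'n) chart \<Rightarrow> ('a \<Rightarrow> 'b) \<Rightarrow> 'n \<Rightarrow> complex^'m \<Rightarrow> complex" where
  "cmap c d f i z = of_real (local_rep c d f z $ i)"

abbreviation fdz ::
  "('a, complex^'m::finite) chart \<Rightarrow> ('b, real^'n) chart \<Rightarrow> ('a \<Rightarrow> 'b) \<Rightarrow> 'n \<Rightarrow> 'm \<Rightarrow> complex^'m \<Rightarrow> complex" where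
  "fdz c d f i \<equiv> dz (cmap c d f i)"

abbreviation fdzbar ::
  "('a, complex^'m::finite) chart \<Rightarrow> ('b, real^'n) chart \<Rightarrow> ('a \<Rightarrow> 'b) \<Rightarrow> 'n \<Rightarrow> 'm \<Rightarrow> complex^'m \<Rightarrow> complex" where
  "fdzbar c d f i \<equiv> dzbar (cmap c d f i)"

definition pluriharmonic ::
  "('a::{t2_space, second_countable_topology}, complex^'m::finite) chart set \<Rightarrow>
   ('b::{t2_space, second_countable_topology}, real^'n::finite) chart set \<Rightarrow> ('b, 'n) rmetric \<Rightarrow>
   ('a \<Rightarrow> 'b) \<Rightarrow> bool" where
  "pluriharmonic A B g f \<longleftrightarrow> smooth_map A B f \<and>
     (\<forall>c\<in>A. \<forall>d\<in>B. \<forall>p\<in>cdom c \<inter> f -` cdom d. \<forall>i \<alpha> \<beta>.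
        dz (fdzbar c d f i \<beta>) \<alpha> (coord c p) +
        (\<Sum>j\<in>UNIV. \<Sum>k\<in>UNIV. of_real (christoffel (g d) i j k (coord d (f p))) *
           fdzbar c d f j \<beta> (coord c p) * fdz c d f k \<alpha> (coord c p)) = 0)"


section \<open>The projectivized tangent bundle\<close>

(* A vector of the holomorphic tangent space at p is the family of its component vectors
   (W^\<alpha>) with respect to d/dz^\<alpha> in all charts around p. *)
type_synonym ('a, 'm) tvector = "('a, complex^'m) chart \<Rightarrow> complex^'m"

definition tangent_space ::
  "('a, complex^'m::finite) chart set \<Rightarrow> 'a \<Rightarrow> ('a, 'm) tvector set" where
  "tangent_space A p = {v. (\<forall>c. \<not> (c \<in> A \<and> p \<in> cdom c) \<longrightarrow> v c = 0) \<and>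
     (\<forall>c\<in>A. \<forall>d\<in>A. p \<in> cdom c \<inter> cdom d \<longrightarrow>
        v d = frechet_derivative (transition c d) (at (coord c p)) (v c))}"

definition tvec ::
  "('a, complex^'m::finite) chart set \<Rightarrow> ('a, complex^'m) chart \<Rightarrow> 'a \<Rightarrow> complex^'m \<Rightarrow> ('a, 'm) tvector" where
  "tvec A c p W = (\<lambda>d. if d \<in> A \<and> p \<in> cdom d
     then frechet_derivative (transition c d) (at (coord c p)) W else 0)"

definition cline :: "('a, 'm::finite) tvector \<Rightarrow> ('a, 'm) tvector set" where
  "cline v = {\<lambda>c. s *s v c | s. True}"

definition proj_tangent_bundle ::
  "('a, complex^'m::finite) chart set \<Rightarrow> ('a \<times> ('a, 'm) tvector set) set" where
  "proj_tangent_bundle A = {(p, L). \<exists>v\<in>tangent_space A p. v \<noteq> (\<lambda>_. 0) \<and> L = cline v}"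

(* The holomorphic charts of P(T_M) are indexed by pairs (c, \<nu>), with c a chart of M and \<nu> an
   index such that W^\<nu> does not vanish; the coordinates are z^\<alpha> and w^\<gamma> = W^\<gamma> / W^\<nu> for
   \<gamma> \<noteq> \<nu>.  We write them as a vector indexed by 'm + 'm, z^\<alpha> being the entry Inl \<alpha> and w^\<gamma> the
   entry Inr \<gamma>.  The entry Inr \<nu> is not a coordinate: proj_coord sets it to 1 and proj_point
   disregards it. *)
definition proj_chart_dom ::
  "('a, complex^'m::finite) chart set \<Rightarrow> ('a, complex^'m) chart \<Rightarrow> 'm \<Rightarrow> ('a \<times> ('a, 'm) tvector set) set" where
  "proj_chart_dom A c \<nu> = {(p, L) \<in> proj_tangent_bundle A. p \<in> cdom c \<and> (\<exists>v\<in>L. v c $ \<nu> \<noteq> 0)}"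

definition proj_coord ::
  "('a, complex^'m::finite) chart \<Rightarrow> 'm \<Rightarrow> 'a \<times> ('a, 'm) tvector set \<Rightarrow> complex^('m + 'm)" where
  "proj_coord c \<nu> \<xi> = (let v = (SOME v. v \<in> snd \<xi> \<and> v c $ \<nu> \<noteq> 0) in
     \<chi> I. case I of Inl \<alpha> \<Rightarrow> coord c (fst \<xi>) $ \<alpha> | Inr \<gamma> \<Rightarrow> v c $ \<gamma> / v c $ \<nu>)"

definition base_pt :: "('a, complex^'m::finite) chart \<Rightarrow> complex^('m + 'm) \<Rightarrow> 'a" where
  "base_pt c \<zeta> = cinv c (\<chi> \<alpha>. \<zeta> $ Inl \<alpha>)"

(* The holomorphic section of the tautological bundle with W^\<nu> = 1. *)
definition lift_vec ::
  "('a, complex^'m::finite) chart set \<Rightarrow> ('a, complex^'m) chart \<Rightarrow> 'm \<Rightarrow> complex^('m + 'm) \<Rightarrow> ('a, 'm) tvector" where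
  "lift_vec A c \<nu> \<zeta> = tvec A c (base_pt c \<zeta>) (\<chi> \<gamma>. if \<gamma> = \<nu> then 1 else \<zeta> $ Inr \<gamma>)"

definition proj_point ::
  "('a, complex^'m::finite) chart set \<Rightarrow> ('a, complex^'m) chart \<Rightarrow> 'm \<Rightarrow> complex^('m + 'm) \<Rightarrow>
   'a \<times> ('a, 'm) tvector set" where
  "proj_point A c \<nu> \<zeta> = (base_pt c \<zeta>, cline (lift_vec A c \<nu> \<zeta>))"


section \<open>Real (1,1)-forms on the projectivized tangent bundle\<close>

(* The form i * (sum over I, J of a_{IJ} d\<zeta>^I \<and> d\<zeta>bar^J) at a point of the chart (c, \<nu>) is
   represented by the matrix a, whose rows and columns at Inr \<nu> are meaningless.  It is
   semi-positive iff a_{IJ} V^I Vbar^J is real and nonnegative for all (1,0)-vectors V; in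
   particular a is then Hermitian, that is, the form is real. *)
definition semipositive :: "'m::finite \<Rightarrow> complex^('m + 'm)^('m + 'm) \<Rightarrow> bool" where
  "semipositive \<nu> a \<longleftrightarrow> (\<forall>V :: complex^('m + 'm). V $ Inr \<nu> = 0 \<longrightarrow>
     (\<Sum>I\<in>UNIV. \<Sum>J\<in>UNIV. a $ I $ J * V $ I * cnj (V $ J)) \<in> \<real>\<^sub>\<ge>\<^sub>0)"

definition form_ge ::
  "'m::finite \<Rightarrow> complex^('m + 'm)^('m + 'm) \<Rightarrow> complex^('m + 'm)^('m + 'm) \<Rightarrow> bool" where
  "form_ge \<nu> a b \<longleftrightarrow> semipositive \<nu> (a - b)"

definition ddbar_coeffs :: "(complex^'k::finite \<Rightarrow> complex) \<Rightarrow> complex^'k \<Rightarrow> complex^'k^'k" where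
  "ddbar_coeffs u \<zeta> = (\<chi> I J. dz (dzbar u J) I \<zeta>)"

(* i ddbar u for a function u on P(T_M) *)
definition ddbar_fun ::
  "('a, complex^'m::finite) chart set \<Rightarrow> ('a, complex^'m) chart \<Rightarrow> 'm \<Rightarrow>
   ('a \<times> ('a, 'm) tvector set \<Rightarrow> complex) \<Rightarrow> 'a \<times> ('a, 'm) tvector set \<Rightarrow> complex^('m + 'm)^('m + 'm)" where
  "ddbar_fun A c \<nu> u \<xi> = ddbar_coeffs (u \<circ> proj_point A c \<nu>) (proj_coord c \<nu> \<xi>)"


section \<open>The functions H and Y\<close>

definition hform ::
  "('a, 'm::finite) hmetric \<Rightarrow> ('a, complex^'m) chart \<Rightarrow> complex^'m \<Rightarrow> complex^'m \<Rightarrow> real" where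
  "hform h c z W = Re (\<Sum>\<gamma>\<in>UNIV. \<Sum>\<delta>\<in>UNIV. h c z $ \<gamma> $ \<delta> * W $ \<gamma> * cnj (W $ \<delta>))"

(* The function H on T_M; see H_fun_eq. *)
definition H_fun ::
  "('a, complex^'m::finite) chart set \<Rightarrow> ('a, 'm) hmetric \<Rightarrow> 'a \<Rightarrow> ('a, 'm) tvector \<Rightarrow> real" where
  "H_fun A h p v = (THE r. \<forall>c\<in>A. p \<in> cdom c \<longrightarrow> r = hform h c (coord c p) (v c))"

definition yform ::
  "('a, 'm::finite) hmetric \<Rightarrow> ('b, 'n::finite) rmetric \<Rightarrow> ('a \<Rightarrow> 'b) \<Rightarrow> ('a, complex^'m) chart \<Rightarrow>
   ('b, real^'n) chart \<Rightarrow> 'a \<Rightarrow> complex^'m \<Rightarrow> complex" where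
  "yform h g f c d p W =
     (\<Sum>i\<in>UNIV. \<Sum>j\<in>UNIV. \<Sum>\<alpha>\<in>UNIV. \<Sum>\<beta>\<in>UNIV. of_real (g d (coord d (f p)) $ i $ j) *
        fdz c d f i \<alpha> (coord c p) * cnj (fdz c d f j \<beta> (coord c p)) * W $ \<alpha> * cnj (W $ \<beta>))
     / of_real (hform h c (coord c p) W)"

(* The function Y on P(T_M): the common value of the expression above in all charts and for
   all nonzero vectors of the line; see Y_fun_eq. *)
definition Y_fun ::
  "('a, complex^'m::finite) chart set \<Rightarrow> ('a, 'm) hmetric \<Rightarrow> ('b, real^'n::finite) chart set \<Rightarrow>
   ('b, 'n) rmetric \<Rightarrow> ('a \<Rightarrow> 'b) \<Rightarrow> 'a \<times> ('a, 'm) tvector set \<Rightarrow> complex" where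
  "Y_fun A h B g f \<xi> = (THE y. \<forall>c\<in>A. \<forall>d\<in>B. \<forall>v\<in>snd \<xi>.
     fst \<xi> \<in> cdom c \<and> f (fst \<xi>) \<in> cdom d \<and> v \<noteq> (\<lambda>_. 0) \<longrightarrow> y = yform h g f c d (fst \<xi>) (v c))"

(* i ddbar log H^{-1} on P(T_M), computed with the section W^\<nu> = 1; any other local holomorphic
   section gives the same form. *)
definition ddbar_log_Hinv ::
  "('a, complex^'m::finite) chart set \<Rightarrow> ('a, 'm) hmetric \<Rightarrow> ('a, complex^'m) chart \<Rightarrow> 'm \<Rightarrow>
   'a \<times> ('a, 'm) tvector set \<Rightarrow> complex^('m + 'm)^('m + 'm)" where
  "ddbar_log_Hinv A h c \<nu> \<xi> =
     ddbar_coeffs (\<lambda>\<zeta>. of_real (ln (inverse (H_fun A h (base_pt c \<zeta>) (lift_vec A c \<nu> \<zeta>)))))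
       (proj_coord c \<nu> \<xi>)"

(* i R_{ilkj} f^i_\<alpha> f^j_\<beta>bar f^k_\<gamma> f^l_\<delta>bar W^\<gamma> Wbar^\<delta> dz^\<alpha> \<and> dzbar^\<beta>  at p, where W = v c *)
definition curvature_form ::
  "('b, 'n::finite) rmetric \<Rightarrow> ('a \<Rightarrow> 'b) \<Rightarrow> ('a, complex^'m::finite) chart \<Rightarrow> ('b, real^'n) chart \<Rightarrow>
   'a \<Rightarrow> ('a, 'm) tvector \<Rightarrow> complex^('m + 'm)^('m + 'm)" where
  "curvature_form g f c d p v = (\<chi> I J. case (I, J) of
       (Inl \<alpha>, Inl \<beta>) \<Rightarrow>
         (\<Sum>i\<in>UNIV. \<Sum>j\<in>UNIV. \<Sum>k\<in>UNIV. \<Sum>l\<in>UNIV. \<Sum>\<gamma>\<in>UNIV. \<Sum>\<delta>\<in>UNIV.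
            of_real (curvature (g d) i l k j (coord d (f p))) *
            fdz c d f i \<alpha> (coord c p) * fdzbar c d f j \<beta> (coord c p) *
            fdz c d f k \<gamma> (coord c p) * fdzbar c d f l \<delta> (coord c p) *
            v c $ \<gamma> * cnj (v c $ \<delta>))
     | _ \<Rightarrow> 0)"


section \<open>Independence of the charts\<close>

lemma chart_cinv: "p \<in> cdom c \<Longrightarrow> is_chart c \<Longrightarrow> cinv c (coord c p) = p"
  and chart_coord: "z \<in> crange c \<Longrightarrow> is_chart c \<Longrightarrow> coord c (cinv c z) = z"
  and cinv_cdom: "z \<in> crange c \<Longrightarrow> is_chart c \<Longrightarrow> cinv c z \<in> cdom c"
  unfolding is_chart_def homeomorphism_def by auto

lemma open_coord_image:
  assumes "is_chart c" "open S"
  shows "open (coord c ` (cdom c \<inter> S))"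
proof -
  have "coord c ` (cdom c \<inter> S) = crange c \<inter> cinv c -` S"
  proof (intro equalityI subsetI)
    fix z assume "z \<in> coord c ` (cdom c \<inter> S)"
    then show "z \<in> crange c \<inter> cinv c -` S"
      by (auto simp: crange_def chart_cinv[OF _ assms(1)])
  next
    fix z assume "z \<in> crange c \<inter> cinv c -` S"
    then have "coord c (cinv c z) = z" "cinv c z \<in> cdom c \<inter> S"
      by (simp_all add: chart_coord cinv_cdom assms(1))
    then show "z \<in> coord c ` (cdom c \<inter> S)" by (metis image_eqI)
  qed
  moreover have "open (crange c \<inter> cinv c -` S)"
    using assms unfolding is_chart_def homeomorphism_def
    by (intro continuous_open_preimage) auto
  ultimately show ?thesis by simp
qed

lemma Cinf_on_has_derivative:
  assumes "Cinf_on F S" "x \<in> S"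
  shows "(F has_derivative frechet_derivative F (at x)) (at x)"
proof -
  have "Ck_on (Suc 0) F S" using assms(1) unfolding Cinf_on_def by blast
  then show ?thesis using assms(2) by (simp add: frechet_derivative_works)
qed

lemma transition_chain:
  assumes ch: "is_chart c" "is_chart d" "is_chart e" and p: "p \<in> cdom c" "p \<in> cdom d" "p \<in> cdom e"
    and cd: "Cinf_on (transition c d) (coord c ` (cdom c \<inter> cdom d))"
    and de: "Cinf_on (transition d e) (coord d ` (cdom d \<inter> cdom e))"
  shows "frechet_derivative (transition c e) (at (coord c p)) v =
    frechet_derivative (transition d e) (at (coord d p)) (frechet_derivative (transition c d) (at (coord c p)) v)"
proof -
  let ?S = "coord c ` (cdom c \<inter> (cdom d \<inter> cdom e))"
  have eq: "transition c d (coord c p) = coord d p"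
    by (simp add: transition_def chart_cinv ch p)
  have 1: "(transition c d has_derivative frechet_derivative (transition c d) (at (coord c p))) (at (coord c p))"
    by (rule Cinf_on_has_derivative[OF cd]) (use p in auto)
  have 2: "(transition d e has_derivative frechet_derivative (transition d e) (at (coord d p)))
      (at (transition c d (coord c p)))"
    unfolding eq by (rule Cinf_on_has_derivative[OF de]) (use p in auto)
  have "((transition d e \<circ> transition c d) has_derivative
     (frechet_derivative (transition d e) (at (coord d p)) \<circ> frechet_derivative (transition c d) (at (coord c p))))
     (at (coord c p))"
    by (rule diff_chain_at[OF 1 2])
  then have "(transition c e has_derivative
     (frechet_derivative (transition d e) (at (coord d p)) \<circ> frechet_derivative (transition c d) (at (coord c p))))
     (at (coord c p))"
  proof (rule has_derivative_transform_within_open[where s = ?S])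
    show "open ?S"
      using ch by (intro open_coord_image) (auto simp: is_chart_def)
    show "coord c p \<in> ?S" using p by auto
    fix z assume "z \<in> ?S"
    then show "(transition d e \<circ> transition c d) z = transition c e z"
      using ch by (auto simp: transition_def chart_cinv)
  qed
  from fun_cong[OF frechet_derivative_at[OF this], of v] show ?thesis by simp
qed

lemma transition_self:
  assumes ch: "is_chart c" and p: "p \<in> cdom c"
  shows "frechet_derivative (transition c c) (at (coord c p)) v = v"
proof -
  have "(transition c c has_derivative (\<lambda>v. v)) (at (coord c p))"
  proof (rule has_derivative_transform_within_open[where s = "crange c"])
    show "((\<lambda>v. v) has_derivative (\<lambda>v. v)) (at (coord c p))" by (rule has_derivative_ident)
    show "open (crange c)" using ch by (simp add: is_chart_def)
    show "coord c p \<in> crange c" using p by (simp add: crange_def)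
    show "z = transition c c z" if "z \<in> crange c" for z
      using that ch by (simp add: transition_def chart_coord)
  qed
  from fun_cong[OF frechet_derivative_at[OF this], of v] show ?thesis by simp
qed

lemma complex_atlasD:
  assumes "complex_atlas A" "c \<in> A"
  shows "is_chart c"
    and "d \<in> A \<Longrightarrow> Cinf_on (transition c d) (coord c ` (cdom c \<inter> cdom d))"
    and "d \<in> A \<Longrightarrow> p \<in> cdom c \<Longrightarrow> p \<in> cdom d \<Longrightarrow>
      frechet_derivative (transition c d) (at (coord c p)) (s *s v) =
      s *s frechet_derivative (transition c d) (at (coord c p)) v"
  using assms unfolding complex_atlas_def holomorphic_map_on_def by auto

lemma complex_atlas_linear:
  assumes "complex_atlas A" "c \<in> A" "d \<in> A" "p \<in> cdom c" "p \<in> cdom d"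
  shows "linear (frechet_derivative (transition c d) (at (coord c p)))"
  using Cinf_on_has_derivative[OF complex_atlasD(2)[OF assms(1-3)]] assms(4,5)
  by (auto intro: has_derivative_linear)

lemma tvec_in_tangent_space:
  assumes A: "complex_atlas A" and c: "c \<in> A" "p \<in> cdom c"
  shows "tvec A c p W \<in> tangent_space A p" and "tvec A c p W c = W"
proof -
  show "tvec A c p W \<in> tangent_space A p"
    unfolding tangent_space_def
  proof (intro CollectI conjI allI ballI impI)
    fix d assume "\<not> (d \<in> A \<and> p \<in> cdom d)"
    then show "tvec A c p W d = 0" by (auto simp: tvec_def)
  next
    fix d e assume de: "d \<in> A" "e \<in> A" "p \<in> cdom d \<inter> cdom e"
    have "frechet_derivative (transition c e) (at (coord c p)) W =
      frechet_derivative (transition d e) (at (coord d p)) (frechet_derivative (transition c d) (at (coord c p)) W)"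
      by (rule transition_chain) (use complex_atlasD(1,2)[OF A] c de in auto)
    then show "tvec A c p W e = frechet_derivative (transition d e) (at (coord d p)) (tvec A c p W d)"
      using de by (simp add: tvec_def)
  qed
  show "tvec A c p W c = W"
    using c by (simp add: tvec_def transition_self[OF complex_atlasD(1)[OF A]])
qed

lemma tangent_spaceD:
  assumes "v \<in> tangent_space A p"
  shows "\<not> (c \<in> A \<and> p \<in> cdom c) \<Longrightarrow> v c = 0"
    and "c \<in> A \<Longrightarrow> p \<in> cdom c \<Longrightarrow> d \<in> A \<Longrightarrow> p \<in> cdom d \<Longrightarrow>
      v d = frechet_derivative (transition c d) (at (coord c p)) (v c)"
  using assms unfolding tangent_space_def by blast+

lemma tangent_space_eq_tvec:
  assumes "v \<in> tangent_space A p" "c \<in> A" "p \<in> cdom c"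
  shows "v = tvec A c p (v c)"
proof
  fix d show "v d = tvec A c p (v c) d"
    using tangent_spaceD(1)[OF assms(1), of d] tangent_spaceD(2)[OF assms, of d]
    unfolding tvec_def by presburger
qed

lemma cline_smult_subset: "cline (\<lambda>c. s *s v c) \<subseteq> cline v"
proof
  fix u assume "u \<in> cline (\<lambda>c. s *s v c)"
  then obtain t where "u = (\<lambda>c. t *s (s *s v c))" unfolding cline_def by blast
  then have "u = (\<lambda>c. (t * s) *s v c)" by (simp add: vector_smult_assoc)
  then show "u \<in> cline v" unfolding cline_def by blast
qed

lemma cline_smult:
  assumes "s \<noteq> 0" shows "cline (\<lambda>c. s *s v c) = cline v"
proof
  have "cline (\<lambda>c. inverse s *s (s *s v c)) \<subseteq> cline (\<lambda>c. s *s v c)"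
    by (rule cline_smult_subset)
  then show "cline v \<subseteq> cline (\<lambda>c. s *s v c)" using assms by (simp add: vector_smult_assoc)
qed (rule cline_smult_subset)

lemma cline_in_tangent_space:
  assumes A: "complex_atlas A" and v: "v \<in> tangent_space A p" and u: "u \<in> cline v"
  shows "u \<in> tangent_space A p"
proof -
  obtain s where s: "u = (\<lambda>c. s *s v c)" using u unfolding cline_def by blast
  show ?thesis
    unfolding tangent_space_def
  proof (intro CollectI conjI allI ballI impI)
    fix d assume "\<not> (d \<in> A \<and> p \<in> cdom d)"
    then show "u d = 0" unfolding s by (simp add: tangent_spaceD(1)[OF v])
  next
    fix d e assume de: "d \<in> A" "e \<in> A" "p \<in> cdom d \<inter> cdom e"
    then show "u e = frechet_derivative (transition d e) (at (coord d p)) (u d)"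
      unfolding s using complex_atlasD(3)[OF A, of d e p s "v d"] tangent_spaceD(2)[OF v, of d e] by simp
  qed
qed

lemma tangent_nonzero_comp:
  assumes A: "complex_atlas A" and v: "v \<in> tangent_space A p" "v \<noteq> (\<lambda>_. 0)" and c: "c \<in> A" "p \<in> cdom c"
  shows "v c \<noteq> 0"
proof
  assume "v c = 0"
  then have "v = tvec A c p 0" using tangent_space_eq_tvec[OF v(1) c] by simp
  also have "\<dots> = (\<lambda>_. 0)"
    using complex_atlas_linear[OF A c(1) _ c(2)] by (auto simp: tvec_def linear_0)
  finally show False using v(2) by simp
qed

lemma sum_hermitian_product:
  fixes G :: complex
  shows "G * (\<Sum>\<alpha>\<in>S. a \<alpha>) * cnj (\<Sum>\<beta>\<in>T. b \<beta>) = (\<Sum>\<alpha>\<in>S. \<Sum>\<beta>\<in>T. G * a \<alpha> * cnj (b \<beta>))"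
  by (subst mult.assoc, subst cnj_sum, subst sum_product) (simp add: sum_distrib_left mult.assoc)

lemma quadratic_pullback:
  fixes H :: "'x::finite \<Rightarrow> 'x \<Rightarrow> complex" and P :: "'y::finite \<Rightarrow> 'x \<Rightarrow> complex"
  shows "(\<Sum>\<alpha>\<in>UNIV. \<Sum>\<beta>\<in>UNIV. (\<Sum>\<gamma>\<in>UNIV. \<Sum>\<delta>\<in>UNIV. H \<gamma> \<delta> * P \<alpha> \<gamma> * cnj (P \<beta> \<delta>)) * W \<alpha> * cnj (W \<beta>)) =
    (\<Sum>\<gamma>\<in>UNIV. \<Sum>\<delta>\<in>UNIV. H \<gamma> \<delta> * (\<Sum>\<alpha>\<in>UNIV. P \<alpha> \<gamma> * W \<alpha>) * cnj (\<Sum>\<beta>\<in>UNIV. P \<beta> \<delta> * W \<beta>))"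
    (is "?L = ?R")
proof -
  let ?t = "\<lambda>\<alpha> \<beta> \<gamma> \<delta>. H \<gamma> \<delta> * P \<alpha> \<gamma> * cnj (P \<beta> \<delta>) * W \<alpha> * cnj (W \<beta>)"
  have "?L = (\<Sum>\<alpha>\<in>UNIV. \<Sum>\<beta>\<in>UNIV. \<Sum>\<gamma>\<in>UNIV. \<Sum>\<delta>\<in>UNIV. ?t \<alpha> \<beta> \<gamma> \<delta>)"
    by (simp add: sum_distrib_right)
  also have "\<dots> = (\<Sum>\<alpha>\<in>UNIV. \<Sum>\<gamma>\<in>UNIV. \<Sum>\<beta>\<in>UNIV. \<Sum>\<delta>\<in>UNIV. ?t \<alpha> \<beta> \<gamma> \<delta>)"
    by (intro sum.cong refl, rule sum.swap)
  also have "\<dots> = (\<Sum>\<gamma>\<in>UNIV. \<Sum>\<alpha>\<in>UNIV. \<Sum>\<beta>\<in>UNIV. \<Sum>\<delta>\<in>UNIV. ?t \<alpha> \<beta> \<gamma> \<delta>)"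
    by (rule sum.swap)
  also have "\<dots> = (\<Sum>\<gamma>\<in>UNIV. \<Sum>\<alpha>\<in>UNIV. \<Sum>\<delta>\<in>UNIV. \<Sum>\<beta>\<in>UNIV. ?t \<alpha> \<beta> \<gamma> \<delta>)"
    by (intro sum.cong refl, rule sum.swap)
  also have "\<dots> = (\<Sum>\<gamma>\<in>UNIV. \<Sum>\<delta>\<in>UNIV. \<Sum>\<alpha>\<in>UNIV. \<Sum>\<beta>\<in>UNIV. ?t \<alpha> \<beta> \<gamma> \<delta>)"
    by (intro sum.cong refl, rule sum.swap)
  also have "\<dots> = ?R"
  proof (intro sum.cong refl)
    fix \<gamma> \<delta>
    show "(\<Sum>\<alpha>\<in>UNIV. \<Sum>\<beta>\<in>UNIV. ?t \<alpha> \<beta> \<gamma> \<delta>) =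
      H \<gamma> \<delta> * (\<Sum>\<alpha>\<in>UNIV. P \<alpha> \<gamma> * W \<alpha>) * cnj (\<Sum>\<beta>\<in>UNIV. P \<beta> \<delta> * W \<beta>)"
      unfolding sum_hermitian_product
      by (intro sum.cong refl) (simp add: mult_ac)
  qed
  finally show ?thesis .
qed

lemma hform_invariant:
  assumes A: "complex_atlas A" and h: "hermitian_metric A h" and c: "c \<in> A" "p \<in> cdom c"
    and d: "d \<in> A" "p \<in> cdom d" and v: "v \<in> tangent_space A p"
  shows "hform h c (coord c p) (v c) = hform h d (coord d p) (v d)"
proof -
  let ?J = "frechet_derivative (transition c d) (at (coord c p))"
  have vd: "v d = ?J (v c)" by (rule tangent_spaceD(2)[OF v c d])
  have lin: "linear ?J" by (rule complex_atlas_linear[OF A c(1) d(1) c(2) d(2)])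
  have "?J (v c) = ?J (\<Sum>\<alpha>\<in>UNIV. v c $ \<alpha> *s axis \<alpha> 1)" by (simp add: basis_expansion)
  also have "\<dots> = (\<Sum>\<alpha>\<in>UNIV. v c $ \<alpha> *s ?J (axis \<alpha> 1))"
    by (simp add: linear_sum[OF lin] complex_atlasD(3)[OF A c(1) d(1) c(2) d(2)])
  finally have vd': "v d $ \<gamma> = (\<Sum>\<alpha>\<in>UNIV. ?J (axis \<alpha> 1) $ \<gamma> * v c $ \<alpha>)" for \<gamma>
    by (simp add: vd sum_component mult.commute)
  have hc: "h c (coord c p) $ \<alpha> $ \<beta> =
      (\<Sum>\<gamma>\<in>UNIV. \<Sum>\<delta>\<in>UNIV. h d (coord d p) $ \<gamma> $ \<delta> * ?J (axis \<alpha> 1) $ \<gamma> * cnj (?J (axis \<beta> 1) $ \<delta>))"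
    for \<alpha> \<beta>
    using h c d unfolding hermitian_metric_def Let_def by blast
  show ?thesis
    unfolding hform_def hc vd' quadratic_pullback[where W = "\<lambda>\<alpha>. v c $ \<alpha>"] ..
qed

lemma H_fun_eq:
  assumes "hermitian_manifold A h" and c: "c \<in> A" "p \<in> cdom c" and v: "v \<in> tangent_space A p"
  shows "H_fun A h p v = hform h c (coord c p) (v c)"
  unfolding H_fun_def
proof (rule the_equality)
  have A: "complex_atlas A" "hermitian_metric A h"
    using assms(1) unfolding hermitian_manifold_def by auto
  show "\<forall>c'\<in>A. p \<in> cdom c' \<longrightarrow> hform h c (coord c p) (v c) = hform h c' (coord c' p) (v c')"
    using hform_invariant[OF A c _ _ v] by blast
qed (use c in blast)

lemma dz_contract:
  fixes F :: "complex^'m::finite \<Rightarrow> real^'n::finite"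
  assumes F: "(F has_derivative D) (at z)"
  shows "(\<Sum>\<alpha>\<in>UNIV. dz (\<lambda>x. of_real (F x $ i)) \<alpha> z * W $ \<alpha>) =
    (of_real (D W $ i) - \<i> * of_real (D (\<i> *s W) $ i)) / 2"
proof -
  have lin: "linear D" using F by (rule has_derivative_linear)
  have "((\<lambda>x. complex_of_real (F x $ i)) has_derivative (\<lambda>v. of_real (D v $ i))) (at z)"
    by (intro has_derivative_of_real bounded_linear.has_derivative[OF bounded_linear_vec_nth] F)
  from frechet_derivative_at[OF this]
  have fd: "frechet_derivative (\<lambda>x. complex_of_real (F x $ i)) (at z) = (\<lambda>v. of_real (D v $ i))" by simp
  have ax: "axis \<alpha> w = Re w *\<^sub>R axis \<alpha> (1::complex) + Im w *\<^sub>R axis \<alpha> \<i>" for \<alpha> :: 'm and w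
    by (vector axis_def) (simp add: complex_eq_iff)
  have Dax: "D (axis \<alpha> w) = Re w *\<^sub>R D (axis \<alpha> 1) + Im w *\<^sub>R D (axis \<alpha> \<i>)" for \<alpha> w
    by (subst ax) (simp add: linear_add[OF lin] linear_scale[OF lin])
  have exp: "U = (\<Sum>\<alpha>\<in>UNIV. axis \<alpha> (U $ \<alpha>))" for U :: "complex^'m"
    by (simp add: vec_eq_iff axis_def)
  have DU: "D U $ i = (\<Sum>\<alpha>\<in>UNIV. Re (U $ \<alpha>) * D (axis \<alpha> 1) $ i + Im (U $ \<alpha>) * D (axis \<alpha> \<i>) $ i)" for U
  proof -
    have "D U = (\<Sum>\<alpha>\<in>UNIV. D (axis \<alpha> (U $ \<alpha>)))"
      by (subst exp[of U]) (simp add: linear_sum[OF lin])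
    also have "\<dots> = (\<Sum>\<alpha>\<in>UNIV. Re (U $ \<alpha>) *\<^sub>R D (axis \<alpha> 1) + Im (U $ \<alpha>) *\<^sub>R D (axis \<alpha> \<i>))"
      by (intro sum.cong refl Dax)
    finally show ?thesis by simp
  qed
  have "(\<Sum>\<alpha>\<in>UNIV. dz (\<lambda>x. of_real (F x $ i)) \<alpha> z * W $ \<alpha>) =
    (\<Sum>\<alpha>\<in>UNIV. (of_real (Re (W $ \<alpha>) * D (axis \<alpha> 1) $ i + Im (W $ \<alpha>) * D (axis \<alpha> \<i>) $ i)
      - \<i> * of_real (Re (\<i> * W $ \<alpha>) * D (axis \<alpha> 1) $ i + Im (\<i> * W $ \<alpha>) * D (axis \<alpha> \<i>) $ i)) / 2)"
    by (intro sum.cong refl) (simp add: dz_def fd complex_eq_iff algebra_simps)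
  also have "\<dots> = (of_real (D W $ i) - \<i> * of_real (D (\<i> *s W) $ i)) / 2"
    unfolding DU[of W] DU[of "\<i> *s W"]
    by (simp only: sum_divide_distrib[symmetric] sum_subtractf sum_distrib_left[symmetric] of_real_sum
        vector_smult_component)
  finally show ?thesis .
qed

definition fcontract ::
  "('a, complex^'m::finite) chart \<Rightarrow> ('b, real^'n::finite) chart \<Rightarrow> ('a \<Rightarrow> 'b) \<Rightarrow> 'a \<Rightarrow> complex^'m \<Rightarrow> 'n \<Rightarrow> complex" where
  "fcontract c d f p W i = (\<Sum>\<alpha>\<in>UNIV. fdz c d f i \<alpha> (coord c p) * W $ \<alpha>)"

lemma yform_fcontract:
  "yform h g f c d p W = (\<Sum>i\<in>UNIV. \<Sum>j\<in>UNIV. of_real (g d (coord d (f p)) $ i $ j) *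
     fcontract c d f p W i * cnj (fcontract c d f p W j)) / of_real (hform h c (coord c p) W)"
proof -
  have "(\<Sum>\<alpha>\<in>UNIV. \<Sum>\<beta>\<in>UNIV. G * a \<alpha> * cnj (b \<beta>) * W $ \<alpha> * cnj (W $ \<beta>)) =
    G * (\<Sum>\<alpha>\<in>UNIV. a \<alpha> * W $ \<alpha>) * cnj (\<Sum>\<beta>\<in>UNIV. b \<beta> * W $ \<beta>)" for G a b
    unfolding sum_hermitian_product
    by (intro sum.cong refl) (simp add: mult_ac)
  then show ?thesis unfolding yform_def fcontract_def by simp
qed

lemma fcontract_transform:
  assumes A: "complex_atlas A" and B: "smooth_atlas B" and f: "smooth_map A B f"
    and c: "c \<in> A" "p \<in> cdom c" "c' \<in> A" "p \<in> cdom c'"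
    and d: "d \<in> B" "f p \<in> cdom d" "d' \<in> B" "f p \<in> cdom d'"
    and v: "v \<in> tangent_space A p"
  shows "fcontract c' d' f p (v c') k = (\<Sum>i\<in>UNIV.
    of_real (frechet_derivative (transition d d') (at (coord d (f p))) (axis i 1) $ k) * fcontract c d f p (v c) i)"
proof -
  let ?z = "coord c p" and ?z' = "coord c' p" and ?y = "coord d (f p)"
  let ?F = "local_rep c d f" and ?F' = "local_rep c' d' f"
  let ?J = "frechet_derivative (transition c' c) (at ?z')"
  let ?K = "frechet_derivative (transition d d') (at ?y)"
  let ?D = "frechet_derivative ?F (at ?z)"
  have ch: "is_chart c" "is_chart c'" using complex_atlasD(1)[OF A] c by auto
  have chB: "is_chart d" "is_chart d'" using B d unfolding smooth_atlas_def by auto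
  have DJ: "(transition c' c has_derivative ?J) (at ?z')"
    by (rule Cinf_on_has_derivative[OF complex_atlasD(2)[OF A c(3) c(1)]]) (use c in auto)
  have DF: "(?F has_derivative ?D) (at ?z)"
    by (rule Cinf_on_has_derivative[where S = "coord c ` (cdom c \<inter> f -` cdom d)"])
       (use f c d in \<open>auto simp: smooth_map_def\<close>)
  have DK: "(transition d d' has_derivative ?K) (at ?y)"
    by (rule Cinf_on_has_derivative[where S = "coord d ` (cdom d \<inter> cdom d')"])
       (use B d in \<open>auto simp: smooth_atlas_def\<close>)
  have e1: "transition c' c ?z' = ?z" by (simp add: transition_def chart_cinv ch c)
  have e2: "?F ?z = ?y" by (simp add: local_rep_def chart_cinv ch c)
  have "((transition d d' \<circ> (?F \<circ> transition c' c)) has_derivative (?K \<circ> (?D \<circ> ?J))) (at ?z')"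
    by (intro diff_chain_at DJ) (simp_all add: e1 e2 DF DK)
  then have DF': "(?F' has_derivative (?K \<circ> (?D \<circ> ?J))) (at ?z')"
  proof (rule has_derivative_transform_within_open
      [where s = "coord c' ` (cdom c' \<inter> (cdom c \<inter> f -` (cdom d \<inter> cdom d')))"])
    have "open (f -` (cdom d \<inter> cdom d'))"
      using f chB unfolding smooth_map_def is_chart_def by (intro open_vimage) auto
    then show "open (coord c' ` (cdom c' \<inter> (cdom c \<inter> f -` (cdom d \<inter> cdom d'))))"
      using ch by (intro open_coord_image) (auto simp: is_chart_def)
    show "?z' \<in> coord c' ` (cdom c' \<inter> (cdom c \<inter> f -` (cdom d \<inter> cdom d')))" using c d by auto
    fix x assume "x \<in> coord c' ` (cdom c' \<inter> (cdom c \<inter> f -` (cdom d \<inter> cdom d')))"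
    then show "(transition d d' \<circ> (?F \<circ> transition c' c)) x = ?F' x"
      using ch chB by (auto simp: transition_def local_rep_def chart_cinv)
  qed
  have J: "?J (v c') = v c" "?J (\<i> *s v c') = \<i> *s v c"
    using tangent_spaceD(2)[OF v c(3,4,1,2)] complex_atlasD(3)[OF A c(3) c(1) c(4) c(2)] by simp_all
  have linK: "linear ?K" using DK by (rule has_derivative_linear)
  have K: "?K u $ k = (\<Sum>i\<in>UNIV. ?K (axis i 1) $ k * u $ i)" for u
  proof -
    have "?K u = ?K (\<Sum>i\<in>UNIV. u $ i *s axis i 1)" by (simp add: basis_expansion)
    then show ?thesis
      by (simp add: linear_sum[OF linK] sum_component scalar_mult_eq_scaleR linear_scale[OF linK] mult.commute)
  qed
  have "fcontract c' d' f p (v c') k = (of_real (?K (?D (v c)) $ k) - \<i> * of_real (?K (?D (\<i> *s v c)) $ k)) / 2"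
    unfolding fcontract_def cmap_def[abs_def] dz_contract[OF DF'] by (simp add: J)
  also have "\<dots> = (\<Sum>i\<in>UNIV. of_real (?K (axis i 1) $ k) *
      ((of_real (?D (v c) $ i) - \<i> * of_real (?D (\<i> *s v c) $ i)) / 2))"
    unfolding K[of "?D (v c)"] K[of "?D (\<i> *s v c)"]
    by (simp add: sum_distrib_left sum_subtractf[symmetric] sum_divide_distrib algebra_simps diff_divide_distrib)
  also have "\<dots> = (\<Sum>i\<in>UNIV. of_real (?K (axis i 1) $ k) * fcontract c d f p (v c) i)"
    unfolding fcontract_def cmap_def[abs_def] dz_contract[OF DF] ..
  finally show ?thesis .
qed

lemma yform_invariant:
  assumes M: "hermitian_manifold A h" and N: "riemannian_manifold B g" and f: "smooth_map A B f"
    and c: "c \<in> A" "p \<in> cdom c" "c' \<in> A" "p \<in> cdom c'"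
    and d: "d \<in> B" "f p \<in> cdom d" "d' \<in> B" "f p \<in> cdom d'"
    and v: "v \<in> tangent_space A p"
  shows "yform h g f c d p (v c) = yform h g f c' d' p (v c')"
proof -
  have A: "complex_atlas A" "hermitian_metric A h" and B: "smooth_atlas B" "riemannian_metric B g"
    using M N unfolding hermitian_manifold_def riemannian_manifold_def by auto
  let ?K = "frechet_derivative (transition d d') (at (coord d (f p)))"
  have "g d (coord d (f p)) $ i $ j =
     (\<Sum>k\<in>UNIV. \<Sum>l\<in>UNIV. g d' (coord d' (f p)) $ k $ l * ?K (axis i 1) $ k * ?K (axis j 1) $ l)" for i j
    using B(2) d unfolding riemannian_metric_def Let_def by blast
  then have g: "complex_of_real (g d (coord d (f p)) $ i $ j) =
     (\<Sum>k\<in>UNIV. \<Sum>l\<in>UNIV. of_real (g d' (coord d' (f p)) $ k $ l) * of_real (?K (axis i 1) $ k) *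
       cnj (of_real (?K (axis j 1) $ l)))" for i j by simp
  show ?thesis
    unfolding yform_fcontract g quadratic_pullback
      fcontract_transform[OF A(1) B(1) f c d v]
      hform_invariant[OF A c v] ..
qed

lemma yform_smult:
  assumes "s \<noteq> 0"
  shows "yform h g f c d p (s *s W) = yform h g f c d p W"
proof -
  have 1: "fcontract c d f p (s *s W) i = s * fcontract c d f p W i" for i
    by (simp add: fcontract_def sum_distrib_left mult_ac)
  have 2: "(\<Sum>\<gamma>\<in>UNIV. \<Sum>\<delta>\<in>UNIV. h c z $ \<gamma> $ \<delta> * (s *s W) $ \<gamma> * cnj ((s *s W) $ \<delta>)) =
     of_real ((cmod s)\<^sup>2) * (\<Sum>\<gamma>\<in>UNIV. \<Sum>\<delta>\<in>UNIV. h c z $ \<gamma> $ \<delta> * W $ \<gamma> * cnj (W $ \<delta>))" for z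
    unfolding complex_norm_square by (simp add: sum_distrib_left mult_ac)
  have 3: "hform h c z (s *s W) = (cmod s)\<^sup>2 * hform h c z W" for z
    unfolding hform_def 2 by simp
  have 4: "(\<Sum>i\<in>UNIV. \<Sum>j\<in>UNIV. of_real (G $ i $ j) * fcontract c d f p (s *s W) i * cnj (fcontract c d f p (s *s W) j)) =
    of_real ((cmod s)\<^sup>2) * (\<Sum>i\<in>UNIV. \<Sum>j\<in>UNIV. of_real (G $ i $ j) * fcontract c d f p W i * cnj (fcontract c d f p W j))"
    for G :: "real^_^_"
    unfolding complex_norm_square 1 by (simp add: sum_distrib_left mult_ac)
  show ?thesis using assms unfolding yform_fcontract 3 4 by simp
qed

lemma Y_fun_eq:
  assumes M: "hermitian_manifold A h" and N: "riemannian_manifold B g" and f: "smooth_map A B f"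
    and \<xi>: "(p, L) \<in> proj_tangent_bundle A" and c: "c \<in> A" "p \<in> cdom c" and d: "d \<in> B" "f p \<in> cdom d"
    and v: "v \<in> L" "v \<noteq> (\<lambda>_. 0)"
  shows "Y_fun A h B g f (p, L) = yform h g f c d p (v c)"
proof -
  have A: "complex_atlas A" using M unfolding hermitian_manifold_def by auto
  obtain w where w: "w \<in> tangent_space A p" "L = cline w"
    using \<xi> unfolding proj_tangent_bundle_def by auto
  have *: "yform h g f c' d' p (u c') = yform h g f c d p (w c)"
    if u: "c' \<in> A" "p \<in> cdom c'" "d' \<in> B" "f p \<in> cdom d'" "u \<in> L" "u \<noteq> (\<lambda>_. 0)" for c' d' u
  proof -
    obtain s where s':  "u = (\<lambda>c. s *s w c)" using u(5) w(2) unfolding cline_def by auto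
    then have s: "s \<noteq> 0" using u(6) by auto
    show ?thesis unfolding s' yform_smult[OF s]
      by (rule yform_invariant[OF M N f u(1,2) c u(3,4) d w(1)])
  qed
  show ?thesis
    unfolding Y_fun_def fst_conv snd_conv
  proof (rule the_equality)
    show "\<forall>c'\<in>A. \<forall>d'\<in>B. \<forall>u\<in>L. p \<in> cdom c' \<and> f p \<in> cdom d' \<and> u \<noteq> (\<lambda>_. 0) \<longrightarrow>
        yform h g f c d p (v c) = yform h g f c' d' p (u c')"
      using *[OF c d v] * by presburger
  qed (use c d v in blast)
qed

lemma proj_coord_eq:
  assumes "(p, L) \<in> proj_chart_dom A c \<nu>" and v: "v \<in> L" "v \<noteq> (\<lambda>_. 0)"
  shows "v c $ \<nu> \<noteq> 0"
    and "proj_coord c \<nu> (p, L) = (\<chi> I. case I of Inl \<alpha> \<Rightarrow> coord c p $ \<alpha> | Inr \<gamma> \<Rightarrow> v c $ \<gamma> / v c $ \<nu>)"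
proof -
  obtain w where w: "w \<in> tangent_space A p" "L = cline w"
    using assms unfolding proj_chart_dom_def proj_tangent_bundle_def by auto
  let ?u = "SOME v. v \<in> L \<and> v c $ \<nu> \<noteq> 0"
  have "\<exists>v. v \<in> L \<and> v c $ \<nu> \<noteq> 0" using assms(1) unfolding proj_chart_dom_def by auto
  then have u: "?u \<in> L" "?u c $ \<nu> \<noteq> 0" by (metis (mono_tags, lifting) someI_ex)+
  obtain t where t: "?u = (\<lambda>c. t *s w c)" using u(1) w unfolding cline_def by auto
  obtain s where s: "v = (\<lambda>c. s *s w c)" using v w unfolding cline_def by auto
  have "s \<noteq> 0" using v s by auto
  moreover have "t \<noteq> 0" "w c $ \<nu> \<noteq> 0" using u(2) unfolding t by auto
  ultimately show "v c $ \<nu> \<noteq> 0"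
    and "proj_coord c \<nu> (p, L) = (\<chi> I. case I of Inl \<alpha> \<Rightarrow> coord c p $ \<alpha> | Inr \<gamma> \<Rightarrow> v c $ \<gamma> / v c $ \<nu>)"
    unfolding proj_coord_def Let_def snd_conv t s by (auto simp: vec_eq_iff split: sum.split)
qed

lemma proj_point_coord:
  assumes A: "complex_atlas A" and c: "c \<in> A" and \<xi>: "\<xi> \<in> proj_chart_dom A c \<nu>"
  shows "proj_point A c \<nu> (proj_coord c \<nu> \<xi>) = \<xi>"
proof -
  obtain p L where pL: "\<xi> = (p, L)" by (cases \<xi>)
  obtain w where w: "w \<in> tangent_space A p" "w \<noteq> (\<lambda>_. 0)" "L = cline w" and p: "p \<in> cdom c"
    using \<xi> unfolding pL proj_chart_dom_def proj_tangent_bundle_def by auto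
  have "w = (\<lambda>c. 1 *s w c)" by simp
  then have "w \<in> L" unfolding w(3) cline_def by blast
  note eq = proj_coord_eq[OF \<xi>[unfolded pL] this w(2)]
  let ?s = "inverse (w c $ \<nu>)"
  let ?u = "\<lambda>c. ?s *s w c"
  have "?u \<in> tangent_space A p"
    by (rule cline_in_tangent_space[OF A w(1)]) (auto simp: cline_def)
  then have u: "tvec A c p (?u c) = ?u"
    by (rule tangent_space_eq_tvec[OF _ c p, symmetric])
  have b: "base_pt c (proj_coord c \<nu> \<xi>) = p"
    unfolding base_pt_def pL eq(2) by (simp add: chart_cinv complex_atlasD(1)[OF A c] p)
  have "(\<chi> \<gamma>. if \<gamma> = \<nu> then 1 else proj_coord c \<nu> \<xi> $ Inr \<gamma>) = ?u c"
    unfolding pL eq(2) using eq(1) by (auto simp: vec_eq_iff field_simps)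
  then have "lift_vec A c \<nu> (proj_coord c \<nu> \<xi>) = ?u"
    unfolding lift_vec_def b using u by simp
  then show ?thesis
    unfolding proj_point_def using cline_smult[of ?s w] eq(1) w(3) b pL by simp
qed

lemma proj_charts_cover:
  assumes A: "complex_atlas A" and \<xi>: "\<xi> \<in> proj_tangent_bundle A"
  shows "\<exists>c\<in>A. \<exists>\<nu>. \<xi> \<in> proj_chart_dom A c \<nu>"
proof -
  obtain p L where pL: "\<xi> = (p, L)" by (cases \<xi>)
  obtain w where w: "w \<in> tangent_space A p" "w \<noteq> (\<lambda>_. 0)" "L = cline w"
    using \<xi> unfolding pL proj_tangent_bundle_def by auto
  obtain c where c: "c \<in> A" "p \<in> cdom c"
  proof -
    have "p \<in> (\<Union>c\<in>A. cdom c)" using A unfolding complex_atlas_def by simp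
    then show ?thesis using that by blast
  qed
  from tangent_nonzero_comp[OF A w(1,2) c] obtain \<nu> where "w c $ \<nu> \<noteq> 0"
    by (auto simp: vec_eq_iff)
  moreover have "w = (\<lambda>c. 1 *s w c)" by simp
  then have "w \<in> L" unfolding w(3) cline_def by blast
  ultimately show ?thesis using c \<xi> unfolding pL proj_chart_dom_def by blast
qed

end

theory Submission
  imports Defs
begin

text \<open>
  On a chart of the projectivized bundle use the coordinates \<open>\<zeta> = (z, w)\<close> and the
  holomorphic section \<open>W\<close> of the tautological bundle with \<open>W\<^sup>\<nu> = 1\<close>.  Then
  \<open>u\<^sup>i = f\<^sup>i\<^sub>\<alpha> W\<^sup>\<alpha>\<close> is a section of the complexified pullback of the tangent bundle of
  \<open>N\<close>, and \<open>Y = g(u, cnj u) / H\<close>.  Let \<open>\<nabla>\<close> be the pullback of the Levi-Civita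
  connection and write \<open>V\<close> and \<open>V'\<close> for differentiation along a constant (1,0)-vector and
  along its conjugate.  By pluri-harmonicity \<open>\<nabla>\<close> in any (0,1)-direction kills every
  \<open>f\<^sub>\<alpha>\<close>; as the \<open>W\<^sup>\<alpha>\<close> are holomorphic, it kills \<open>u\<close> too.  Hence only two
  terms survive when \<open>g(u, cnj u)\<close> is differentiated twice (lemma \<open>energy_mixed\<close>):
  \<open>V V' g(u, cnj u) = |\<nabla>\<^sub>V u|\<^sup>2 + g(u, R(f\<^sub>V, f\<^sub>V\<^sub>') cnj u)\<close>, the second one being the commutator
  of the covariant derivatives (lemma \<open>nabla_commutator\<close>).

  Put \<open>\<phi> = - log H\<close>, so that \<open>Y = g(u, cnj u) exp \<phi>\<close>.  The terms of \<open>V V' Y\<close> with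
  first derivatives of \<open>\<phi>\<close> complete the square:
  \<open>V V' Y - Y V V' \<phi> = (|\<nabla>\<^sub>V u + (V \<phi>) u|\<^sup>2 + g(u, R(f\<^sub>V, f\<^sub>V\<^sub>') cnj u)) / H\<close>
  (lemma \<open>bochner_identity\<close>).  The square is nonnegative, so it remains to recognize the last
  term.

  In the claim the same four vectors stand in other slots of the curvature tensor.  Skew-symmetry
  in the last pair and the first Bianchi identity turn one expression into the other up to
  \<open>R(f\<^sub>V\<^sub>', cnj u) f\<^sub>V\<close>.  This vanishes: it is a combination of commutators of
  two (0,1)-derivatives of \<open>f\<^sub>V\<close>, and each of these derivatives is zero already
  (lemmas \<open>curvature_antiholo_antiholo\<close> and \<open>curvature_term\<close>).  So the difference of the
  two sides of the inequality is exactly the square.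
\<close>

section \<open>Functions of class \<open>C\<^sup>k\<close>\<close>

lemma Ck_on_SucD:
  assumes "Ck_on (Suc k) F S" "x \<in> S"
  shows "(F has_derivative frechet_derivative F (at x)) (at x)"
  using assms by (simp add: frechet_derivative_works)

lemma Ck_on_cong:
  assumes "open S" "\<And>x. x \<in> S \<Longrightarrow> F x = F' x" "Ck_on k F S"
  shows "Ck_on k F' S"
  using assms(2,3)
proof (induction k arbitrary: F F')
  case 0
  then show ?case by (simp cong: continuous_on_cong)
next
  case (Suc k)
  have d: "(F' has_derivative frechet_derivative F (at x)) (at x)" if "x \<in> S" for x
    using has_derivative_transform_within_open[OF Ck_on_SucD[OF Suc.prems(2) that] assms(1) that] Suc.prems(1)
    by auto
  have eq: "frechet_derivative F (at x) = frechet_derivative F' (at x)" if "x \<in> S" for x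
    using frechet_derivative_at[OF d[OF that]] .
  have "Ck_on k (\<lambda>x. frechet_derivative F' (at x) v) S" for v
  proof (rule Suc.IH)
    show "frechet_derivative F (at x) v = frechet_derivative F' (at x) v" if "x \<in> S" for x
      using eq[OF that] by simp
    show "Ck_on k (\<lambda>x. frechet_derivative F (at x) v) S" using Suc.prems(2) by simp
  qed
  with d show ?case by (auto simp: differentiable_def)
qed

text \<open>Allows the derivative to be given by a formula; the closure properties below then become
  inductions in which the derivative is again built from functions of the same kind.\<close>

lemma Ck_on_SucI:
  assumes "open S" "\<And>x. x \<in> S \<Longrightarrow> (F has_derivative F' x) (at x)" "\<And>v. Ck_on k (\<lambda>x. F' x v) S"
  shows "Ck_on (Suc k) F S"
proof -
  have "Ck_on k (\<lambda>x. frechet_derivative F (at x) v) S" for v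
    by (rule Ck_on_cong[OF assms(1) _ assms(3)[of v]]) (use frechet_derivative_at[OF assms(2)] in auto)
  then show ?thesis using assms(2) by (auto simp: differentiable_def)
qed

lemma Ck_on_pred: "Ck_on (Suc k) F S \<Longrightarrow> Ck_on k F S"
proof (induction k arbitrary: F)
  case 0
  then show ?case
    by (auto simp: continuous_on_eq_continuous_within intro!: differentiable_imp_continuous_within
        intro: differentiable_at_withinI)
next
  case (Suc k)
  then show ?case by (simp only: Ck_on.simps(2)[of "Suc k"] Ck_on.simps(2)[of k]) auto
qed

lemma Ck_on_subset: "Ck_on k F S \<Longrightarrow> S' \<subseteq> S \<Longrightarrow> Ck_on k F S'"
  by (induction k arbitrary: F) (auto intro: continuous_on_subset)

lemma Ck_on_const [simp]: "Ck_on k (\<lambda>x. c) S"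
  by (induction k arbitrary: c) auto

lemma Ck_on_compose_linear:
  assumes "open S" "bounded_linear L" "Ck_on k F S"
  shows "Ck_on k (\<lambda>x. L (F x)) S"
  using assms(3)
proof (induction k arbitrary: F)
  case 0
  then show ?case using bounded_linear.continuous_on[OF assms(2)] by simp
next
  case (Suc k)
  show ?case
  proof (rule Ck_on_SucI[OF assms(1)])
    show "((\<lambda>x. L (F x)) has_derivative (\<lambda>v. L (frechet_derivative F (at x) v))) (at x)" if "x \<in> S" for x
      by (rule bounded_linear.has_derivative[OF assms(2) Ck_on_SucD[OF Suc.prems that]])
    show "Ck_on k (\<lambda>x. L (frechet_derivative F (at x) v)) S" for v
      by (rule Suc.IH) (use Suc.prems in simp)
  qed
qed

lemma Ck_on_linear:
  assumes "bounded_linear L"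
  shows "Ck_on k L S"
proof (cases k)
  case 0
  then show ?thesis by (simp add: linear_continuous_on[OF assms])
next
  case (Suc l)
  have "(L has_derivative L) (at x)" for x by (rule bounded_linear_imp_has_derivative[OF assms])
  then have "frechet_derivative L (at x) = L" "L differentiable (at x)" for x
    by (auto simp: differentiable_def intro: frechet_derivative_at[symmetric])
  then show ?thesis unfolding Suc by simp
qed

lemma Ck_on_precompose_linear:
  fixes L :: "'e::euclidean_space \<Rightarrow> 'd::euclidean_space"
  assumes "open S" "bounded_linear L" "Ck_on k F T" "L ` S \<subseteq> T"
  shows "Ck_on k (\<lambda>x. F (L x)) S"
  using assms(3)
proof (induction k arbitrary: F)
  case 0
  then show ?case
    using continuous_on_compose2[OF _ linear_continuous_on[OF assms(2)] assms(4)] by simp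
next
  case (Suc k)
  show ?case
  proof (rule Ck_on_SucI[OF assms(1)])
    fix x assume "x \<in> S"
    then have "L x \<in> T" using assms(4) by auto
    from has_derivative_compose[OF bounded_linear_imp_has_derivative[OF assms(2)] Ck_on_SucD[OF Suc.prems this]]
    show "((\<lambda>x. F (L x)) has_derivative (\<lambda>v. frechet_derivative F (at (L x)) (L v))) (at x)" .
  next
    show "Ck_on k (\<lambda>x. frechet_derivative F (at (L x)) (L v)) S" for v
      by (rule Suc.IH) (use Suc.prems in simp)
  qed
qed

lemma Ck_on_add:
  assumes "open S" "Ck_on k F S" "Ck_on k G S"
  shows "Ck_on k (\<lambda>x. F x + G x) S"
  using assms(2,3)
proof (induction k arbitrary: F G)
  case 0
  then show ?case by (simp add: continuous_on_add)
next
  case (Suc k)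
  show ?case
    by (rule Ck_on_SucI[OF assms(1) has_derivative_add[OF Ck_on_SucD[OF Suc.prems(1)] Ck_on_SucD[OF Suc.prems(2)]]])
       (use Suc in auto)
qed

lemma Ck_on_sum:
  assumes "open S" "\<And>i. i \<in> I \<Longrightarrow> Ck_on k (F i) S"
  shows "Ck_on k (\<lambda>x. \<Sum>i\<in>I. F i x) S"
  using assms(2) by (induction I rule: infinite_finite_induct) (auto intro!: Ck_on_add assms(1))

lemma Ck_on_mult:
  fixes F G :: "'e::euclidean_space \<Rightarrow> 'v::real_normed_algebra"
  assumes "open S" "Ck_on k F S" "Ck_on k G S"
  shows "Ck_on k (\<lambda>x. F x * G x) S"
  using assms(2,3)
proof (induction k arbitrary: F G)
  case 0
  then show ?case by (simp add: continuous_on_mult)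
next
  case (Suc k)
  show ?case
    by (rule Ck_on_SucI[OF assms(1) has_derivative_mult[OF Ck_on_SucD[OF Suc.prems(1)] Ck_on_SucD[OF Suc.prems(2)]]])
       (use Suc Ck_on_pred[OF Suc.prems(1)] Ck_on_pred[OF Suc.prems(2)] in \<open>auto intro!: Ck_on_add assms(1)\<close>)
qed

lemma Ck_on_prod:
  fixes F :: "'i \<Rightarrow> 'e::euclidean_space \<Rightarrow> 'v::real_normed_field"
  assumes "open S" "\<And>i. i \<in> I \<Longrightarrow> Ck_on k (F i) S"
  shows "Ck_on k (\<lambda>x. \<Prod>i\<in>I. F i x) S"
  using assms(2) by (induction I rule: infinite_finite_induct) (auto intro!: Ck_on_mult assms(1))

lemma Ck_on_inverse:
  fixes F :: "'e::euclidean_space \<Rightarrow> 'v::real_normed_field"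
  assumes "open S" "\<And>x. x \<in> S \<Longrightarrow> F x \<noteq> 0" "Ck_on k F S"
  shows "Ck_on k (\<lambda>x. inverse (F x)) S"
  using assms(3)
proof (induction k)
  case 0
  then show ?case using assms(2) by (simp add: continuous_on_inverse)
next
  case (Suc k)
  note IH = Suc.IH[OF Ck_on_pred[OF Suc.prems]]
  show ?case
  proof (rule Ck_on_SucI[OF assms(1) Deriv.has_derivative_inverse[OF assms(2) Ck_on_SucD[OF Suc.prems]]])
    fix v
    have "Ck_on k (\<lambda>x. frechet_derivative F (at x) v) S" using Suc.prems by simp
    from Ck_on_mult[OF assms(1) Ck_on_mult[OF assms(1) IH this] IH]
    show "Ck_on k (\<lambda>x. - (inverse (F x) * frechet_derivative F (at x) v * inverse (F x))) S"
      by (rule Ck_on_compose_linear[OF assms(1) bounded_linear_minus[OF bounded_linear_ident]])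
  qed
qed

lemma Ck_on_ln:
  fixes F :: "'e::euclidean_space \<Rightarrow> real"
  assumes "open S" "\<And>x. x \<in> S \<Longrightarrow> F x > 0" "Ck_on k F S"
  shows "Ck_on k (\<lambda>x. ln (F x)) S"
proof (cases k)
  case 0
  then show ?thesis using assms(2,3) by (auto intro!: continuous_on_ln dest: assms(2))
next
  case (Suc l)
  note F = assms(3)[unfolded Suc]
  show ?thesis unfolding Suc
  proof (rule Ck_on_SucI[OF assms(1) has_derivative_ln[OF assms(2) Ck_on_SucD[OF F]]])
    fix v
    have "Ck_on l (\<lambda>x. frechet_derivative F (at x) v) S" using F by simp
    moreover have "Ck_on l (\<lambda>x. inverse (F x)) S"
      by (rule Ck_on_inverse[OF assms(1) _ Ck_on_pred[OF F]]) (use assms(2) in force)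
    ultimately show "Ck_on l (\<lambda>x. frechet_derivative F (at x) v * inverse (F x)) S"
      by (rule Ck_on_mult[OF assms(1)])
  qed
qed

lemma derivative_partial_expansion:
  fixes G :: "real^'n::finite \<Rightarrow> 'v::real_normed_vector"
  assumes "linear (frechet_derivative G (at y))"
  shows "frechet_derivative G (at y) v = (\<Sum>j\<in>UNIV. v $ j *\<^sub>R partial G j y)"
proof -
  have "frechet_derivative G (at y) v = frechet_derivative G (at y) (\<Sum>j\<in>UNIV. v $ j *s axis j 1)"
    by (simp add: basis_expansion)
  then show ?thesis
    by (simp add: linear_sum[OF assms] linear_scale[OF assms] scalar_mult_eq_scaleR partial_def)
qed

text \<open>The induction has to run over all \<open>G\<close> at once, because the chain rule replaces \<open>G\<close> by its
  partial derivatives.\<close>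

lemma Ck_on_compose:
  fixes y :: "'e::euclidean_space \<Rightarrow> real^'n::finite" and G :: "real^'n \<Rightarrow> real"
  assumes "open S" "y ` S \<subseteq> T" "Cinf_on G T" "Ck_on k y S"
  shows "Ck_on k (\<lambda>x. G (y x)) S"
  using assms(3,4)
proof (induction k arbitrary: G)
  case 0
  then have "continuous_on T G" unfolding Cinf_on_def using Ck_on.simps(1) by blast
  then show ?case using continuous_on_compose2[OF _ _ assms(2)] 0 by simp
next
  case (Suc k)
  have dG: "(G has_derivative frechet_derivative G (at (y x))) (at (y x))" if "x \<in> S" for x
    by (rule Cinf_on_has_derivative[OF Suc.prems(1)]) (use that assms(2) in auto)
  have G': "Cinf_on (partial G j) T" for j
    unfolding Cinf_on_def partial_def using Suc.prems(1) Ck_on.simps(2) Cinf_on_def by metis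
  show ?case
  proof (rule Ck_on_SucI[OF assms(1)])
    fix x assume x: "x \<in> S"
    from has_derivative_compose[OF Ck_on_SucD[OF Suc.prems(2) x] dG[OF x]]
    show "((\<lambda>x. G (y x)) has_derivative
       (\<lambda>v. \<Sum>j\<in>UNIV. frechet_derivative y (at x) v $ j * partial G j (y x))) (at x)"
      unfolding derivative_partial_expansion[OF has_derivative_linear[OF dG[OF x]]] by simp
  next
    fix v
    have "Ck_on k (\<lambda>x. frechet_derivative y (at x) v $ j) S" for j
      by (rule Ck_on_compose_linear[OF assms(1) bounded_linear_vec_nth]) (use Suc.prems in simp)
    then show "Ck_on k (\<lambda>x. \<Sum>j\<in>UNIV. frechet_derivative y (at x) v $ j * partial G j (y x)) S"
      by (intro Ck_on_sum Ck_on_mult assms(1) Suc.IH G' Ck_on_pred[OF Suc.prems(2)])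
  qed
qed

section \<open>Symmetry of second derivatives\<close>

text \<open>The mean value theorem, applied first in the direction \<open>u\<close> and then in the direction \<open>v\<close>,
  turns the difference quotient into the iterated derivative at a nearby point.  The quotient is
  symmetric in \<open>u\<close> and \<open>v\<close>, hence so is its limit.\<close>

lemma second_difference_tendsto:
  fixes f :: "'e::euclidean_space \<Rightarrow> real"
  assumes S: "open S" "x \<in> S" and f: "Ck_on 2 f S"
  shows "((\<lambda>s. (f (x + s *\<^sub>R u + s *\<^sub>R v) - f (x + s *\<^sub>R u) - f (x + s *\<^sub>R v) + f x) / s\<^sup>2) \<longlongrightarrow>
     frechet_derivative (\<lambda>z. frechet_derivative f (at z) u) (at x) v) (at_right 0)"
proof (rule tendstoI)
  fix e :: real assume e: "e > 0"
  let ?g = "\<lambda>z. frechet_derivative f (at z) u"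
  let ?h = "\<lambda>z. frechet_derivative ?g (at z) v"
  have f': "Ck_on (Suc (Suc 0)) f S" using f by (simp only: numeral_2_eq_2)
  have g: "Ck_on (Suc 0) ?g S" using f' by simp
  have df: "(f has_derivative frechet_derivative f (at z)) (at z)" if "z \<in> S" for z
    by (rule Ck_on_SucD[OF f' that])
  have dg: "(?g has_derivative frechet_derivative ?g (at z)) (at z)" if "z \<in> S" for z
    by (rule Ck_on_SucD[OF g that])
  have line: "((\<lambda>t. F (a + t *\<^sub>R w)) has_real_derivative frechet_derivative F (at (a + t *\<^sub>R w)) w) (at t)"
    if "(F has_derivative frechet_derivative F (at (a + t *\<^sub>R w))) (at (a + t *\<^sub>R w))"
    for F :: "'e \<Rightarrow> real" and a w t
  proof -
    have "((\<lambda>t. a + t *\<^sub>R w) has_derivative (\<lambda>t. t *\<^sub>R w)) (at t)"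
      by (auto intro!: derivative_eq_intros)
    from has_derivative_compose[OF this that] show ?thesis
      by (simp add: has_field_derivative_def linear_scale[OF has_derivative_linear[OF that]] mult.commute[of _ "frechet_derivative _ _ _"])
  qed
  have "continuous_on S ?h" using g by simp
  then have "isCont ?h x" using S by (simp add: continuous_on_eq_continuous_at)
  then have "(?h \<longlongrightarrow> ?h x) (nhds x)"
    by (rule tendsto_at_iff_tendsto_nhds[of ?h x, THEN iffD1, OF isContD])
  then have "\<forall>\<^sub>F z in nhds x. dist (?h z) (?h x) < e"
    using e by (rule tendstoD)
  then have "\<forall>\<^sub>F z in nhds x. z \<in> S \<and> dist (?h z) (?h x) < e"
    using eventually_nhds_in_open[OF S] by eventually_elim simp
  then obtain d where d: "d > 0" "\<And>z. dist z x < d \<Longrightarrow> z \<in> S \<and> dist (?h z) (?h x) < e"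
    unfolding eventually_nhds_metric by blast
  \<comment> \<open>parallelograms at \<open>x\<close> with sides \<open>t u\<close>, \<open>s v\<close> and \<open>t, s < ?r\<close> stay inside the ball\<close>
  let ?r = "d / (norm u + norm v + 1)"
  have r: "?r > 0" using d(1) by (intro divide_pos_pos) (auto simp: add_nonneg_pos)
  have near: "dist (x + t *\<^sub>R u + s *\<^sub>R v) x < d" if "0 \<le> t" "t \<le> r" "0 \<le> s" "s \<le> r" "r < ?r" for t s r
  proof -
    have "norm (t *\<^sub>R u + s *\<^sub>R v) \<le> t * norm u + s * norm v"
      using that norm_triangle_ineq[of "t *\<^sub>R u" "s *\<^sub>R v"] by simp
    also have "\<dots> \<le> r * norm u + r * norm v"
      using that by (intro add_mono mult_right_mono) auto
    also have "\<dots> \<le> r * (norm u + norm v + 1)" using that by (simp add: algebra_simps)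
    also have "\<dots> < d"
      using that(5) by (subst (asm) pos_less_divide_eq) (auto simp: add_nonneg_pos)
    finally show ?thesis by (simp add: dist_norm add.assoc)
  qed
  have "\<forall>\<^sub>F s in at_right 0. 0 < s \<and> s < ?r"
    unfolding eventually_at_right_field using r by (intro exI[of _ ?r]) auto
  then show "\<forall>\<^sub>F s in at_right 0. dist ((f (x + s *\<^sub>R u + s *\<^sub>R v) - f (x + s *\<^sub>R u) - f (x + s *\<^sub>R v) + f x) / s\<^sup>2) (?h x) < e"
  proof eventually_elim
    fix s :: real assume s: "0 < s \<and> s < ?r"
    let ?\<phi> = "\<lambda>t. f (x + s *\<^sub>R v + t *\<^sub>R u) - f (x + t *\<^sub>R u)"
    have "\<exists>t>0. t < s \<and> ?\<phi> s - ?\<phi> 0 = (s - 0) * (?g (x + s *\<^sub>R v + t *\<^sub>R u) - ?g (x + t *\<^sub>R u))"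
    proof (rule MVT2)
      fix t assume t: "0 \<le> t" "t \<le> s"
      have "x + s *\<^sub>R v + t *\<^sub>R u \<in> S" "x + t *\<^sub>R u \<in> S"
        using near[of t s s] near[of t s 0] d(2) t s by (auto simp: add_ac)
      then show "(?\<phi> has_real_derivative (?g (x + s *\<^sub>R v + t *\<^sub>R u) - ?g (x + t *\<^sub>R u))) (at t)"
        by (intro DERIV_diff line df)
    qed (use s in simp)
    then obtain t where t: "0 < t" "t < s"
      "?\<phi> s - ?\<phi> 0 = s * (?g (x + s *\<^sub>R v + t *\<^sub>R u) - ?g (x + t *\<^sub>R u))" by auto
    have "\<exists>r>0. r < s \<and> ?g (x + t *\<^sub>R u + s *\<^sub>R v) - ?g (x + t *\<^sub>R u + 0 *\<^sub>R v) = (s - 0) * ?h (x + t *\<^sub>R u + r *\<^sub>R v)"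
    proof (rule MVT2)
      fix r assume "0 \<le> r" "r \<le> s"
      then have "x + t *\<^sub>R u + r *\<^sub>R v \<in> S" using near[of t s r] d(2) t s by auto
      then show "((\<lambda>r. ?g (x + t *\<^sub>R u + r *\<^sub>R v)) has_real_derivative ?h (x + t *\<^sub>R u + r *\<^sub>R v)) (at r)"
        by (intro line dg)
    qed (use s in simp)
    then obtain r where r: "0 < r" "r < s"
      "?g (x + t *\<^sub>R u + s *\<^sub>R v) - ?g (x + t *\<^sub>R u) = s * ?h (x + t *\<^sub>R u + r *\<^sub>R v)" by auto
    have "f (x + s *\<^sub>R u + s *\<^sub>R v) - f (x + s *\<^sub>R u) - f (x + s *\<^sub>R v) + f x = ?\<phi> s - ?\<phi> 0"
      by (simp add: add_ac)
    also have "\<dots> = s\<^sup>2 * ?h (x + t *\<^sub>R u + r *\<^sub>R v)"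
      using t(3) r(3) by (simp add: add_ac power2_eq_square)
    finally have "(f (x + s *\<^sub>R u + s *\<^sub>R v) - f (x + s *\<^sub>R u) - f (x + s *\<^sub>R v) + f x) / s\<^sup>2 = ?h (x + t *\<^sub>R u + r *\<^sub>R v)"
      using s by simp
    moreover have "dist (?h (x + t *\<^sub>R u + r *\<^sub>R v)) (?h x) < e"
      using near[of t s r] d(2) t r s by auto
    ultimately show "dist ((f (x + s *\<^sub>R u + s *\<^sub>R v) - f (x + s *\<^sub>R u) - f (x + s *\<^sub>R v) + f x) / s\<^sup>2) (?h x) < e"
      by simp
  qed
qed

lemma second_derivative_symmetric_real:
  fixes f :: "'e::euclidean_space \<Rightarrow> real"
  assumes S: "open S" "x \<in> S" and f: "Ck_on 2 f S"
  shows "frechet_derivative (\<lambda>z. frechet_derivative f (at z) u) (at x) v =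
    frechet_derivative (\<lambda>z. frechet_derivative f (at z) v) (at x) u"
proof -
  let ?\<Delta> = "\<lambda>u v s. f (x + s *\<^sub>R u + s *\<^sub>R v) - f (x + s *\<^sub>R u) - f (x + s *\<^sub>R v) + f x"
  have swap: "?\<Delta> v u = ?\<Delta> u v" by (rule ext) (simp add: add_ac)
  have "((\<lambda>s. ?\<Delta> u v s / s\<^sup>2) \<longlongrightarrow> frechet_derivative (\<lambda>z. frechet_derivative f (at z) v) (at x) u) (at_right 0)"
    using second_difference_tendsto[OF assms, of v u] unfolding fun_cong[OF swap] .
  then show ?thesis
    by (rule tendsto_unique[OF trivial_limit_at_right_real second_difference_tendsto[OF assms, of u v]])
qed

lemma frechet_derivative_linear_compose:
  assumes "bounded_linear L" "F differentiable at x"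
  shows "frechet_derivative (\<lambda>z. L (F z)) (at x) v = L (frechet_derivative F (at x) v)"
  using frechet_derivative_at[OF bounded_linear.has_derivative[OF assms(1)
    assms(2)[unfolded frechet_derivative_works]]] by metis

lemma second_derivative_symmetric:
  fixes F :: "'e::euclidean_space \<Rightarrow> 'v::euclidean_space"
  assumes S: "open S" "x \<in> S" and F: "Ck_on 2 F S"
  shows "frechet_derivative (\<lambda>z. frechet_derivative F (at z) u) (at x) v =
    frechet_derivative (\<lambda>z. frechet_derivative F (at z) v) (at x) u"
proof (rule euclidean_eqI)
  fix b :: 'v assume "b \<in> Basis"
  let ?L = "\<lambda>y. y \<bullet> b"
  have bl: "bounded_linear ?L" by (rule bounded_linear_inner_left)
  have F': "Ck_on (Suc (Suc 0)) F S" using F by (simp only: numeral_2_eq_2)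
  have eq: "frechet_derivative (\<lambda>z. frechet_derivative F (at z) w) (at x) w' \<bullet> b =
     frechet_derivative (\<lambda>z. frechet_derivative (\<lambda>x. F x \<bullet> b) (at z) w) (at x) w'" for w w'
  proof -
    have "frechet_derivative (\<lambda>z. frechet_derivative F (at z) w) (at x) w' \<bullet> b =
      frechet_derivative (\<lambda>z. frechet_derivative F (at z) w \<bullet> b) (at x) w'"
      by (rule frechet_derivative_linear_compose[OF bl, symmetric]) (use F' S in simp)
    also have "\<dots> = frechet_derivative (\<lambda>z. frechet_derivative (\<lambda>x. F x \<bullet> b) (at z) w) (at x) w'"
    proof -
      have e: "frechet_derivative F (at z) w \<bullet> b = frechet_derivative (\<lambda>x. F x \<bullet> b) (at z) w" if "z \<in> S" for z
        by (rule frechet_derivative_linear_compose[OF bl, symmetric]) (use F' that in simp)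
      have "(\<lambda>z. frechet_derivative F (at z) w \<bullet> b) differentiable at x"
        by (rule differentiable_compose[OF bounded_linear_imp_differentiable[OF bl]]) (use F' S in simp)
      from frechet_derivative_transform_within_open[OF this S e] show ?thesis by simp
    qed
    finally show ?thesis .
  qed
  show "frechet_derivative (\<lambda>z. frechet_derivative F (at z) u) (at x) v \<bullet> b =
    frechet_derivative (\<lambda>z. frechet_derivative F (at z) v) (at x) u \<bullet> b"
    unfolding eq by (rule second_derivative_symmetric_real[OF S Ck_on_compose_linear[OF S(1) bl F]])
qed

section \<open>Smooth functions\<close>

lemma Cinf_on_differentiable: "Cinf_on F S \<Longrightarrow> x \<in> S \<Longrightarrow> F differentiable (at x)"
  using Cinf_on_has_derivative by (auto simp: differentiable_def)

lemma Cinf_on_frechet: "Cinf_on F S \<Longrightarrow> Cinf_on (\<lambda>x. frechet_derivative F (at x) v) S"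
  unfolding Cinf_on_def using Ck_on.simps(2) by metis

lemma Cinf_on_const [simp]: "Cinf_on (\<lambda>x. c) S" by (simp add: Cinf_on_def)
lemma Cinf_on_add: "open S \<Longrightarrow> Cinf_on F S \<Longrightarrow> Cinf_on G S \<Longrightarrow> Cinf_on (\<lambda>x. F x + G x) S"
  by (simp add: Cinf_on_def Ck_on_add)
lemma Cinf_on_sum: "open S \<Longrightarrow> (\<And>i. i \<in> I \<Longrightarrow> Cinf_on (F i) S) \<Longrightarrow> Cinf_on (\<lambda>x. \<Sum>i\<in>I. F i x) S"
  by (simp add: Cinf_on_def Ck_on_sum)
lemma Cinf_on_mult:
  fixes F G :: "'e::euclidean_space \<Rightarrow> 'v::real_normed_algebra"
  shows "open S \<Longrightarrow> Cinf_on F S \<Longrightarrow> Cinf_on G S \<Longrightarrow> Cinf_on (\<lambda>x. F x * G x) S"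
  by (simp add: Cinf_on_def Ck_on_mult)
lemma Cinf_on_compose_linear:
  "open S \<Longrightarrow> bounded_linear L \<Longrightarrow> Cinf_on F S \<Longrightarrow> Cinf_on (\<lambda>x. L (F x)) S"
  by (simp add: Cinf_on_def Ck_on_compose_linear)
lemma Cinf_on_diff: "open S \<Longrightarrow> Cinf_on F S \<Longrightarrow> Cinf_on G S \<Longrightarrow> Cinf_on (\<lambda>x. F x - G x) S"
  using Cinf_on_add[of S F "\<lambda>x. - G x"] Cinf_on_compose_linear[OF _ bounded_linear_minus[OF bounded_linear_ident], of S G]
  by simp
lemma Cinf_on_prod:
  fixes F :: "'i \<Rightarrow> 'e::euclidean_space \<Rightarrow> 'v::real_normed_field"
  shows "open S \<Longrightarrow> (\<And>i. i \<in> I \<Longrightarrow> Cinf_on (F i) S) \<Longrightarrow> Cinf_on (\<lambda>x. \<Prod>i\<in>I. F i x) S"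
  by (simp add: Cinf_on_def Ck_on_prod)
lemma Cinf_on_inverse:
  fixes F :: "'e::euclidean_space \<Rightarrow> 'v::real_normed_field"
  shows "open S \<Longrightarrow> (\<And>x. x \<in> S \<Longrightarrow> F x \<noteq> 0) \<Longrightarrow> Cinf_on F S \<Longrightarrow> Cinf_on (\<lambda>x. inverse (F x)) S"
  by (simp add: Cinf_on_def Ck_on_inverse)
lemma Cinf_on_ln:
  fixes F :: "'e::euclidean_space \<Rightarrow> real"
  shows "open S \<Longrightarrow> (\<And>x. x \<in> S \<Longrightarrow> F x > 0) \<Longrightarrow> Cinf_on F S \<Longrightarrow> Cinf_on (\<lambda>x. ln (F x)) S"
  by (simp add: Cinf_on_def Ck_on_ln)
lemma Cinf_on_compose:
  fixes y :: "'e::euclidean_space \<Rightarrow> real^'n::finite" and G :: "real^'n \<Rightarrow> real"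
  shows "open S \<Longrightarrow> y ` S \<subseteq> T \<Longrightarrow> Cinf_on G T \<Longrightarrow> Cinf_on y S \<Longrightarrow> Cinf_on (\<lambda>x. G (y x)) S"
  using Ck_on_compose unfolding Cinf_on_def[of y] Cinf_on_def[of "\<lambda>x. G (y x)"] by blast
lemma Cinf_on_matrix_entry:
  fixes G :: "'e::euclidean_space \<Rightarrow> 'v::euclidean_space^'n::finite^'m::finite"
  shows "open S \<Longrightarrow> Cinf_on G S \<Longrightarrow> Cinf_on (\<lambda>x. G x $ i $ j) S"
  using Cinf_on_compose_linear[OF _ bounded_linear_compose[OF bounded_linear_vec_nth bounded_linear_vec_nth], of S G i j]
  by simp

section \<open>Levi-Civita connection and curvature in a chart\<close>

lemma partial_cong:
  assumes "open T" "z \<in> T" "\<And>x. x \<in> T \<Longrightarrow> F x = F' x" "F differentiable (at z)"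
  shows "partial F l z = partial F' l z"
  unfolding partial_def by (simp add: frechet_derivative_transform_within_open[OF assms(4,1,2,3)])

lemma partial_eqI:
  "(F has_derivative D) (at z) \<Longrightarrow> partial F l z = D (axis l 1)"
  unfolding partial_def by (simp flip: frechet_derivative_at)

lemma partial_sum_mult:
  fixes F F' :: "'i::finite \<Rightarrow> real^'n::finite \<Rightarrow> real"
  assumes "\<And>s. F s differentiable (at z)" "\<And>s. F' s differentiable (at z)"
  shows "partial (\<lambda>x. \<Sum>s\<in>UNIV. F s x * F' s x) l z =
    (\<Sum>s\<in>UNIV. F s z * partial (F' s) l z + partial (F s) l z * F' s z)"
proof -
  have d: "(F s has_derivative frechet_derivative (F s) (at z)) (at z)"
    "(F' s has_derivative frechet_derivative (F' s) (at z)) (at z)" for s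
    using assms by (auto simp: frechet_derivative_works)
  have "((\<lambda>x. \<Sum>s\<in>UNIV. F s x * F' s x) has_derivative
     (\<lambda>h. \<Sum>s\<in>UNIV. F s z * frechet_derivative (F' s) (at z) h + frechet_derivative (F s) (at z) h * F' s z)) (at z)"
    by (intro has_derivative_sum has_derivative_mult d)
  from partial_eqI[OF this] show ?thesis by (simp add: partial_def)
qed

lemma partial_add:
  fixes F F' :: "real^'n::finite \<Rightarrow> real"
  assumes "F differentiable (at z)" "F' differentiable (at z)"
  shows "partial (\<lambda>x. F x + F' x) l z = partial F l z + partial F' l z"
  using partial_eqI[OF has_derivative_add[OF assms[unfolded frechet_derivative_works]]]
  by (simp add: partial_def)

lemma Cinf_on_partial: "Cinf_on F T \<Longrightarrow> Cinf_on (partial F l) T"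
  using Cinf_on_frechet[of F T "axis l 1"] unfolding partial_def[abs_def] .

lemma partial_commute:
  fixes F :: "real^'n::finite \<Rightarrow> real"
  assumes "open T" "z \<in> T" "Cinf_on F T"
  shows "partial (partial F i) j z = partial (partial F j) i z"
  unfolding partial_def[abs_def]
  by (rule second_derivative_symmetric[OF assms(1,2)]) (use assms(3) in \<open>simp add: Cinf_on_def\<close>)

lemma Cinf_on_det:
  fixes M :: "'e::euclidean_space \<Rightarrow> real^'n::finite^'n"
  assumes "open S" "\<And>i j. Cinf_on (\<lambda>x. M x $ i $ j) S"
  shows "Cinf_on (\<lambda>x. det (M x)) S"
  unfolding det_def by (intro Cinf_on_sum Cinf_on_mult Cinf_on_prod assms Cinf_on_const)

lemma matrix_inv_right:
  fixes M :: "'a::semiring_1^'n::finite^'m::finite"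
  assumes "invertible M"
  shows "M ** matrix_inv M = mat 1"
  using someI_ex[OF assms[unfolded invertible_def]] unfolding matrix_inv_def by blast

text \<open>The \<open>s\<close>-th component of \<open>R(\<partial>\<^sub>i, \<partial>\<^sub>j) \<partial>\<^sub>k\<close>.\<close>

definition riemann_coeff :: "(real^'n::finite \<Rightarrow> real^'n^'n) \<Rightarrow> 'n \<Rightarrow> 'n \<Rightarrow> 'n \<Rightarrow> 'n \<Rightarrow> real^'n \<Rightarrow> real" where
  "riemann_coeff G s i j k z = partial (christoffel G s j k) i z - partial (christoffel G s i k) j z
    + (\<Sum>l\<in>UNIV. christoffel G s i l z * christoffel G l j k z)
    - (\<Sum>l\<in>UNIV. christoffel G s j l z * christoffel G l i k z)"

locale riemannian_chart =
  fixes G :: "real^'n::finite \<Rightarrow> real^'n^'n" and T :: "(real^'n) set"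
  assumes open_T: "open T"
    and smooth_metric: "Cinf_on G T"
    and metric_sym: "z \<in> T \<Longrightarrow> G z $ i $ j = G z $ j $ i"
    and metric_pos: "z \<in> T \<Longrightarrow> v \<noteq> 0 \<Longrightarrow> 0 < (\<Sum>i\<in>UNIV. \<Sum>j\<in>UNIV. G z $ i $ j * v $ i * v $ j)"
begin

lemma metric_invertible: assumes "z \<in> T" shows "invertible (G z)"
proof -
  have "v = 0" if "G z *v v = 0" for v
  proof (rule ccontr)
    assume "v \<noteq> 0"
    have "(\<Sum>i\<in>UNIV. \<Sum>j\<in>UNIV. G z $ i $ j * v $ i * v $ j) = (\<Sum>i\<in>UNIV. v $ i * (G z *v v) $ i)"
      by (simp add: matrix_vector_mult_def sum_distrib_left mult_ac)
    with metric_pos[OF assms \<open>v \<noteq> 0\<close>] that show False by simp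
  qed
  then show ?thesis by (simp add: invertible_left_inverse matrix_left_invertible_ker)
qed

lemma metric_inverse:
  assumes "z \<in> T"
  shows "(\<Sum>i\<in>UNIV. G z $ i $ l * matrix_inv (G z) $ i $ m) = (if l = m then 1 else 0)"
proof -
  have "(\<Sum>i\<in>UNIV. G z $ i $ l * matrix_inv (G z) $ i $ m) = (G z ** matrix_inv (G z)) $ l $ m"
    by (simp add: matrix_matrix_mult_def metric_sym[OF assms, of l])
  also have "\<dots> = (if l = m then 1 else 0)"
    by (simp add: matrix_inv_right[OF metric_invertible[OF assms]] mat_def)
  finally show ?thesis .
qed

lemma smooth_entry: "Cinf_on (\<lambda>x. G x $ i $ j) T"
  by (rule Cinf_on_matrix_entry[OF open_T smooth_metric])

text \<open>By Cramer's rule the entries of the inverse are quotients of determinants.\<close>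

lemma smooth_inverse: "Cinf_on (\<lambda>x. matrix_inv (G x) $ i $ l) T"
proof -
  let ?M = "\<lambda>x. (\<chi> r j. if j = i then axis l 1 $ r else G x $ r $ j) :: real^'n^'n"
  have "Cinf_on (\<lambda>x. det (?M x) * inverse (det (G x))) T"
  proof (intro Cinf_on_mult Cinf_on_inverse Cinf_on_det open_T smooth_entry)
    show "det (G x) \<noteq> 0" if "x \<in> T" for x
      using metric_invertible[OF that] by (simp add: invertible_det_nz)
    show "Cinf_on (\<lambda>x. ?M x $ r $ j) T" for r j
      by (cases "j = i") (simp_all add: smooth_entry)
  qed
  then show ?thesis
    unfolding Cinf_on_def
  proof (elim all_forward, elim Ck_on_cong[OF open_T, rotated])
    fix x assume x: "x \<in> T"
    let ?v = "matrix_inv (G x) *v axis l 1"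
    have "G x *v ?v = axis l 1"
      by (simp add: matrix_vector_mul_assoc matrix_inv_right[OF metric_invertible[OF x]])
    then have "?v = (\<chi> k. det (\<chi> r j. if j = k then axis l 1 $ r else G x $ r $ j) / det (G x))"
      using cramer[of "G x" ?v "axis l 1"] metric_invertible[OF x] by (simp add: invertible_det_nz)
    then have "?v $ i = det (?M x) / det (G x)" by simp
    moreover have "?v $ i = matrix_inv (G x) $ i $ l"
      by (simp add: matrix_vector_mult_def axis_def if_distrib sum.delta cong: if_cong)
    ultimately show "det (?M x) * inverse (det (G x)) = matrix_inv (G x) $ i $ l"
      by (simp add: divide_inverse)
  qed
qed

lemma smooth_christoffel: "Cinf_on (christoffel G i j k) T"
  unfolding christoffel_def[abs_def]
  by (intro Cinf_on_sum Cinf_on_mult Cinf_on_add Cinf_on_diff Cinf_on_const smooth_inverse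
      Cinf_on_partial smooth_entry open_T)

lemma partial_metric_sym:
  assumes "z \<in> T"
  shows "partial (\<lambda>x. G x $ i $ j) l z = partial (\<lambda>x. G x $ j $ i) l z"
  by (rule partial_cong[OF open_T assms metric_sym Cinf_on_differentiable[OF smooth_entry assms]])

lemma christoffel_sym: "z \<in> T \<Longrightarrow> christoffel G i j k z = christoffel G i k j z"
  unfolding christoffel_def using partial_metric_sym[of z j k] by (simp add: add_ac)

lemma christoffel_lowered:
  assumes "z \<in> T"
  shows "(\<Sum>s\<in>UNIV. G z $ s $ l * christoffel G s j k z) =
    (partial (\<lambda>x. G x $ k $ l) j z + partial (\<lambda>x. G x $ j $ l) k z - partial (\<lambda>x. G x $ j $ k) l z) / 2"
proof -
  let ?B = "\<lambda>l. partial (\<lambda>x. G x $ k $ l) j z + partial (\<lambda>x. G x $ j $ l) k z - partial (\<lambda>x. G x $ j $ k) l z"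
  have "(\<Sum>s\<in>UNIV. G z $ s $ l * christoffel G s j k z) =
    (\<Sum>s\<in>UNIV. \<Sum>m\<in>UNIV. (G z $ s $ l * matrix_inv (G z) $ s $ m) * (?B m / 2))"
    unfolding christoffel_def by (simp add: sum_distrib_left sum_divide_distrib mult_ac)
  also have "\<dots> = (\<Sum>m\<in>UNIV. (\<Sum>s\<in>UNIV. G z $ s $ l * matrix_inv (G z) $ s $ m) * (?B m / 2))"
    by (subst sum.swap) (simp only: sum_distrib_right)
  also have "\<dots> = ?B l / 2"
    by (simp add: metric_inverse[OF assms] if_distribR if_distrib sum.delta cong: if_cong)
  finally show ?thesis .
qed

text \<open>The connection is metric: in the sum of the two lowered Christoffel symbols all partial
  derivatives of the metric cancel in pairs except the one on the left.\<close>

lemma metric_compatible: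
  assumes "z \<in> T"
  shows "partial (\<lambda>x. G x $ i $ j) l z =
    (\<Sum>s\<in>UNIV. G z $ s $ j * christoffel G s l i z) + (\<Sum>s\<in>UNIV. G z $ s $ i * christoffel G s l j z)"
  unfolding christoffel_lowered[OF assms]
  using partial_metric_sym[OF assms, of j i l] partial_metric_sym[OF assms, of l i j] partial_metric_sym[OF assms, of l j i]
  by (simp add: field_simps)

lemma riemann_bianchi:
  assumes "z \<in> T"
  shows "riemann_coeff G s i j k z + riemann_coeff G s j k i z + riemann_coeff G s k i j z = 0"
proof -
  have sw: "christoffel G s j k z = christoffel G s k j z" for s j k by (rule christoffel_sym[OF assms])
  have p: "partial (christoffel G s j k) i z = partial (christoffel G s k j) i z" for s j k i
    by (rule partial_cong[OF open_T assms christoffel_sym Cinf_on_differentiable[OF smooth_christoffel assms]])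
  show ?thesis
    unfolding riemann_coeff_def
    using p[of s i j k] p[of s i k j] p[of s j k i] sw[of _ i j] sw[of _ j k] sw[of _ i k]
    by simp
qed

text \<open>Differentiate \<open>metric_compatible\<close> once more and use that second partial derivatives of the
  metric commute.  The products of Christoffel symbols in which the metric joins the two factors
  are symmetric in \<open>i\<close> and \<open>j\<close>, so they drop out; what is left is the curvature, lowered at
  \<open>l\<close> and at \<open>k\<close>.\<close>

lemma riemann_skew:
  assumes z: "z \<in> T"
  shows "(\<Sum>s\<in>UNIV. G z $ s $ l * riemann_coeff G s i j k z) = - (\<Sum>s\<in>UNIV. G z $ s $ k * riemann_coeff G s i j l z)"
proof -
  let ?C = "\<lambda>s j k. christoffel G s j k z"
  let ?g = "\<lambda>i j. G z $ i $ j"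
  let ?D = "\<lambda>s j k i. partial (christoffel G s j k) i z"
  note dG = Cinf_on_differentiable[OF smooth_entry z] and dC = Cinf_on_differentiable[OF smooth_christoffel z]
  have dS: "(\<lambda>x. \<Sum>s\<in>UNIV. G x $ s $ l * christoffel G s j k x) differentiable (at z)" for j k l
    by (intro differentiable_sum ballI differentiable_mult dG dC finite)
  have second: "partial (partial (\<lambda>x. G x $ k $ l) j) i z =
     (\<Sum>s\<in>UNIV. ?g s l * ?D s j k i) + (\<Sum>s\<in>UNIV. ?g s k * ?D s j l i)
     + (\<Sum>s\<in>UNIV. \<Sum>t\<in>UNIV. ?g t l * ?C t i s * ?C s j k) + (\<Sum>s\<in>UNIV. \<Sum>t\<in>UNIV. ?g t s * ?C t i l * ?C s j k)
     + (\<Sum>s\<in>UNIV. \<Sum>t\<in>UNIV. ?g t k * ?C t i s * ?C s j l) + (\<Sum>s\<in>UNIV. \<Sum>t\<in>UNIV. ?g t s * ?C t i k * ?C s j l)"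
    for i j
  proof -
    have "partial (partial (\<lambda>x. G x $ k $ l) j) i z =
       partial (\<lambda>x. (\<Sum>s\<in>UNIV. G x $ s $ l * christoffel G s j k x) + (\<Sum>s\<in>UNIV. G x $ s $ k * christoffel G s j l x)) i z"
      by (rule partial_cong[OF open_T z metric_compatible
            Cinf_on_differentiable[OF Cinf_on_partial[OF smooth_entry] z]])
    also have "\<dots> = (\<Sum>s\<in>UNIV. ?g s l * ?D s j k i + partial (\<lambda>x. G x $ s $ l) i z * ?C s j k)
       + (\<Sum>s\<in>UNIV. ?g s k * ?D s j l i + partial (\<lambda>x. G x $ s $ k) i z * ?C s j l)"
      by (simp only: partial_add[OF dS dS] partial_sum_mult[OF dG dC])
    also have "\<dots> = (\<Sum>s\<in>UNIV. ?g s l * ?D s j k i) + (\<Sum>s\<in>UNIV. ?g s k * ?D s j l i)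
     + (\<Sum>s\<in>UNIV. \<Sum>t\<in>UNIV. ?g t l * ?C t i s * ?C s j k) + (\<Sum>s\<in>UNIV. \<Sum>t\<in>UNIV. ?g t s * ?C t i l * ?C s j k)
     + (\<Sum>s\<in>UNIV. \<Sum>t\<in>UNIV. ?g t k * ?C t i s * ?C s j l) + (\<Sum>s\<in>UNIV. \<Sum>t\<in>UNIV. ?g t s * ?C t i k * ?C s j l)"
      unfolding metric_compatible[OF z] by (simp add: sum.distrib distrib_right sum_distrib_right)
    finally show ?thesis .
  qed
  have cross: "(\<Sum>s\<in>UNIV. \<Sum>t\<in>UNIV. ?g t s * ?C t i l * ?C s j k) = (\<Sum>s\<in>UNIV. \<Sum>t\<in>UNIV. ?g t s * ?C t j k * ?C s i l)"
    for i j k l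
    by (subst sum.swap) (simp add: metric_sym[OF z] mult_ac)
  have quad: "(\<Sum>s\<in>UNIV. ?g s l * (\<Sum>t\<in>UNIV. ?C s i t * ?C t j k)) = (\<Sum>s\<in>UNIV. \<Sum>t\<in>UNIV. ?g t l * ?C t i s * ?C s j k)"
    for i j k l
    by (subst sum.swap) (simp add: sum_distrib_left mult_ac)
  have low: "(\<Sum>s\<in>UNIV. ?g s l * riemann_coeff G s i j k z) =
      (\<Sum>s\<in>UNIV. ?g s l * ?D s j k i) - (\<Sum>s\<in>UNIV. ?g s l * ?D s i k j)
      + (\<Sum>s\<in>UNIV. \<Sum>t\<in>UNIV. ?g t l * ?C t i s * ?C s j k) - (\<Sum>s\<in>UNIV. \<Sum>t\<in>UNIV. ?g t l * ?C t j s * ?C s i k)"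
    for k l
    unfolding riemann_coeff_def quad[symmetric]
    by (simp add: distrib_left right_diff_distrib sum.distrib sum_subtractf)
  show ?thesis
    using partial_commute[OF open_T z smooth_entry, of k l j i]
    unfolding second[of i j] second[of j i] low[of l k] low[of k l]
    using cross[of i l j k] cross[of i k j l] by simp
qed

lemma curvature_eq:
  assumes z: "z \<in> T"
  shows "curvature G i j k l z = (\<Sum>s\<in>UNIV. G z $ s $ l * riemann_coeff G s i j k z)"
proof -
  have contract: "(\<Sum>j\<in>UNIV. \<Sum>k\<in>UNIV. A j k * axis i 1 $ j * B k) = (\<Sum>k\<in>UNIV. A i k * B k)"
    for A :: "'n \<Rightarrow> 'n \<Rightarrow> real" and i B
    by (subst sum.swap) (simp add: axis_def if_distrib if_distribR sum.delta cong: if_cong)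
  have cd0: "covariant_deriv G (\<lambda>_. axis j 1) (\<lambda>_. axis k 1) = (\<lambda>z. \<chi> s. christoffel G s j k z)" for j k
  proof
    fix z
    show "covariant_deriv G (\<lambda>_. axis j 1) (\<lambda>_. axis k 1) z = (\<chi> s. christoffel G s j k z)"
      unfolding covariant_deriv_def vec_eq_iff
      by (simp add: contract) (simp add: axis_def if_distrib sum.delta cong: if_cong)
  qed
  have cd: "covariant_deriv G (\<lambda>_. axis i 1) (\<lambda>z. \<chi> s. christoffel G s j k z) z $ s =
      partial (christoffel G s j k) i z + (\<Sum>l\<in>UNIV. christoffel G s i l z * christoffel G l j k z)" for i j s
  proof -
    have "((\<lambda>z. \<chi> s. christoffel G s j k z) has_derivative
       (\<lambda>v. \<chi> s. frechet_derivative (christoffel G s j k) (at z) v)) (at z)"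
      by (subst has_derivative_componentwise_within)
        (auto simp: Basis_vec_def inner_axis intro!: Cinf_on_has_derivative[OF smooth_christoffel z])
    then have "frechet_derivative (\<lambda>z. \<chi> s. christoffel G s j k z) (at z) (axis i 1) $ s = partial (christoffel G s j k) i z"
      by (simp add: partial_def flip: frechet_derivative_at)
    then show ?thesis
      unfolding covariant_deriv_def
      by (simp add: contract)
  qed
  have lb: "lie_bracket (\<lambda>_. axis i 1) (\<lambda>_. axis j 1) = (\<lambda>_. 0)" by (simp add: lie_bracket_def fun_eq_iff)
  have "linear (frechet_derivative (\<lambda>_. axis k 1 :: real^'n) (at z))" by (simp add: linear_zero)
  then have cd1: "covariant_deriv G (\<lambda>_. 0) (\<lambda>_. axis k 1) z = 0"
    by (simp add: covariant_deriv_def vec_eq_iff)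
  show ?thesis
    unfolding curvature_def curvature_op_def lb cd0 riemann_coeff_def
    by (intro sum.cong refl arg_cong[where f="(*) _"]) (simp add: cd cd1)
qed

end

section \<open>Derivatives along complex tangent vectors\<close>

text \<open>The derivative along the complexified tangent vector \<open>fst X + \<i> * snd X\<close>.  All such derivatives
  commute, and conjugation exchanges \<open>X\<close> and \<open>conj_dir X\<close>, so that derivatives of type (1,0)
  and (0,1) obey one calculus.\<close>

definition cderiv :: "'e \<times> 'e \<Rightarrow> ('e::euclidean_space \<Rightarrow> complex) \<Rightarrow> 'e \<Rightarrow> complex" where
  "cderiv X F x = frechet_derivative F (at x) (fst X) + \<i> * frechet_derivative F (at x) (snd X)"

definition conj_dir :: "'e::real_vector \<times> 'e \<Rightarrow> 'e \<times> 'e" where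
  "conj_dir X = (fst X, - snd X)"

lemma conj_dir_conj_dir [simp]: "conj_dir (conj_dir X) = X"
  by (simp add: conj_dir_def)

lemma cderiv_eqI: "(F has_derivative D) (at x) \<Longrightarrow> cderiv X F x = D (fst X) + \<i> * D (snd X)"
  unfolding cderiv_def by (simp flip: frechet_derivative_at)

lemma cderiv_cong:
  assumes "open S" "x \<in> S" "\<And>x. x \<in> S \<Longrightarrow> F x = F' x" "F differentiable (at x)"
  shows "cderiv X F x = cderiv X F' x"
  unfolding cderiv_def by (simp add: frechet_derivative_transform_within_open[OF assms(4,1,2,3)])

lemma cderiv_const [simp]: "cderiv X (\<lambda>x. c) x = 0"
  by (simp add: cderiv_def)

lemma cderiv_add:
  assumes "F differentiable (at x)" "F' differentiable (at x)"
  shows "cderiv X (\<lambda>x. F x + F' x) x = cderiv X F x + cderiv X F' x"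
  by (subst cderiv_eqI[OF has_derivative_add[OF assms[unfolded frechet_derivative_works]]])
     (simp add: cderiv_def algebra_simps)

lemma cderiv_mult:
  assumes "F differentiable (at x)" "F' differentiable (at x)"
  shows "cderiv X (\<lambda>x. F x * F' x) x = cderiv X F x * F' x + F x * cderiv X F' x"
  by (subst cderiv_eqI[OF has_derivative_mult[OF assms[unfolded frechet_derivative_works]]])
     (simp add: cderiv_def algebra_simps)

lemma cderiv_sum:
  assumes "\<And>i. i \<in> I \<Longrightarrow> F i differentiable (at x)"
  shows "cderiv X (\<lambda>x. \<Sum>i\<in>I. F i x) x = (\<Sum>i\<in>I. cderiv X (F i) x)"
  by (subst cderiv_eqI[OF has_derivative_sum[OF assms[unfolded frechet_derivative_works]]])
     (simp_all add: cderiv_def sum.distrib sum_distrib_left)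

lemma cderiv_cnj:
  assumes "F differentiable (at x)"
  shows "cderiv X (\<lambda>x. cnj (F x)) x = cnj (cderiv (conj_dir X) F x)"
proof -
  note d = assms[unfolded frechet_derivative_works]
  show ?thesis
    by (subst cderiv_eqI[OF has_derivative_cnj[OF d]])
       (simp add: cderiv_def conj_dir_def linear_neg[OF has_derivative_linear[OF d]])
qed

lemma cderiv_real:
  assumes "(F has_derivative D) (at x)"
  shows "cderiv X (\<lambda>x. of_real (F x)) x = of_real (D (fst X)) + \<i> * of_real (D (snd X))"
  by (rule cderiv_eqI[OF has_derivative_of_real[OF assms]])

lemma cderiv_compose:
  fixes y :: "'e::euclidean_space \<Rightarrow> real^'n::finite" and F :: "real^'n \<Rightarrow> real"
  assumes "y differentiable (at x)" "F differentiable (at (y x))"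
  shows "cderiv X (\<lambda>x. of_real (F (y x))) x =
    (\<Sum>j\<in>UNIV. of_real (partial F j (y x)) * cderiv X (\<lambda>x. of_real (y x $ j)) x)"
proof -
  note dy = assms(1)[unfolded frechet_derivative_works] and dF = assms(2)[unfolded frechet_derivative_works]
  have *: "frechet_derivative F (at (y x)) v = (\<Sum>j\<in>UNIV. v $ j * partial F j (y x))" for v
    using derivative_partial_expansion[OF has_derivative_linear[OF dF], of v] by simp
  show ?thesis
    unfolding cderiv_real[OF has_derivative_compose[OF dy dF]]
      cderiv_real[OF bounded_linear.has_derivative[OF bounded_linear_vec_nth dy]] *
    by (simp add: sum_distrib_left sum.distrib algebra_simps)
qed

lemma Cinf_on_cderiv:
  assumes "open S" "Cinf_on F S"
  shows "Cinf_on (cderiv X F) S"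
  unfolding cderiv_def[abs_def]
  by (intro Cinf_on_add Cinf_on_mult Cinf_on_const Cinf_on_frechet assms)

lemma Cinf_on_cnj: "open S \<Longrightarrow> Cinf_on F S \<Longrightarrow> Cinf_on (\<lambda>x. cnj (F x)) S"
  by (rule Cinf_on_compose_linear[OF _ bounded_linear_cnj])

lemma Cinf_on_of_real: "open S \<Longrightarrow> Cinf_on F S \<Longrightarrow> Cinf_on (\<lambda>x. complex_of_real (F x)) S"
  by (rule Cinf_on_compose_linear[OF _ bounded_linear_of_real])

lemma cderiv_commute:
  assumes "open S" "x \<in> S" "Cinf_on F S"
  shows "cderiv X (cderiv Y F) x = cderiv Y (cderiv X F) x"
proof -
  have exp: "cderiv X (cderiv Y F) x = cderiv X (\<lambda>z. frechet_derivative F (at z) (fst Y)) x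
    + \<i> * cderiv X (\<lambda>z. frechet_derivative F (at z) (snd Y)) x" for X Y
    unfolding cderiv_def[of Y, abs_def]
    by (simp add: cderiv_add cderiv_mult Cinf_on_differentiable[OF Cinf_on_frechet[OF assms(3)] assms(2)])
  have "Ck_on 2 F S" using assms(3) by (simp add: Cinf_on_def)
  note sym = second_derivative_symmetric[OF assms(1,2) this]
  show ?thesis unfolding exp unfolding cderiv_def
    using sym[of "fst X" "fst Y"] sym[of "snd X" "fst Y"] sym[of "fst X" "snd Y"] sym[of "snd X" "snd Y"]
    by (simp add: algebra_simps)
qed

section \<open>The complexified curvature tensor\<close>

text \<open>The complex trilinear extension of \<open>R(X, Y) Z\<close>, component \<open>s\<close>.\<close>

definition ccurv :: "(real^'n::finite \<Rightarrow> real^'n^'n) \<Rightarrow> real^'n \<Rightarrow> 'n \<Rightarrow>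
    ('n \<Rightarrow> complex) \<Rightarrow> ('n \<Rightarrow> complex) \<Rightarrow> ('n \<Rightarrow> complex) \<Rightarrow> complex" where
  "ccurv G z s X Y Z = (\<Sum>a\<in>UNIV. \<Sum>b\<in>UNIV. \<Sum>k\<in>UNIV. of_real (riemann_coeff G s a b k z) * X a * Y b * Z k)"

lemma ccurv_antisym: "ccurv G z s X Y Z = - ccurv G z s Y X Z"
proof -
  have R: "riemann_coeff G s a b k z = - riemann_coeff G s b a k z" for a b k
    by (simp add: riemann_coeff_def)
  have "ccurv G z s X Y Z =
      (\<Sum>a\<in>UNIV. \<Sum>b\<in>UNIV. \<Sum>k\<in>UNIV. of_real (- riemann_coeff G s b a k z) * X a * Y b * Z k)"
    unfolding ccurv_def by (intro sum.cong refl) (subst R, rule refl)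
  also have "\<dots> = - ccurv G z s Y X Z"
    unfolding ccurv_def by (subst sum.swap) (simp add: sum_negf mult_ac)
  finally show ?thesis .
qed

lemma ccurv_cnj: "cnj (ccurv G z s X Y Z) = ccurv G z s (\<lambda>a. cnj (X a)) (\<lambda>a. cnj (Y a)) (\<lambda>a. cnj (Z a))"
  by (simp add: ccurv_def)

lemma ccurv_sum: "ccurv G z s X (\<lambda>b. \<Sum>a\<in>I. Y a b * c a) Z = (\<Sum>a\<in>I. ccurv G z s X (Y a) Z * c a)"
proof -
  have "ccurv G z s X (\<lambda>b. \<Sum>a\<in>I. Y a b * c a) Z =
    (\<Sum>a'\<in>UNIV. \<Sum>b\<in>UNIV. \<Sum>k\<in>UNIV. \<Sum>a\<in>I. of_real (riemann_coeff G s a' b k z) * X a' * Y a b * Z k * c a)"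
    by (simp add: ccurv_def sum_distrib_left sum_distrib_right mult_ac)
  also have "\<dots> = (\<Sum>a'\<in>UNIV. \<Sum>b\<in>UNIV. \<Sum>a\<in>I. \<Sum>k\<in>UNIV. of_real (riemann_coeff G s a' b k z) * X a' * Y a b * Z k * c a)"
    by (intro sum.cong refl sum.swap)
  also have "\<dots> = (\<Sum>a'\<in>UNIV. \<Sum>a\<in>I. \<Sum>b\<in>UNIV. \<Sum>k\<in>UNIV. of_real (riemann_coeff G s a' b k z) * X a' * Y a b * Z k * c a)"
    by (intro sum.cong refl sum.swap)
  also have "\<dots> = (\<Sum>a\<in>I. \<Sum>a'\<in>UNIV. \<Sum>b\<in>UNIV. \<Sum>k\<in>UNIV. of_real (riemann_coeff G s a' b k z) * X a' * Y a b * Z k * c a)"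
    by (rule sum.swap)
  finally show ?thesis by (simp add: ccurv_def sum_distrib_right)
qed

lemma (in riemannian_chart) ccurv_bianchi:
  assumes "z \<in> T"
  shows "ccurv G z s X Y Z + ccurv G z s Y Z X + ccurv G z s Z X Y = 0"
proof -
  let ?R = "\<lambda>a b k. complex_of_real (riemann_coeff G s a b k z)"
  have 2: "ccurv G z s Y Z X = (\<Sum>a\<in>UNIV. \<Sum>b\<in>UNIV. \<Sum>k\<in>UNIV. ?R b k a * X a * Y b * Z k)"
  proof -
    have "ccurv G z s Y Z X = (\<Sum>b\<in>UNIV. \<Sum>a\<in>UNIV. \<Sum>k\<in>UNIV. ?R b k a * X a * Y b * Z k)"
      unfolding ccurv_def by (rule sum.cong[OF refl], subst sum.swap) (simp add: mult_ac)
    also have "\<dots> = (\<Sum>a\<in>UNIV. \<Sum>b\<in>UNIV. \<Sum>k\<in>UNIV. ?R b k a * X a * Y b * Z k)" by (rule sum.swap)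
    finally show ?thesis .
  qed
  have 3: "ccurv G z s Z X Y = (\<Sum>a\<in>UNIV. \<Sum>b\<in>UNIV. \<Sum>k\<in>UNIV. ?R k a b * X a * Y b * Z k)"
  proof -
    have "ccurv G z s Z X Y = (\<Sum>a\<in>UNIV. \<Sum>k\<in>UNIV. \<Sum>b\<in>UNIV. ?R k a b * X a * Y b * Z k)"
      unfolding ccurv_def by (subst sum.swap) (simp add: mult_ac)
    also have "\<dots> = (\<Sum>a\<in>UNIV. \<Sum>b\<in>UNIV. \<Sum>k\<in>UNIV. ?R k a b * X a * Y b * Z k)"
      by (intro sum.cong refl sum.swap)
    finally show ?thesis .
  qed
  have R: "?R a b k + ?R b k a + ?R k a b = 0" for a b k
    using riemann_bianchi[OF assms, of s a b k] by (metis of_real_0 of_real_add)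
  have "ccurv G z s X Y Z + ccurv G z s Y Z X + ccurv G z s Z X Y =
    (\<Sum>a\<in>UNIV. \<Sum>b\<in>UNIV. \<Sum>k\<in>UNIV. (?R a b k + ?R b k a + ?R k a b) * X a * Y b * Z k)"
    unfolding 2 3 by (simp add: ccurv_def sum.distrib distrib_right)
  then show ?thesis by (simp add: R)
qed

section \<open>The pullback of the Levi-Civita connection\<close>

locale map_into_chart = riemannian_chart G T
  for G :: "real^'n::finite \<Rightarrow> real^'n^'n" and T +
  fixes S :: "'e::euclidean_space set" and y :: "'e \<Rightarrow> real^'n"
  assumes open_S: "open S" and maps_to: "y ` S \<subseteq> T" and smooth_map: "Cinf_on y S"
begin

text \<open>The components of the complex vector \<open>dy(X)\<close>.\<close>

definition yd :: "'e \<times> 'e \<Rightarrow> 'n \<Rightarrow> 'e \<Rightarrow> complex" where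
  "yd X j = cderiv X (\<lambda>x. of_real (y x $ j))"

text \<open>The connection matrix of the pulled back connection in the direction \<open>X\<close>, with respect to the
  coordinate frame of the target.\<close>

definition conn :: "'e \<times> 'e \<Rightarrow> 'n \<Rightarrow> 'n \<Rightarrow> 'e \<Rightarrow> complex" where
  "conn X i k x = (\<Sum>j\<in>UNIV. of_real (christoffel G i j k (y x)) * yd X j x)"

definition nabla :: "'e \<times> 'e \<Rightarrow> ('n \<Rightarrow> 'e \<Rightarrow> complex) \<Rightarrow> 'n \<Rightarrow> 'e \<Rightarrow> complex" where
  "nabla X u i x = cderiv X (u i) x + (\<Sum>k\<in>UNIV. conn X i k x * u k x)"

text \<open>The metric is extended bilinearly, not as a Hermitian form; conjugates are written out where
  they are wanted.\<close>

definition pair :: "('n \<Rightarrow> 'e \<Rightarrow> complex) \<Rightarrow> ('n \<Rightarrow> 'e \<Rightarrow> complex) \<Rightarrow> 'e \<Rightarrow> complex" where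
  "pair u v x = (\<Sum>i\<in>UNIV. \<Sum>j\<in>UNIV. of_real (G (y x) $ i $ j) * u i x * v j x)"

lemma y_in_T: "x \<in> S \<Longrightarrow> y x \<in> T" using maps_to by auto

lemma smooth_pulled: "Cinf_on F T \<Longrightarrow> Cinf_on (\<lambda>x. complex_of_real (F (y x))) S" for F :: "real^'n \<Rightarrow> real"
  by (intro Cinf_on_of_real open_S Cinf_on_compose[OF open_S maps_to _ smooth_map])

lemma smooth_component: "Cinf_on (\<lambda>x. complex_of_real (y x $ j)) S"
  by (intro Cinf_on_of_real open_S Cinf_on_compose_linear[OF _ bounded_linear_vec_nth] smooth_map)

lemma smooth_yd: "Cinf_on (yd X j) S"
  unfolding yd_def by (intro Cinf_on_cderiv open_S smooth_component)

lemma smooth_conn: "Cinf_on (conn X i k) S"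
  unfolding conn_def[abs_def]
  by (intro Cinf_on_sum Cinf_on_mult open_S smooth_pulled smooth_christoffel smooth_yd)

lemma smooth_nabla: "(\<And>i. Cinf_on (u i) S) \<Longrightarrow> Cinf_on (nabla X u i) S"
  unfolding nabla_def[abs_def]
  by (intro Cinf_on_sum Cinf_on_mult Cinf_on_add Cinf_on_cderiv open_S smooth_conn)

lemma smooth_pair: "(\<And>i. Cinf_on (u i) S) \<Longrightarrow> (\<And>i. Cinf_on (v i) S) \<Longrightarrow> Cinf_on (pair u v) S"
  unfolding pair_def[abs_def]
  by (intro Cinf_on_sum Cinf_on_mult open_S smooth_pulled smooth_entry)

lemma cderiv_pulled:
  fixes F :: "real^'n \<Rightarrow> real"
  assumes "x \<in> S" "Cinf_on F T"
  shows "cderiv X (\<lambda>x. of_real (F (y x))) x = (\<Sum>l\<in>UNIV. of_real (partial F l (y x)) * yd X l x)"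
  unfolding yd_def
  by (rule cderiv_compose[OF Cinf_on_differentiable[OF smooth_map assms(1)]
        Cinf_on_differentiable[OF assms(2) y_in_T[OF assms(1)]]])

lemma yd_conj_dir: "x \<in> S \<Longrightarrow> yd (conj_dir X) j x = cnj (yd X j x)"
  unfolding yd_def
  using cderiv_cnj[OF Cinf_on_differentiable[OF smooth_component], where X = "conj_dir X"] by (simp only: conj_dir_conj_dir complex_cnj_complex_of_real)

lemma nabla_conj_dir:
  assumes "x \<in> S" "\<And>i. Cinf_on (u i) S"
  shows "nabla (conj_dir X) (\<lambda>i x. cnj (u i x)) i x = cnj (nabla X u i x)"
  unfolding nabla_def conn_def
  by (simp add: yd_conj_dir[OF assms(1)] cderiv_cnj[OF Cinf_on_differentiable[OF assms(2,1)]])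

lemma nabla_cong:
  assumes "x \<in> S" "\<And>i x. x \<in> S \<Longrightarrow> u i x = v i x" "\<And>i. Cinf_on (u i) S"
  shows "nabla X u i x = nabla X v i x"
  unfolding nabla_def
  using cderiv_cong[OF open_S assms(1) assms(2) Cinf_on_differentiable[OF assms(3,1)]] assms(1,2) by simp

lemma nabla_zero [simp]: "nabla X (\<lambda>i x. 0) i x = 0"
  by (simp add: nabla_def)

lemma nabla_nabla_vanishing:
  assumes "x \<in> S" "\<And>i. Cinf_on (u i) S" "\<And>i x. x \<in> S \<Longrightarrow> nabla Y u i x = 0"
  shows "nabla X (nabla Y u) i x = 0"
proof -
  have "nabla X (nabla Y u) i x = nabla X (\<lambda>i x. 0) i x"
    by (rule nabla_cong[OF assms(1) assms(3) smooth_nabla[OF assms(2)]])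
  then show ?thesis by simp
qed

lemma pair_cong: "(\<And>i. u i x = u' i x) \<Longrightarrow> (\<And>i. v i x = v' i x) \<Longrightarrow> pair u v x = pair u' v' x"
  by (simp add: pair_def)

lemma pair_zero [simp]: "pair (\<lambda>i x. 0) v x = 0" "pair u (\<lambda>i x. 0) x = 0"
  by (simp_all add: pair_def)

lemma nabla_sum_scale:
  assumes "x \<in> S" "\<And>a i. Cinf_on (s a i) S" "\<And>a. Cinf_on (w a) S"
  shows "nabla X (\<lambda>i x. \<Sum>a\<in>I. s a i x * w a x) i x =
    (\<Sum>a\<in>I. nabla X (s a) i x * w a x + s a i x * cderiv X (w a) x)"
proof -
  note d = Cinf_on_differentiable[OF assms(2,1)] Cinf_on_differentiable[OF assms(3,1)]
  have "cderiv X (\<lambda>x. \<Sum>a\<in>I. s a i x * w a x) x =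
     (\<Sum>a\<in>I. cderiv X (s a i) x * w a x + s a i x * cderiv X (w a) x)"
    by (simp add: cderiv_sum cderiv_mult d)
  moreover have "(\<Sum>k\<in>UNIV. conn X i k x * (\<Sum>a\<in>I. s a k x * w a x)) =
     (\<Sum>a\<in>I. (\<Sum>k\<in>UNIV. conn X i k x * s a k x) * w a x)"
    by (simp add: sum_distrib_left sum_distrib_right mult_ac) (rule sum.swap)
  ultimately show ?thesis
    unfolding nabla_def by (simp add: sum.distrib distrib_right)
qed

lemma pair_deriv:
  assumes x: "x \<in> S" and u: "\<And>i. Cinf_on (u i) S" and v: "\<And>i. Cinf_on (v i) S"
  shows "cderiv X (pair u v) x = pair (nabla X u) v x + pair u (nabla X v) x"
proof -
  let ?g = "\<lambda>i j. complex_of_real (G (y x) $ i $ j)"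
  have du: "u i differentiable (at x)" and dv: "v i differentiable (at x)"
    and dg: "(\<lambda>x. complex_of_real (G (y x) $ i $ j)) differentiable (at x)" for i j
    using Cinf_on_differentiable[OF u x] Cinf_on_differentiable[OF v x]
      Cinf_on_differentiable[OF smooth_pulled[OF smooth_entry] x] by auto
  have Dg: "cderiv X (\<lambda>x. of_real (G (y x) $ i $ j)) x =
     (\<Sum>s\<in>UNIV. ?g s j * conn X s i x) + (\<Sum>s\<in>UNIV. ?g i s * conn X s j x)" for i j
  proof -
    have sw: "(\<Sum>l\<in>UNIV. (\<Sum>s\<in>UNIV. ?g s j * of_real (christoffel G s l i (y x))) * yd X l x) = (\<Sum>s\<in>UNIV. ?g s j * conn X s i x)"
      for i j
      unfolding conn_def by (simp add: sum_distrib_left sum_distrib_right mult_ac) (rule sum.swap)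
    have "cderiv X (\<lambda>x. of_real (G (y x) $ i $ j)) x = (\<Sum>l\<in>UNIV. of_real (partial (\<lambda>z. G z $ i $ j) l (y x)) * yd X l x)"
      by (rule cderiv_pulled[OF x smooth_entry])
    also have "\<dots> = (\<Sum>s\<in>UNIV. ?g s j * conn X s i x) + (\<Sum>s\<in>UNIV. ?g s i * conn X s j x)"
      unfolding metric_compatible[OF y_in_T[OF x]] by (simp add: distrib_right sum.distrib sw)
    finally show ?thesis using metric_sym[OF y_in_T[OF x], of i] by simp
  qed
  have "cderiv X (pair u v) x = (\<Sum>i\<in>UNIV. \<Sum>j\<in>UNIV.
      cderiv X (\<lambda>x. of_real (G (y x) $ i $ j)) x * u i x * v j x +
      ?g i j * cderiv X (u i) x * v j x + ?g i j * u i x * cderiv X (v j) x)"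
    unfolding pair_def[abs_def]
    by (simp add: cderiv_sum cderiv_mult du dv dg distrib_right)
  also have "\<dots> = (\<Sum>i\<in>UNIV. \<Sum>j\<in>UNIV. (\<Sum>s\<in>UNIV. ?g s j * conn X s i x) * u i x * v j x)
     + (\<Sum>i\<in>UNIV. \<Sum>j\<in>UNIV. (\<Sum>s\<in>UNIV. ?g i s * conn X s j x) * u i x * v j x)
     + (\<Sum>i\<in>UNIV. \<Sum>j\<in>UNIV. ?g i j * cderiv X (u i) x * v j x)
     + (\<Sum>i\<in>UNIV. \<Sum>j\<in>UNIV. ?g i j * u i x * cderiv X (v j) x)"
    unfolding Dg by (simp add: sum.distrib distrib_right add_ac)
  also have "(\<Sum>i\<in>UNIV. \<Sum>j\<in>UNIV. (\<Sum>s\<in>UNIV. ?g s j * conn X s i x) * u i x * v j x) =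
     (\<Sum>s\<in>UNIV. \<Sum>j\<in>UNIV. ?g s j * (\<Sum>i\<in>UNIV. conn X s i x * u i x) * v j x)" (is "?l = _")
  proof -
    have "?l = (\<Sum>j\<in>UNIV. \<Sum>i\<in>UNIV. \<Sum>s\<in>UNIV. ?g s j * conn X s i x * u i x * v j x)"
      by (subst sum.swap) (simp add: sum_distrib_right)
    also have "\<dots> = (\<Sum>j\<in>UNIV. \<Sum>s\<in>UNIV. \<Sum>i\<in>UNIV. ?g s j * conn X s i x * u i x * v j x)"
      by (intro sum.cong refl sum.swap)
    also have "\<dots> = (\<Sum>s\<in>UNIV. \<Sum>j\<in>UNIV. \<Sum>i\<in>UNIV. ?g s j * conn X s i x * u i x * v j x)"
      by (rule sum.swap)
    finally show ?thesis by (simp add: sum_distrib_left sum_distrib_right mult_ac)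
  qed
  also have "(\<Sum>i\<in>UNIV. \<Sum>j\<in>UNIV. (\<Sum>s\<in>UNIV. ?g i s * conn X s j x) * u i x * v j x) =
     (\<Sum>i\<in>UNIV. \<Sum>s\<in>UNIV. ?g i s * u i x * (\<Sum>j\<in>UNIV. conn X s j x * v j x))"
    by (rule sum.cong[OF refl], simp add: sum_distrib_left sum_distrib_right mult_ac) (rule sum.swap)
  finally show ?thesis
    unfolding pair_def nabla_def by (simp add: sum.distrib distrib_left distrib_right)
qed

text \<open>Cartan's structure equation, contracted with a vector \<open>u\<close>.  The second derivatives of \<open>y\<close>
  cancel because the directions \<open>X\<close> and \<open>Y\<close> are constant.\<close>

lemma conn_curvature:
  assumes x: "x \<in> S"
  shows "(\<Sum>k\<in>UNIV. (cderiv X (conn Y i k) x - cderiv Y (conn X i k) x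
      + (\<Sum>l\<in>UNIV. conn X i l x * conn Y l k x) - (\<Sum>l\<in>UNIV. conn Y i l x * conn X l k x)) * u k) =
    ccurv G (y x) i (\<lambda>a. yd X a x) (\<lambda>b. yd Y b x) u"
proof -
  let ?\<Gamma> = "\<lambda>i j k. complex_of_real (christoffel G i j k (y x))"
  let ?D = "\<lambda>i j k l. complex_of_real (partial (christoffel G i j k) l (y x))"
  have d: "yd Y j differentiable (at x)"
     "(\<lambda>x. complex_of_real (christoffel G i j k (y x))) differentiable (at x)" for Y i j k
    using Cinf_on_differentiable[OF smooth_yd x] Cinf_on_differentiable[OF smooth_pulled[OF smooth_christoffel] x]
    by auto
  have D\<Gamma>: "cderiv X (\<lambda>x. complex_of_real (christoffel G i j k (y x))) x = (\<Sum>l\<in>UNIV. ?D i j k l * yd X l x)"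
    for X i j k by (rule cderiv_pulled[OF x smooth_christoffel])
  have Dconn: "cderiv X (conn Y i k) x = (\<Sum>a\<in>UNIV. \<Sum>b\<in>UNIV. ?D i b k a * yd X a x * yd Y b x)
     + (\<Sum>b\<in>UNIV. ?\<Gamma> i b k * cderiv X (yd Y b) x)" for X Y k
  proof -
    have "cderiv X (conn Y i k) x = (\<Sum>b\<in>UNIV. \<Sum>a\<in>UNIV. ?D i b k a * yd X a x * yd Y b x)
      + (\<Sum>b\<in>UNIV. ?\<Gamma> i b k * cderiv X (yd Y b) x)"
      unfolding conn_def[abs_def]
      by (simp add: cderiv_sum cderiv_mult d D\<Gamma> sum.distrib sum_distrib_right)
    then show ?thesis using sum.swap[of "\<lambda>b a. ?D i b k a * yd X a x * yd Y b x" UNIV UNIV] by simp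
  qed
  have comm: "cderiv X (yd Y b) x = cderiv Y (yd X b) x" for b
    unfolding yd_def by (rule cderiv_commute[OF open_S x smooth_component])
  \<comment> \<open>renaming the indices brings the terms of \<open>X\<close> and \<open>Y\<close> over the same monomials\<close>
  have swap: "(\<Sum>a\<in>UNIV. \<Sum>b\<in>UNIV. ?D i b k a * yd Y a x * yd X b x) =
     (\<Sum>a\<in>UNIV. \<Sum>b\<in>UNIV. ?D i a k b * yd X a x * yd Y b x)" for k
    by (subst sum.swap) (simp add: mult_ac)
  have prod: "(\<Sum>l\<in>UNIV. conn X i l x * conn Y l k x) =
     (\<Sum>a\<in>UNIV. \<Sum>b\<in>UNIV. (\<Sum>l\<in>UNIV. ?\<Gamma> i a l * ?\<Gamma> l b k) * yd X a x * yd Y b x)" for X Y k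
  proof -
    have "(\<Sum>l\<in>UNIV. conn X i l x * conn Y l k x) =
      (\<Sum>l\<in>UNIV. \<Sum>a\<in>UNIV. \<Sum>b\<in>UNIV. ?\<Gamma> i a l * ?\<Gamma> l b k * yd X a x * yd Y b x)"
      unfolding conn_def sum_product by (simp add: mult_ac)
    also have "\<dots> = (\<Sum>a\<in>UNIV. \<Sum>l\<in>UNIV. \<Sum>b\<in>UNIV. ?\<Gamma> i a l * ?\<Gamma> l b k * yd X a x * yd Y b x)"
      by (rule sum.swap)
    also have "\<dots> = (\<Sum>a\<in>UNIV. \<Sum>b\<in>UNIV. \<Sum>l\<in>UNIV. ?\<Gamma> i a l * ?\<Gamma> l b k * yd X a x * yd Y b x)"
      by (intro sum.cong refl sum.swap)
    finally show ?thesis by (simp add: sum_distrib_right)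
  qed
  have prod': "(\<Sum>l\<in>UNIV. conn Y i l x * conn X l k x) =
     (\<Sum>a\<in>UNIV. \<Sum>b\<in>UNIV. (\<Sum>l\<in>UNIV. ?\<Gamma> i b l * ?\<Gamma> l a k) * yd X a x * yd Y b x)" for k
    unfolding prod by (subst sum.swap) (simp add: mult_ac)
  have "cderiv X (conn Y i k) x - cderiv Y (conn X i k) x
      + (\<Sum>l\<in>UNIV. conn X i l x * conn Y l k x) - (\<Sum>l\<in>UNIV. conn Y i l x * conn X l k x) =
    (\<Sum>a\<in>UNIV. \<Sum>b\<in>UNIV. of_real (riemann_coeff G i a b k (y x)) * yd X a x * yd Y b x)" for k
    unfolding Dconn prod' prod[of X Y] swap comm riemann_coeff_def
    by (simp add: sum.distrib sum_subtractf distrib_right left_diff_distrib)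
  then have "(\<Sum>k\<in>UNIV. (cderiv X (conn Y i k) x - cderiv Y (conn X i k) x
      + (\<Sum>l\<in>UNIV. conn X i l x * conn Y l k x) - (\<Sum>l\<in>UNIV. conn Y i l x * conn X l k x)) * u k) =
    (\<Sum>k\<in>UNIV. \<Sum>a\<in>UNIV. \<Sum>b\<in>UNIV. of_real (riemann_coeff G i a b k (y x)) * yd X a x * yd Y b x * u k)"
    by (simp add: sum_distrib_right)
  also have "\<dots> = (\<Sum>a\<in>UNIV. \<Sum>k\<in>UNIV. \<Sum>b\<in>UNIV. of_real (riemann_coeff G i a b k (y x)) * yd X a x * yd Y b x * u k)"
    by (rule sum.swap)
  also have "\<dots> = ccurv G (y x) i (\<lambda>a. yd X a x) (\<lambda>b. yd Y b x) u"
    unfolding ccurv_def by (intro sum.cong refl sum.swap)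
  finally show ?thesis .
qed

text \<open>The first derivatives of \<open>u\<close> cancel in the commutator, and its second derivatives commute;
  the connection matrices alone remain.\<close>

lemma nabla_commutator:
  assumes x: "x \<in> S" and u: "\<And>i. Cinf_on (u i) S"
  shows "nabla X (nabla Y u) i x - nabla Y (nabla X u) i x =
    ccurv G (y x) i (\<lambda>a. yd X a x) (\<lambda>b. yd Y b x) (\<lambda>k. u k x)"
proof -
  note d = Cinf_on_differentiable[OF u x] Cinf_on_differentiable[OF smooth_conn x]
    Cinf_on_differentiable[OF Cinf_on_cderiv[OF open_S u] x]
  have 2: "nabla X (nabla Y u) i x = cderiv X (cderiv Y (u i)) x
    + (\<Sum>k\<in>UNIV. cderiv X (conn Y i k) x * u k x) + (\<Sum>k\<in>UNIV. conn Y i k x * cderiv X (u k) x)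
    + (\<Sum>k\<in>UNIV. conn X i k x * cderiv Y (u k) x)
    + (\<Sum>k\<in>UNIV. (\<Sum>l\<in>UNIV. conn X i l x * conn Y l k x) * u k x)" for X Y
  proof -
    have "(\<Sum>l\<in>UNIV. conn X i l x * (\<Sum>k\<in>UNIV. conn Y l k x * u k x)) =
       (\<Sum>k\<in>UNIV. (\<Sum>l\<in>UNIV. conn X i l x * conn Y l k x) * u k x)"
      by (simp add: sum_distrib_left sum_distrib_right mult_ac) (rule sum.swap)
    moreover have "cderiv X (nabla Y u i) x = cderiv X (cderiv Y (u i)) x
      + (\<Sum>k\<in>UNIV. cderiv X (conn Y i k) x * u k x) + (\<Sum>k\<in>UNIV. conn Y i k x * cderiv X (u k) x)"
      unfolding nabla_def[abs_def] by (simp add: cderiv_add cderiv_sum cderiv_mult d sum.distrib)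
    ultimately show ?thesis
      unfolding nabla_def[of X] by (simp add: nabla_def distrib_left sum.distrib)
  qed
  show ?thesis
    unfolding 2 conn_curvature[OF x, symmetric] cderiv_commute[OF open_S x u, of X Y]
    by (simp add: distrib_right left_diff_distrib sum.distrib sum_subtractf)
qed

text \<open>For \<open>u = a + \<i> b\<close> the value is \<open>g(a, a) + g(b, b)\<close>; the imaginary part cancels by symmetry of
  the metric.\<close>

lemma pair_nonneg:
  assumes "x \<in> S"
  shows "pair u (\<lambda>i x. cnj (u i x)) x \<in> \<real>\<^sub>\<ge>\<^sub>0"
proof -
  let ?g = "\<lambda>i j. G (y x) $ i $ j"
  let ?Q = "\<lambda>v w. \<Sum>i\<in>UNIV. \<Sum>j\<in>UNIV. ?g i j * v i * w j"
  let ?a = "\<lambda>i. Re (u i x)" and ?b = "\<lambda>i. Im (u i x)"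
  have "of_real (?g i j) * u i x * cnj (u j x) =
     Complex (?g i j * ?a i * ?a j + ?g i j * ?b i * ?b j) (?g i j * ?b i * ?a j - ?g i j * ?a i * ?b j)" for i j
    by (simp add: complex_eq_iff algebra_simps)
  then have eq: "pair u (\<lambda>i x. cnj (u i x)) x =
     Complex (?Q ?a ?a + ?Q ?b ?b) (?Q ?b ?a - ?Q ?a ?b)"
    unfolding pair_def by (simp add: complex_eq_iff sum.distrib sum_subtractf)
  have "?Q ?b ?a = ?Q ?a ?b"
    by (subst sum.swap) (simp add: metric_sym[OF y_in_T[OF assms]] mult_ac)
  moreover have "?Q v v \<ge> 0" for v
    using metric_pos[OF y_in_T[OF assms], of "\<chi> i. v i"]
    by (cases "(\<chi> i. v i) = (0::real^'n)") (auto simp: vec_eq_iff)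
  ultimately show ?thesis
    unfolding eq by (simp add: complex_nonneg_Reals_iff)
qed

end

section \<open>The Bochner identity for pluri-harmonic maps\<close>

text \<open>The (1,0)-vector with components \<open>V\<close>, that is \<open>(V - \<i> J V) / 2\<close> with \<open>J\<close> the complex
  structure.\<close>

definition holo :: "complex^'k::finite \<Rightarrow> (complex^'k) \<times> (complex^'k)" where
  "holo V = ((1/2) *\<^sub>R V, - ((1/2) *\<^sub>R (\<i> *s V)))"

abbreviation antiholo :: "complex^'k::finite \<Rightarrow> (complex^'k) \<times> (complex^'k)" where
  "antiholo V \<equiv> conj_dir (holo V)"

text \<open>Think of \<open>\<eta> = exp \<phi>\<close>; only \<open>d\<eta> = \<eta> d\<phi>\<close> matters.  The left-hand side is arranged so that the
  second derivatives of \<open>\<phi>\<close> cancel.\<close>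

lemma cderiv_weighted_mixed:
  assumes S: "open S" "x \<in> S" and N: "Cinf_on N S" and \<eta>: "Cinf_on \<eta> S" and \<phi>: "Cinf_on \<phi> S"
    and exp: "\<And>X x. x \<in> S \<Longrightarrow> cderiv X \<eta> x = \<eta> x * cderiv X \<phi> x"
  shows "cderiv P (cderiv Q (\<lambda>x. N x * \<eta> x)) x - N x * \<eta> x * cderiv P (cderiv Q \<phi>) x =
    \<eta> x * (cderiv P (cderiv Q N) x + cderiv P \<phi> x * cderiv Q N x + cderiv P N x * cderiv Q \<phi> x
      + N x * cderiv P \<phi> x * cderiv Q \<phi> x)"
proof -
  have d: "N differentiable (at z)" "\<eta> differentiable (at z)" "\<phi> differentiable (at z)"
     "cderiv Q N differentiable (at z)" "cderiv Q \<phi> differentiable (at z)" if "z \<in> S" for z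
    using that N \<eta> \<phi> by (auto intro!: Cinf_on_differentiable Cinf_on_cderiv S)
  have "cderiv P (cderiv Q (\<lambda>x. N x * \<eta> x)) x =
    cderiv P (\<lambda>x. \<eta> x * (cderiv Q N x + N x * cderiv Q \<phi> x)) x"
  proof (rule cderiv_cong[OF S])
    show "cderiv Q (\<lambda>x. N x * \<eta> x) z = \<eta> z * (cderiv Q N z + N z * cderiv Q \<phi> z)" if "z \<in> S" for z
      by (simp add: cderiv_mult d that exp algebra_simps)
    show "cderiv Q (\<lambda>x. N x * \<eta> x) differentiable (at x)"
      by (intro Cinf_on_differentiable[of _ S] Cinf_on_cderiv Cinf_on_mult S N \<eta>)
  qed
  also have "\<dots> = \<eta> x * cderiv P \<phi> x * (cderiv Q N x + N x * cderiv Q \<phi> x)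
     + \<eta> x * (cderiv P (cderiv Q N) x + cderiv P N x * cderiv Q \<phi> x + N x * cderiv P (cderiv Q \<phi>) x)"
    by (simp add: cderiv_mult cderiv_add d S exp)
  finally show ?thesis by (simp add: algebra_simps)
qed

lemma cderiv_inverse_eq_ln:
  fixes H :: "'e::euclidean_space \<Rightarrow> real"
  assumes "open S" "x \<in> S" "Cinf_on H S" "\<And>x. x \<in> S \<Longrightarrow> H x > 0"
  shows "cderiv X (\<lambda>x. complex_of_real (inverse (H x))) x =
    of_real (inverse (H x)) * cderiv X (\<lambda>x. complex_of_real (ln (inverse (H x)))) x"
proof -
  have "Cinf_on (\<lambda>x. inverse (H x)) S"
    using assms(4) by (intro Cinf_on_inverse assms(1,3)) force
  note d = Cinf_on_has_derivative[OF this assms(2)]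
  have pos: "inverse (H x) > 0" "H x > 0" using assms(2,4) by auto
  show ?thesis
    unfolding cderiv_real[OF d] cderiv_real[OF has_derivative_ln[OF pos(1) d]]
    using pos(2) by (simp add: field_simps)
qed

lemma sum5_reorder:
  fixes t :: "'i::finite \<Rightarrow> 'j::finite \<Rightarrow> 'k::finite \<Rightarrow> 'l::finite \<Rightarrow> 's::finite \<Rightarrow> complex"
  shows "(\<Sum>i\<in>UNIV. \<Sum>j\<in>UNIV. \<Sum>k\<in>UNIV. \<Sum>l\<in>UNIV. \<Sum>s\<in>UNIV. t i j k l s) =
    (\<Sum>k\<in>UNIV. \<Sum>s\<in>UNIV. \<Sum>i\<in>UNIV. \<Sum>l\<in>UNIV. \<Sum>j\<in>UNIV. t i j k l s)"
proof -
  have "(\<Sum>i\<in>UNIV. \<Sum>j\<in>UNIV. \<Sum>k\<in>UNIV. \<Sum>l\<in>UNIV. \<Sum>s\<in>UNIV. t i j k l s) =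
     (\<Sum>i\<in>UNIV. \<Sum>k\<in>UNIV. \<Sum>j\<in>UNIV. \<Sum>s\<in>UNIV. \<Sum>l\<in>UNIV. t i j k l s)"
    by (rule sum.cong[OF refl], subst sum.swap, rule sum.cong[OF refl], rule sum.cong[OF refl], rule sum.swap)
  also have "\<dots> = (\<Sum>k\<in>UNIV. \<Sum>i\<in>UNIV. \<Sum>s\<in>UNIV. \<Sum>l\<in>UNIV. \<Sum>j\<in>UNIV. t i j k l s)"
    by (subst sum.swap, rule sum.cong[OF refl], rule sum.cong[OF refl], subst sum.swap,
        rule sum.cong[OF refl], rule sum.swap)
  also have "\<dots> = (\<Sum>k\<in>UNIV. \<Sum>s\<in>UNIV. \<Sum>i\<in>UNIV. \<Sum>l\<in>UNIV. \<Sum>j\<in>UNIV. t i j k l s)"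
    by (rule sum.cong[OF refl], rule sum.swap)
  finally show ?thesis .
qed

locale pluriharmonic_into_chart = map_into_chart G T S y
  for G :: "real^'n::finite \<Rightarrow> real^'n^'n" and T and S :: "(complex^'k::finite) set" and y +
  assumes pluriharmonic: "x \<in> S \<Longrightarrow> cderiv (holo V) (yd (antiholo U) i) x +
    (\<Sum>j\<in>UNIV. \<Sum>k\<in>UNIV. of_real (christoffel G i j k (y x)) * yd (antiholo U) j x * yd (holo V) k x) = 0"
begin

text \<open>Mixed derivatives of \<open>y\<close> commute, so the pluri-harmonic equation says that \<open>dy\<close>, applied to a
  constant (1,0)-vector, is parallel in all (0,1)-directions.\<close>

lemma nabla_antiholo_yd: "x \<in> S \<Longrightarrow> nabla (antiholo U) (yd (holo V)) i x = 0"
proof -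
  assume x: "x \<in> S"
  have "cderiv (antiholo U) (yd (holo V) i) x = cderiv (holo V) (yd (antiholo U) i) x"
    unfolding yd_def by (rule cderiv_commute[OF open_S x smooth_component])
  moreover have "(\<Sum>k\<in>UNIV. conn (antiholo U) i k x * yd (holo V) k x) =
     (\<Sum>j\<in>UNIV. \<Sum>k\<in>UNIV. of_real (christoffel G i j k (y x)) * yd (antiholo U) j x * yd (holo V) k x)"
    unfolding conn_def by (subst sum.swap) (simp add: sum_distrib_right)
  ultimately show ?thesis using pluriharmonic[OF x] unfolding nabla_def by simp
qed

text \<open>Both iterated covariant derivatives in the commutator vanish, since the inner one already does.\<close>

lemma curvature_antiholo_antiholo:
  assumes x: "x \<in> S"
  shows "ccurv G (y x) i (\<lambda>a. yd (antiholo U) a x) (\<lambda>b. yd (antiholo U') b x) (\<lambda>k. yd (holo V) k x) = 0"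
  using nabla_commutator[where u = "yd (holo V)" and X = "antiholo U" and Y = "antiholo U'" and i = i, OF x smooth_yd]
  by (simp add: nabla_nabla_vanishing[OF x smooth_yd nabla_antiholo_yd])

end

text \<open>
  The section of the pulled back tangent bundle obtained by applying \<open>dy\<close> to a holomorphic
  combination, with coefficients \<open>w\<close>, of the constant (1,0)-vectors \<open>e\<close>.
\<close>

locale pluriharmonic_lift = pluriharmonic_into_chart G T S y
  for G :: "real^'n::finite \<Rightarrow> real^'n^'n" and T and S :: "(complex^'k::finite) set" and y +
  fixes e :: "'m::finite \<Rightarrow> complex^'k" and w :: "'m \<Rightarrow> complex^'k \<Rightarrow> complex"
  assumes smooth_w: "Cinf_on (w a) S"
    and holomorphic_w: "x \<in> S \<Longrightarrow> cderiv (antiholo U) (w a) x = 0"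
begin

definition lift :: "'n \<Rightarrow> complex^'k \<Rightarrow> complex" where
  "lift i x = (\<Sum>a\<in>UNIV. yd (holo (e a)) i x * w a x)"

lemma smooth_lift: "Cinf_on (lift i) S"
  unfolding lift_def[abs_def] by (intro Cinf_on_sum Cinf_on_mult open_S smooth_yd smooth_w)

lemma nabla_antiholo_lift: "x \<in> S \<Longrightarrow> nabla (antiholo U) lift i x = 0"
  using nabla_sum_scale[where s = "\<lambda>a. yd (holo (e a))" and w = w and I = UNIV, OF _ smooth_yd smooth_w, of x "antiholo U" i]
  unfolding lift_def[abs_def] by (simp add: nabla_antiholo_yd holomorphic_w)

text \<open>The conjugate of the section is a combination of vectors \<open>dy(X)\<close> with \<open>X\<close> of type (0,1), so
  \<open>curvature_antiholo_antiholo\<close> applies to each summand.\<close>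

lemma curvature_antiholo_lift:
  assumes x: "x \<in> S"
  shows "ccurv G (y x) i (\<lambda>a. yd (antiholo U) a x) (\<lambda>b. cnj (lift b x)) (\<lambda>k. yd (holo V) k x) = 0"
proof -
  have "cnj (lift b x) = (\<Sum>a\<in>UNIV. yd (antiholo (e a)) b x * cnj (w a x))" for b
    by (simp add: lift_def yd_conj_dir[OF x])
  then show ?thesis
    using ccurv_sum[where Y = "\<lambda>a b. yd (antiholo (e a)) b x" and c = "\<lambda>a. cnj (w a x)"]
    by (simp add: curvature_antiholo_antiholo[OF x])
qed

abbreviation energy :: "complex^'k \<Rightarrow> complex" where
  "energy \<equiv> pair lift (\<lambda>i x. cnj (lift i x))"

lemma smooth_cnj_lift: "Cinf_on (\<lambda>x. cnj (lift i x)) S"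
  by (rule Cinf_on_cnj[OF open_S smooth_lift])

lemma smooth_energy: "Cinf_on energy S"
  by (rule smooth_pair[OF smooth_lift smooth_cnj_lift])

lemma energy_antiholo:
  assumes x: "x \<in> S"
  shows "cderiv (antiholo V) energy x = pair lift (\<lambda>i x. cnj (nabla (holo V) lift i x)) x"
proof -
  have "pair (nabla (antiholo V) lift) (\<lambda>i x. cnj (lift i x)) x = pair (\<lambda>i x. 0) (\<lambda>i x. cnj (lift i x)) x"
    by (rule pair_cong) (simp_all add: nabla_antiholo_lift[OF x])
  moreover have "pair lift (nabla (antiholo V) (\<lambda>i x. cnj (lift i x))) x =
      pair lift (\<lambda>i x. cnj (nabla (holo V) lift i x)) x"
    by (rule pair_cong) (simp_all add: nabla_conj_dir[OF x smooth_lift])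
  ultimately show ?thesis
    unfolding pair_deriv[OF x smooth_lift smooth_cnj_lift] by simp
qed

lemma energy_holo:
  assumes x: "x \<in> S"
  shows "cderiv (holo V) energy x = pair (nabla (holo V) lift) (\<lambda>i x. cnj (lift i x)) x"
proof -
  have "nabla (holo V) (\<lambda>i x. cnj (lift i x)) i x = 0" for i
    using nabla_conj_dir[where u = lift and X = "antiholo V" and i = i, OF x smooth_lift] nabla_antiholo_lift[OF x] by simp
  then have "pair lift (nabla (holo V) (\<lambda>i x. cnj (lift i x))) x = pair lift (\<lambda>i x. 0) x"
    by (intro pair_cong) simp_all
  then show ?thesis
    unfolding pair_deriv[OF x smooth_lift smooth_cnj_lift] by simp
qed

text \<open>Since \<open>lift\<close> is parallel in (0,1)-directions, the (0,1)-derivative of the energy differentiates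
  only the conjugate factor.  Differentiating once more, the covariant derivatives falling on that
  factor can be commuted, which produces the curvature.\<close>

lemma energy_mixed:
  assumes x: "x \<in> S"
  shows "cderiv (holo V) (cderiv (antiholo V) energy) x =
    pair (nabla (holo V) lift) (\<lambda>i x. cnj (nabla (holo V) lift i x)) x
    + pair lift (\<lambda>i x. ccurv G (y x) i (\<lambda>a. yd (holo V) a x) (\<lambda>b. yd (antiholo V) b x) (\<lambda>k. cnj (lift k x))) x"
proof -
  let ?a = "nabla (holo V) lift"
  have sa: "Cinf_on (?a i) S" for i by (rule smooth_nabla[OF smooth_lift])
  have "cderiv (holo V) (cderiv (antiholo V) energy) x = cderiv (holo V) (pair lift (\<lambda>i x. cnj (?a i x))) x"
    by (rule cderiv_cong[OF open_S x energy_antiholo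
          Cinf_on_differentiable[OF Cinf_on_cderiv[OF open_S smooth_energy] x]])
  also have "\<dots> = pair ?a (\<lambda>i x. cnj (?a i x)) x + pair lift (nabla (holo V) (\<lambda>i x. cnj (?a i x))) x"
    by (rule pair_deriv[OF x smooth_lift Cinf_on_cnj[OF open_S sa]])
  also have "pair lift (nabla (holo V) (\<lambda>i x. cnj (?a i x))) x = pair lift
     (\<lambda>i x. ccurv G (y x) i (\<lambda>a. yd (holo V) a x) (\<lambda>b. yd (antiholo V) b x) (\<lambda>k. cnj (lift k x))) x"
  proof (rule pair_cong)
    fix i
    have "nabla (antiholo V) ?a i x =
        ccurv G (y x) i (\<lambda>a. yd (antiholo V) a x) (\<lambda>b. yd (holo V) b x) (\<lambda>k. lift k x)"
      using nabla_commutator[where u = lift and X = "antiholo V" and Y = "holo V" and i = i, OF x smooth_lift]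
      by (simp add: nabla_nabla_vanishing[OF x smooth_lift nabla_antiholo_lift])
    moreover have "nabla (holo V) (\<lambda>i x. cnj (?a i x)) i x = cnj (nabla (antiholo V) ?a i x)"
      using nabla_conj_dir[where u = "nabla (holo V) lift" and X = "antiholo V" and i = i, OF x sa] by simp
    ultimately show "nabla (holo V) (\<lambda>i x. cnj (?a i x)) i x =
       ccurv G (y x) i (\<lambda>a. yd (holo V) a x) (\<lambda>b. yd (antiholo V) b x) (\<lambda>k. cnj (lift k x))"
      by (simp add: ccurv_cnj yd_conj_dir[OF x])
  qed simp
  finally show ?thesis .
qed

text \<open>Rearranges the slots of the curvature tensor.  Write \<open>P\<close>, \<open>Q\<close> for the two derivatives of
  \<open>y\<close> and \<open>u\<close> for the section.  Skew-symmetry in the last pair moves the lowered index from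
  \<open>Q\<close> to \<open>u\<close>, which leaves \<open>R(P, cnj u) Q\<close>.  It differs from \<open>R(P, Q) (cnj u)\<close> by
  \<open>R(Q, cnj u) P\<close> up to sign, by the Bianchi identity, and that is zero.\<close>

lemma curvature_term:
  assumes x: "x \<in> S"
  shows "(\<Sum>i\<in>UNIV. \<Sum>j\<in>UNIV. \<Sum>k\<in>UNIV. \<Sum>l\<in>UNIV. of_real (curvature G i l k j (y x)) *
      yd (holo V) i x * yd (antiholo V) j x * lift k x * cnj (lift l x)) =
    - pair lift (\<lambda>i x. ccurv G (y x) i (\<lambda>a. yd (holo V) a x) (\<lambda>b. yd (antiholo V) b x) (\<lambda>k. cnj (lift k x))) x"
proof -
  note yT = y_in_T[OF x]
  let ?P = "\<lambda>i. yd (holo V) i x" and ?Q = "\<lambda>i. yd (antiholo V) i x" and ?u = "\<lambda>k. lift k x"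
  let ?R = "\<lambda>s i j k. riemann_coeff G s i j k (y x)" and ?g = "\<lambda>i j. G (y x) $ i $ j"
  have K: "curvature G i l k j (y x) = - (\<Sum>s\<in>UNIV. ?g k s * ?R s i l j)" for i l k j
    unfolding curvature_eq[OF yT] riemann_skew[OF yT, of j i l k] by (simp add: metric_sym[OF yT, of k])
  have "(\<Sum>i\<in>UNIV. \<Sum>j\<in>UNIV. \<Sum>k\<in>UNIV. \<Sum>l\<in>UNIV. of_real (curvature G i l k j (y x)) *
      ?P i * ?Q j * ?u k * cnj (?u l)) =
    - (\<Sum>i\<in>UNIV. \<Sum>j\<in>UNIV. \<Sum>k\<in>UNIV. \<Sum>l\<in>UNIV. \<Sum>s\<in>UNIV.
        of_real (?g k s) * ?u k * (of_real (?R s i l j) * ?P i * cnj (?u l) * ?Q j))"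
    unfolding K by (simp add: sum_distrib_left sum_distrib_right sum_negf mult_ac)
  also have "\<dots> = - pair lift (\<lambda>s x. ccurv G (y x) s (\<lambda>i. yd (holo V) i x) (\<lambda>l. cnj (lift l x)) (\<lambda>j. yd (antiholo V) j x)) x"
    by (subst sum5_reorder) (simp add: pair_def ccurv_def sum_distrib_left)
  also have "pair lift (\<lambda>s x. ccurv G (y x) s (\<lambda>i. yd (holo V) i x) (\<lambda>l. cnj (lift l x)) (\<lambda>j. yd (antiholo V) j x)) x =
    pair lift (\<lambda>i x. ccurv G (y x) i (\<lambda>a. yd (holo V) a x) (\<lambda>b. yd (antiholo V) b x) (\<lambda>k. cnj (lift k x))) x"
  proof (rule pair_cong)
    fix s
    show "ccurv G (y x) s ?P (\<lambda>l. cnj (?u l)) ?Q = ccurv G (y x) s ?P ?Q (\<lambda>l. cnj (?u l))"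
      using ccurv_bianchi[OF yT, of s ?P "\<lambda>l. cnj (?u l)" ?Q] ccurv_antisym[of G "y x" s "\<lambda>l. cnj (?u l)" ?Q ?P]
        ccurv_antisym[of G "y x" s ?Q ?P "\<lambda>l. cnj (?u l)"] curvature_antiholo_lift[OF x, of s V V]
      by simp
  qed simp
  finally show ?thesis .
qed

text \<open>With \<open>a = \<nabla>\<^sub>V u\<close> the four terms of \<open>cderiv_weighted_mixed\<close> are \<open>g(a, cnj a)\<close> plus
  curvature, \<open>c g(u, cnj a)\<close>, \<open>cnj c g(a, cnj u)\<close> and \<open>c cnj c g(u, cnj u)\<close>: they are the
  expansion of the square of \<open>a + c u\<close>.  The curvature is cancelled by the last summand on the
  left.\<close>

lemma bochner_identity:
  fixes V :: "complex^'k"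
  assumes x: "x \<in> S" and H: "Cinf_on H S" "\<And>x. x \<in> S \<Longrightarrow> H x > 0"
  defines "c \<equiv> cderiv (holo V) (\<lambda>x. complex_of_real (ln (inverse (H x)))) x"
  shows "cderiv (holo V) (cderiv (antiholo V) (\<lambda>x. energy x * of_real (inverse (H x)))) x
      - energy x * of_real (inverse (H x)) *
          cderiv (holo V) (cderiv (antiholo V) (\<lambda>x. of_real (ln (inverse (H x))))) x
      + of_real (inverse (H x)) * (\<Sum>i\<in>UNIV. \<Sum>j\<in>UNIV. \<Sum>k\<in>UNIV. \<Sum>l\<in>UNIV. of_real (curvature G i l k j (y x)) *
          yd (holo V) i x * yd (antiholo V) j x * lift k x * cnj (lift l x))
    = of_real (inverse (H x)) * pair (\<lambda>i x. nabla (holo V) lift i x + c * lift i x)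
        (\<lambda>i x. cnj (nabla (holo V) lift i x + c * lift i x)) x"
proof -
  let ?a = "nabla (holo V) lift" and ?\<phi> = "\<lambda>x. complex_of_real (ln (inverse (H x)))"
  let ?cu = "\<lambda>i x. cnj (lift i x)" and ?ca = "\<lambda>i x. cnj (nabla (holo V) lift i x)"
  have inv: "Cinf_on (\<lambda>x. inverse (H x)) S"
    using H(2) by (intro Cinf_on_inverse open_S H(1)) force
  have \<phi>: "Cinf_on ?\<phi> S"
    using H(2) by (intro Cinf_on_of_real Cinf_on_ln open_S inv) auto
  have Q\<phi>: "cderiv (antiholo V) ?\<phi> x = cnj c"
    using cderiv_cnj[OF Cinf_on_differentiable[OF \<phi> x], of "antiholo V"] by (simp add: c_def)
  have square: "pair (\<lambda>i x. ?a i x + c * lift i x) (\<lambda>i x. cnj (?a i x + c * lift i x)) x =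
    pair ?a ?ca x + c * pair lift ?ca x + cnj c * pair ?a ?cu x + c * cnj c * energy x"
    unfolding pair_def by (simp add: algebra_simps sum.distrib sum_distrib_left)
  have "cderiv (holo V) (cderiv (antiholo V) (\<lambda>x. energy x * of_real (inverse (H x)))) x
      - energy x * of_real (inverse (H x)) * cderiv (holo V) (cderiv (antiholo V) ?\<phi>) x =
    of_real (inverse (H x)) * (cderiv (holo V) (cderiv (antiholo V) energy) x
      + cderiv (holo V) ?\<phi> x * cderiv (antiholo V) energy x + cderiv (holo V) energy x * cderiv (antiholo V) ?\<phi> x
      + energy x * cderiv (holo V) ?\<phi> x * cderiv (antiholo V) ?\<phi> x)"
    by (rule cderiv_weighted_mixed[OF open_S x smooth_energy Cinf_on_of_real[OF open_S inv] \<phi>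
          cderiv_inverse_eq_ln[OF open_S _ H]])
  then show ?thesis
    unfolding square curvature_term[OF x]
    unfolding energy_mixed[OF x] energy_holo[OF x] energy_antiholo[OF x] Q\<phi> c_def[symmetric]
    by (simp only: algebra_simps mult_minus_right right_minus add_0_left)
qed

lemma bochner_nonneg:
  assumes x: "x \<in> S" and H: "Cinf_on H S" "\<And>x. x \<in> S \<Longrightarrow> H x > 0"
  shows "cderiv (holo V) (cderiv (antiholo V) (\<lambda>x. energy x * of_real (inverse (H x)))) x
      - energy x * of_real (inverse (H x)) *
          cderiv (holo V) (cderiv (antiholo V) (\<lambda>x. of_real (ln (inverse (H x))))) x
      + of_real (inverse (H x)) * (\<Sum>i\<in>UNIV. \<Sum>j\<in>UNIV. \<Sum>k\<in>UNIV. \<Sum>l\<in>UNIV. of_real (curvature G i l k j (y x)) *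
          yd (holo V) i x * yd (antiholo V) j x * lift k x * cnj (lift l x)) \<in> \<real>\<^sub>\<ge>\<^sub>0"
  by (subst bochner_identity[OF assms], assumption, intro nonneg_Reals_mult_I pair_nonneg[OF x])
     (use H(2)[OF x] in simp)

end

section \<open>Wirtinger derivatives and contracted (1,1)-forms\<close>

lemma i_smult_axis: "\<i> *s axis a 1 = axis a \<i>"
  by (vector axis_def)

lemma cderiv_holo_eq:
  assumes "F differentiable (at z)"
  shows "cderiv (holo V) F z = (frechet_derivative F (at z) V - \<i> * frechet_derivative F (at z) (\<i> *s V)) / 2"
    and "cderiv (antiholo V) F z = (frechet_derivative F (at z) V + \<i> * frechet_derivative F (at z) (\<i> *s V)) / 2"
proof -
  have lin: "linear (frechet_derivative F (at z))"
    using assms by (rule linear_frechet_derivative)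
  show "cderiv (holo V) F z = (frechet_derivative F (at z) V - \<i> * frechet_derivative F (at z) (\<i> *s V)) / 2"
    and "cderiv (antiholo V) F z = (frechet_derivative F (at z) V + \<i> * frechet_derivative F (at z) (\<i> *s V)) / 2"
    unfolding cderiv_def holo_def conj_dir_def
    by (simp_all add: linear_neg[OF lin] linear_scale[OF lin]) (simp_all add: scaleR_conv_of_real field_simps)
qed

lemma dz_eq_cderiv:
  assumes "F differentiable (at z)"
  shows "dz F a z = cderiv (holo (axis a 1)) F z" and "dzbar F a z = cderiv (antiholo (axis a 1)) F z"
  unfolding dz_def dzbar_def cderiv_holo_eq[OF assms] by (simp_all add: i_smult_axis)

lemma cderiv_holo_expansion:
  assumes "F differentiable (at z)"
  shows "cderiv (holo V) F z = (\<Sum>a\<in>UNIV. dz F a z * V $ a)"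
    and "cderiv (antiholo V) F z = (\<Sum>a\<in>UNIV. dzbar F a z * cnj (V $ a))"
proof -
  let ?D = "frechet_derivative F (at z)"
  have lin: "linear ?D" using assms by (rule linear_frechet_derivative)
  have ax: "axis a w = Re w *\<^sub>R axis a (1::complex) + Im w *\<^sub>R axis a \<i>" for a :: 'a and w
    by (vector axis_def) (simp add: complex_eq_iff)
  have D: "?D U = (\<Sum>a\<in>UNIV. of_real (Re (U $ a)) * ?D (axis a 1) + of_real (Im (U $ a)) * ?D (axis a \<i>))" for U
  proof -
    have "U = (\<Sum>a\<in>UNIV. axis a (U $ a))" by (simp add: vec_eq_iff axis_def)
    then have "?D U = (\<Sum>a\<in>UNIV. ?D (axis a (U $ a)))" by (metis linear_sum[OF lin])
    also have "\<dots> = (\<Sum>a\<in>UNIV. of_real (Re (U $ a)) * ?D (axis a 1) + of_real (Im (U $ a)) * ?D (axis a \<i>))"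
      by (intro sum.cong refl, subst ax) (simp add: linear_add[OF lin] linear_scale[OF lin], simp add: scaleR_conv_of_real)
    finally show ?thesis .
  qed
  have "cderiv (holo V) F z = (\<Sum>a\<in>UNIV.
     (of_real (Re (V $ a)) * ?D (axis a 1) + of_real (Im (V $ a)) * ?D (axis a \<i>) -
      \<i> * (of_real (- Im (V $ a)) * ?D (axis a 1) + of_real (Re (V $ a)) * ?D (axis a \<i>))) / 2)"
    unfolding cderiv_holo_eq[OF assms] D[of V] D[of "\<i> *s V"]
    by (simp add: sum_divide_distrib[symmetric]) (simp add: sum_distrib_left sum.distrib sum_subtractf algebra_simps)
  also have "\<dots> = (\<Sum>a\<in>UNIV. dz F a z * V $ a)"
    by (intro sum.cong refl) (simp add: dz_def complex_eq_iff algebra_simps)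
  finally show "cderiv (holo V) F z = (\<Sum>a\<in>UNIV. dz F a z * V $ a)" .
  have "cderiv (antiholo V) F z = (\<Sum>a\<in>UNIV.
     (of_real (Re (V $ a)) * ?D (axis a 1) + of_real (Im (V $ a)) * ?D (axis a \<i>) +
      \<i> * (of_real (- Im (V $ a)) * ?D (axis a 1) + of_real (Re (V $ a)) * ?D (axis a \<i>))) / 2)"
    unfolding cderiv_holo_eq[OF assms] D[of V] D[of "\<i> *s V"]
    by (simp add: sum_divide_distrib[symmetric]) (simp add: sum_distrib_left sum.distrib sum_subtractf algebra_simps)
  also have "\<dots> = (\<Sum>a\<in>UNIV. dzbar F a z * cnj (V $ a))"
    by (intro sum.cong refl) (simp add: dzbar_def complex_eq_iff algebra_simps)
  finally show "cderiv (antiholo V) F z = (\<Sum>a\<in>UNIV. dzbar F a z * cnj (V $ a))" .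
qed

lemma Cinf_on_dz:
  assumes "open S" "Cinf_on F S"
  shows "Cinf_on (dz F a) S" "Cinf_on (dzbar F a) S"
  unfolding dz_def[abs_def] dzbar_def[abs_def] divide_inverse
  by (intro Cinf_on_add Cinf_on_diff Cinf_on_mult Cinf_on_const Cinf_on_frechet assms)+

text \<open>Evaluating the form on one constant vector \<open>V\<close> and its conjugate suffices for
  semi-positivity; this is an iterated derivative, to which the calculus above applies.\<close>

lemma ddbar_coeffs_contract:
  assumes S: "open S" "z \<in> S" and F: "Cinf_on F S"
  shows "(\<Sum>I\<in>UNIV. \<Sum>J\<in>UNIV. ddbar_coeffs F z $ I $ J * V $ I * cnj (V $ J)) =
    cderiv (holo V) (cderiv (antiholo V) F) z"
proof -
  note d = Cinf_on_differentiable[OF Cinf_on_dz(2)[OF S(1) F] S(2)]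
  have "cderiv (holo V) (cderiv (antiholo V) F) z = cderiv (holo V) (\<lambda>z. \<Sum>J\<in>UNIV. dzbar F J z * cnj (V $ J)) z"
    by (rule cderiv_cong[OF S cderiv_holo_expansion(2)[OF Cinf_on_differentiable[OF F]]
          Cinf_on_differentiable[OF Cinf_on_cderiv[OF S(1) F] S(2)]])
  also have "\<dots> = (\<Sum>J\<in>UNIV. \<Sum>I\<in>UNIV. dz (dzbar F J) I z * V $ I * cnj (V $ J))"
    by (simp add: cderiv_sum cderiv_mult d cderiv_holo_expansion(1) sum_distrib_right)
  also have "\<dots> = (\<Sum>I\<in>UNIV. \<Sum>J\<in>UNIV. dz (dzbar F J) I z * V $ I * cnj (V $ J))"
    by (rule sum.swap)
  finally show ?thesis by (simp add: ddbar_coeffs_def)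
qed

lemma ddbar_coeffs_cong:
  assumes S: "open S" "z \<in> S" and F: "Cinf_on F S" and eq: "\<And>x. x \<in> S \<Longrightarrow> F x = F' x"
  shows "ddbar_coeffs F' z = ddbar_coeffs F z"
proof -
  have "dzbar F J x = dzbar F' J x" if "x \<in> S" for J x
    unfolding dzbar_def
    by (simp add: frechet_derivative_transform_within_open[OF Cinf_on_differentiable[OF F that] S(1) that eq])
  then have "dz (dzbar F' J) I z = dz (dzbar F J) I z" for I J
    unfolding dz_def
    by (simp add: frechet_derivative_transform_within_open
        [OF Cinf_on_differentiable[OF Cinf_on_dz(2)[OF S(1) F] S(2)] S, where g = "dzbar F' J"])
  then show ?thesis by (simp add: ddbar_coeffs_def)
qed

lemma cderiv_precompose_linear:
  assumes "bounded_linear L" "F differentiable (at (L x))"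
  shows "cderiv X (\<lambda>x. F (L x)) x = cderiv (L (fst X), L (snd X)) F (L x)"
  by (subst cderiv_eqI[OF has_derivative_compose[OF bounded_linear_imp_has_derivative[OF assms(1)]
          assms(2)[unfolded frechet_derivative_works]]])
     (simp add: cderiv_def)

lemma bilinear_contract:
  fixes \<Gamma> :: "'j::finite \<Rightarrow> 'k::finite \<Rightarrow> complex" and a :: "'a::finite \<Rightarrow> complex" and b :: "'b::finite \<Rightarrow> complex"
  shows "(\<Sum>j\<in>UNIV. \<Sum>k\<in>UNIV. \<Gamma> j k * (\<Sum>\<beta>\<in>UNIV. P j \<beta> * a \<beta>) * (\<Sum>\<alpha>\<in>UNIV. Q k \<alpha> * b \<alpha>)) =
    (\<Sum>\<beta>\<in>UNIV. \<Sum>\<alpha>\<in>UNIV. (\<Sum>j\<in>UNIV. \<Sum>k\<in>UNIV. \<Gamma> j k * P j \<beta> * Q k \<alpha>) * a \<beta> * b \<alpha>)"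
proof -
  let ?t = "\<lambda>j k \<beta> \<alpha>. \<Gamma> j k * P j \<beta> * Q k \<alpha> * a \<beta> * b \<alpha>"
  have "(\<Sum>j\<in>UNIV. \<Sum>k\<in>UNIV. \<Gamma> j k * (\<Sum>\<beta>\<in>UNIV. P j \<beta> * a \<beta>) * (\<Sum>\<alpha>\<in>UNIV. Q k \<alpha> * b \<alpha>)) =
    (\<Sum>j\<in>UNIV. \<Sum>k\<in>UNIV. \<Sum>\<beta>\<in>UNIV. \<Sum>\<alpha>\<in>UNIV. ?t j k \<beta> \<alpha>)"
    by (simp only: mult.assoc sum_product) (simp add: sum_distrib_left mult_ac)
  also have "\<dots> = (\<Sum>j\<in>UNIV. \<Sum>\<beta>\<in>UNIV. \<Sum>\<alpha>\<in>UNIV. \<Sum>k\<in>UNIV. ?t j k \<beta> \<alpha>)"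
    by (rule sum.cong[OF refl], subst sum.swap, rule sum.cong[OF refl], rule sum.swap)
  also have "\<dots> = (\<Sum>\<beta>\<in>UNIV. \<Sum>\<alpha>\<in>UNIV. \<Sum>j\<in>UNIV. \<Sum>k\<in>UNIV. ?t j k \<beta> \<alpha>)"
    by (subst sum.swap, rule sum.cong[OF refl], rule sum.swap)
  finally show ?thesis by (simp add: sum_distrib_right)
qed

lemma sum_swap4:
  fixes t :: "'a \<Rightarrow> 'i::finite \<Rightarrow> 'j::finite \<Rightarrow> 'k::finite \<Rightarrow> 'l::finite \<Rightarrow> complex"
  shows "(\<Sum>\<alpha>\<in>A. \<Sum>i\<in>UNIV. \<Sum>j\<in>UNIV. \<Sum>k\<in>UNIV. \<Sum>l\<in>UNIV. t \<alpha> i j k l) =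
    (\<Sum>i\<in>UNIV. \<Sum>j\<in>UNIV. \<Sum>k\<in>UNIV. \<Sum>l\<in>UNIV. \<Sum>\<alpha>\<in>A. t \<alpha> i j k l)"
  by (subst sum.swap, rule sum.cong[OF refl], subst sum.swap, rule sum.cong[OF refl],
      subst sum.swap, rule sum.cong[OF refl], rule sum.swap)

lemma sum_sum_type: "(\<Sum>I\<in>UNIV. t I) = (\<Sum>\<alpha>\<in>UNIV. t (Inl \<alpha>)) + (\<Sum>\<gamma>\<in>UNIV. t (Inr \<gamma>))"
  for t :: "'a::finite + 'b::finite \<Rightarrow> complex"
  by (simp add: UNIV_Plus_UNIV[symmetric] sum.Plus del: UNIV_Plus_UNIV)

lemma contract_difference:
  fixes a b C :: "'i \<Rightarrow> 'j \<Rightarrow> complex"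
  shows "(\<Sum>I\<in>A. \<Sum>J\<in>B. (a I J - (b I J * y - C I J / h)) * V I * W J) =
    (\<Sum>I\<in>A. \<Sum>J\<in>B. a I J * V I * W J) - y * (\<Sum>I\<in>A. \<Sum>J\<in>B. b I J * V I * W J)
    + (\<Sum>I\<in>A. \<Sum>J\<in>B. C I J * V I * W J) / h"
proof -
  have "(a I J - (b I J * y - C I J / h)) * V I * W J =
    a I J * V I * W J - y * (b I J * V I * W J) + C I J * V I * W J / h" for I J
    by (simp add: algebra_simps)
  then show ?thesis
    by (simp add: sum.distrib sum_subtractf sum_distrib_left sum_divide_distrib)
qed

section \<open>Charts of the projectivized tangent bundle\<close>

definition base_coord :: "complex^('m::finite + 'm) \<Rightarrow> complex^'m" where
  "base_coord \<zeta> = (\<chi> \<alpha>. \<zeta> $ Inl \<alpha>)"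

text \<open>The section of the tautological bundle with \<open>W\<^sup>\<nu> = 1\<close>.  It is affine in the fibre coordinates,
  hence holomorphic.\<close>

definition fibre_vec :: "'m::finite \<Rightarrow> complex^('m + 'm) \<Rightarrow> complex^'m" where
  "fibre_vec \<nu> \<zeta> = (\<chi> \<gamma>. if \<gamma> = \<nu> then 1 else \<zeta> $ Inr \<gamma>)"

lemma bounded_linear_base_coord: "bounded_linear (base_coord :: complex^('m::finite + 'm) \<Rightarrow> complex^'m)"
proof -
  have "linear (base_coord :: complex^('m + 'm) \<Rightarrow> complex^'m)"
    by (rule linearI) (simp_all add: base_coord_def vec_eq_iff)
  then show ?thesis by (rule linear_conv_bounded_linear[THEN iffD1])
qed

lemma base_coord_holo:
  "(base_coord (fst (holo V)), base_coord (snd (holo V))) = holo (base_coord V)"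
  "(base_coord (fst (antiholo V)), base_coord (snd (antiholo V))) = antiholo (base_coord V)"
  by (simp_all add: holo_def conj_dir_def base_coord_def vec_eq_iff)

lemma Cinf_on_fibre_vec: "open S \<Longrightarrow> Cinf_on (\<lambda>\<zeta>. fibre_vec \<nu> \<zeta> $ a) S"
  by (cases "a = \<nu>") (simp_all add: fibre_vec_def Cinf_on_def Ck_on_linear[OF bounded_linear_vec_nth])

lemma fibre_vec_holomorphic: "cderiv (antiholo U) (\<lambda>\<zeta>. fibre_vec \<nu> \<zeta> $ a) x = 0"
proof (cases "a = \<nu>")
  case False
  have "((\<lambda>\<zeta>. \<zeta> $ Inr a) has_derivative (\<lambda>\<zeta>. \<zeta> $ Inr a)) (at x)" for x :: "complex^('a + 'a)"
    by (rule bounded_linear_imp_has_derivative[OF bounded_linear_vec_nth])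
  from cderiv_eqI[OF this] False show ?thesis
    by (simp add: fibre_vec_def holo_def conj_dir_def)
qed (simp add: fibre_vec_def)

text \<open>
  A chart of \<open>M\<close>, an index \<open>\<nu>\<close> and a chart of \<open>N\<close>.  Everything is expressed on \<open>total_dom\<close>,
  the part of the chart of the projectivized bundle that lies over points which \<open>f\<close> maps into the
  domain of the chart of \<open>N\<close>.
\<close>

locale projective_chart =
  fixes A :: "('a::{t2_space, second_countable_topology}, complex^'m::finite) chart set"
    and h :: "('a, 'm) hmetric"
    and B :: "('b::{t2_space, second_countable_topology}, real^'n::finite) chart set"
    and g :: "('b, 'n) rmetric"
    and f :: "'a \<Rightarrow> 'b" and c and \<nu> :: 'm and d
  assumes M: "hermitian_manifold A h"
    and N: "riemannian_manifold B g"
    and ph: "pluriharmonic A B g f"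
    and c: "c \<in> A" and d: "d \<in> B"
begin

definition base_dom :: "(complex^'m) set" where
  "base_dom = coord c ` (cdom c \<inter> f -` cdom d)"

definition total_dom :: "(complex^('m + 'm)) set" where
  "total_dom = base_coord -` base_dom"

definition y :: "complex^('m + 'm) \<Rightarrow> real^'n" where
  "y \<zeta> = local_rep c d f (base_coord \<zeta>)"

definition H :: "complex^('m + 'm) \<Rightarrow> real" where
  "H \<zeta> = hform h c (base_coord \<zeta>) (fibre_vec \<nu> \<zeta>)"

lemma complex_atlas: "complex_atlas A" and hermitian: "hermitian_metric A h"
  and smooth_atlas: "smooth_atlas B" and riemannian: "riemannian_metric B g"
  and smooth_f: "Defs.smooth_map A B f"
  using M N ph unfolding hermitian_manifold_def riemannian_manifold_def pluriharmonic_def by auto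

lemma charts: "is_chart c" "is_chart d"
  using complex_atlasD(1)[OF complex_atlas c] smooth_atlas d unfolding smooth_atlas_def by auto

lemma open_base_dom: "open base_dom"
proof -
  have "open (f -` cdom d)"
    using smooth_f charts unfolding smooth_map_def is_chart_def by (intro open_vimage) auto
  then show ?thesis unfolding base_dom_def by (rule open_coord_image[OF charts(1)])
qed

lemma open_total_dom: "open total_dom"
  unfolding total_dom_def
  by (intro open_vimage open_base_dom linear_continuous_on bounded_linear_base_coord)

lemma smooth_rep: "Cinf_on (local_rep c d f) base_dom"
  using smooth_f c d unfolding smooth_map_def base_dom_def by auto

lemma smooth_cmap: "Cinf_on (cmap c d f i) base_dom"
  unfolding cmap_def[abs_def]
  by (intro Cinf_on_of_real open_base_dom Cinf_on_compose_linear[OF _ bounded_linear_vec_nth] smooth_rep)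

lemma Cinf_on_base: "Cinf_on F base_dom \<Longrightarrow> Cinf_on (\<lambda>\<zeta>. F (base_coord \<zeta>)) total_dom"
  using Ck_on_precompose_linear[OF open_total_dom bounded_linear_base_coord, of _ F base_dom]
  unfolding Cinf_on_def by (auto simp: total_dom_def)

lemma total_point:
  assumes "\<zeta> \<in> total_dom"
  shows "base_pt c \<zeta> \<in> cdom c" "f (base_pt c \<zeta>) \<in> cdom d" "coord c (base_pt c \<zeta>) = base_coord \<zeta>"
    "y \<zeta> = coord d (f (base_pt c \<zeta>))" "base_coord \<zeta> \<in> base_dom"
proof -
  have b: "base_pt c \<zeta> = cinv c (base_coord \<zeta>)" by (simp add: base_pt_def base_coord_def)
  obtain q where q: "base_coord \<zeta> = coord c q" "q \<in> cdom c" "f q \<in> cdom d"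
    using assms unfolding total_dom_def base_dom_def by auto
  have "base_pt c \<zeta> = q" unfolding b q(1) by (rule chart_cinv[OF q(2) charts(1)])
  then show "base_pt c \<zeta> \<in> cdom c" "f (base_pt c \<zeta>) \<in> cdom d" "coord c (base_pt c \<zeta>) = base_coord \<zeta>"
    using q by auto
  show "y \<zeta> = coord d (f (base_pt c \<zeta>))"
    unfolding y_def local_rep_def b by simp
  show "base_coord \<zeta> \<in> base_dom" using assms by (simp add: total_dom_def)
qed

lemma base_dom_subset: "base_dom \<subseteq> crange c"
  unfolding base_dom_def crange_def by auto

lemma fibre_vec_nonzero: "fibre_vec \<nu> \<zeta> \<noteq> 0"
proof -
  have "fibre_vec \<nu> \<zeta> $ \<nu> = 1" by (simp add: fibre_vec_def)
  then show ?thesis by auto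
qed

lemma H_pos: "\<zeta> \<in> total_dom \<Longrightarrow> H \<zeta> > 0"
  using hermitian c fibre_vec_nonzero base_dom_subset total_point(5)[of \<zeta>]
  unfolding hermitian_metric_def H_def hform_def by blast

lemma smooth_H: "Cinf_on H total_dom"
proof -
  have "Cinf_on (h c) base_dom"
  proof -
    have "Cinf_on (h c) (crange c)" using hermitian c unfolding hermitian_metric_def by blast
    then show ?thesis using base_dom_subset Ck_on_subset unfolding Cinf_on_def by blast
  qed
  then have "Cinf_on (\<lambda>z. h c z $ \<gamma> $ \<delta>) base_dom" for \<gamma> \<delta>
    by (rule Cinf_on_matrix_entry[OF open_base_dom])
  then have hh: "Cinf_on (\<lambda>\<zeta>. h c (base_coord \<zeta>) $ \<gamma> $ \<delta>) total_dom" for \<gamma> \<delta>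
    by (rule Cinf_on_base)
  show ?thesis
    unfolding H_def[abs_def] hform_def
    by (intro Cinf_on_compose_linear[OF _ bounded_linear_Re] Cinf_on_sum Cinf_on_mult Cinf_on_cnj
        open_total_dom hh Cinf_on_fibre_vec)
qed

lemma cmap_total: "complex_of_real (y \<zeta> $ j) = cmap c d f j (base_coord \<zeta>)"
  by (simp add: cmap_def y_def)

text \<open>\<open>y\<close> is constant along the fibres, so only the base components of \<open>V\<close> enter.\<close>

lemma Dy_holo:
  assumes "\<zeta> \<in> total_dom"
  shows "cderiv (holo V) (\<lambda>\<zeta>. of_real (y \<zeta> $ j)) \<zeta> = (\<Sum>\<alpha>\<in>UNIV. fdz c d f j \<alpha> (base_coord \<zeta>) * V $ Inl \<alpha>)"
    and "cderiv (antiholo V) (\<lambda>\<zeta>. of_real (y \<zeta> $ j)) \<zeta> = (\<Sum>\<alpha>\<in>UNIV. fdzbar c d f j \<alpha> (base_coord \<zeta>) * cnj (V $ Inl \<alpha>))"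
proof -
  note df = Cinf_on_differentiable[OF smooth_cmap total_point(5)[OF assms]]
  show "cderiv (holo V) (\<lambda>\<zeta>. of_real (y \<zeta> $ j)) \<zeta> = (\<Sum>\<alpha>\<in>UNIV. fdz c d f j \<alpha> (base_coord \<zeta>) * V $ Inl \<alpha>)"
    and "cderiv (antiholo V) (\<lambda>\<zeta>. of_real (y \<zeta> $ j)) \<zeta> = (\<Sum>\<alpha>\<in>UNIV. fdzbar c d f j \<alpha> (base_coord \<zeta>) * cnj (V $ Inl \<alpha>))"
    unfolding cmap_total cderiv_precompose_linear[OF bounded_linear_base_coord df] base_coord_holo
      cderiv_holo_expansion[OF df]
    by (simp_all add: base_coord_def)
qed

sublocale map_into_chart "g d" "crange d" total_dom y
proof
  show "open (crange d)" using charts by (simp add: is_chart_def)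
  show "Cinf_on (g d) (crange d)" "z \<in> crange d \<Longrightarrow> g d z $ i $ j = g d z $ j $ i"
    "z \<in> crange d \<Longrightarrow> v \<noteq> 0 \<Longrightarrow> 0 < (\<Sum>i\<in>UNIV. \<Sum>j\<in>UNIV. g d z $ i $ j * v $ i * v $ j)" for z i j v
    using riemannian d unfolding riemannian_metric_def by blast+
  show "open total_dom" by (rule open_total_dom)
  show "y ` total_dom \<subseteq> crange d" by (auto simp: total_point(4) crange_def total_point(2))
  show "Cinf_on y total_dom" unfolding y_def[abs_def] by (rule Cinf_on_base[OF smooth_rep])
qed

lemmas yd_holo = Dy_holo[folded yd_def]

sublocale pluriharmonic_lift "g d" "crange d" total_dom y "\<lambda>a. axis (Inl a) 1" "\<lambda>a \<zeta>. fibre_vec \<nu> \<zeta> $ a"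
proof
  fix \<zeta> :: "complex^('m + 'm)" and V U :: "complex^('m + 'm)" and i
  assume z: "\<zeta> \<in> total_dom"
  let ?z = "base_coord \<zeta>"
  let ?\<Gamma> = "\<lambda>j k. complex_of_real (christoffel (g d) i j k (y \<zeta>))"
  have zb: "?z \<in> base_dom" by (rule total_point(5)[OF z])
  have sm: "Cinf_on (\<lambda>\<zeta>. fdzbar c d f i \<beta> (base_coord \<zeta>)) total_dom" for \<beta>
    by (rule Cinf_on_base[OF Cinf_on_dz(2)[OF open_base_dom smooth_cmap]])
  note df = Cinf_on_differentiable[OF Cinf_on_dz(2)[OF open_base_dom smooth_cmap] zb]
  have D: "cderiv (holo V) (\<lambda>\<zeta>. fdzbar c d f i \<beta> (base_coord \<zeta>)) \<zeta> =
      (\<Sum>\<alpha>\<in>UNIV. dz (fdzbar c d f i \<beta>) \<alpha> ?z * V $ Inl \<alpha>)" for \<beta>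
    unfolding cderiv_precompose_linear[OF bounded_linear_base_coord df] base_coord_holo
      cderiv_holo_expansion[OF df]
    by (simp add: base_coord_def)
  have "cderiv (holo V) (yd (antiholo U) i) \<zeta> =
      cderiv (holo V) (\<lambda>\<zeta>. \<Sum>\<beta>\<in>UNIV. fdzbar c d f i \<beta> (base_coord \<zeta>) * cnj (U $ Inl \<beta>)) \<zeta>"
    by (rule cderiv_cong[OF open_total_dom z yd_holo(2) Cinf_on_differentiable[OF smooth_yd z]])
  also have "\<dots> = (\<Sum>\<beta>\<in>UNIV. \<Sum>\<alpha>\<in>UNIV. dz (fdzbar c d f i \<beta>) \<alpha> ?z * cnj (U $ Inl \<beta>) * V $ Inl \<alpha>)"
    by (simp add: cderiv_sum cderiv_mult Cinf_on_differentiable[OF sm z] D sum_distrib_left sum_distrib_right mult_ac)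
  finally have 1: "cderiv (holo V) (yd (antiholo U) i) \<zeta> = \<dots>" .
  have 2: "(\<Sum>j\<in>UNIV. \<Sum>k\<in>UNIV. ?\<Gamma> j k * yd (antiholo U) j \<zeta> * yd (holo V) k \<zeta>) =
    (\<Sum>\<beta>\<in>UNIV. \<Sum>\<alpha>\<in>UNIV. (\<Sum>j\<in>UNIV. \<Sum>k\<in>UNIV. ?\<Gamma> j k * fdzbar c d f j \<beta> ?z * fdz c d f k \<alpha> ?z)
       * cnj (U $ Inl \<beta>) * V $ Inl \<alpha>)"
    unfolding yd_holo[OF z] bilinear_contract ..
  have "dz (fdzbar c d f i \<beta>) \<alpha> ?z +
      (\<Sum>j\<in>UNIV. \<Sum>k\<in>UNIV. ?\<Gamma> j k * fdzbar c d f j \<beta> ?z * fdz c d f k \<alpha> ?z) = 0" for \<alpha> \<beta>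
    using ph c d total_point(1,2)[OF z] unfolding pluriharmonic_def total_point(3,4)[OF z, symmetric] 
    by (simp add: total_point(4)[OF z])
  then show "cderiv (holo V) (yd (antiholo U) i) \<zeta> +
    (\<Sum>j\<in>UNIV. \<Sum>k\<in>UNIV. ?\<Gamma> j k * yd (antiholo U) j \<zeta> * yd (holo V) k \<zeta>) = 0"
    unfolding 1 2 by (simp add: sum.distrib[symmetric] distrib_right[symmetric])
next
  show "Cinf_on (\<lambda>\<zeta>. fibre_vec \<nu> \<zeta> $ a) total_dom" for a by (rule Cinf_on_fibre_vec[OF open_total_dom])
  show "cderiv (antiholo U) (\<lambda>\<zeta>. fibre_vec \<nu> \<zeta> $ a) x = 0" for U a x by (rule fibre_vec_holomorphic)
qed

text \<open>Identifies the abstract section with \<open>f\<^sup>i\<^sub>\<alpha> W\<^sup>\<alpha>\<close>, and thereby the energy with the numerator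
  of \<open>Y\<close>.\<close>

lemma lift_eq:
  assumes "\<zeta> \<in> total_dom"
  shows "lift i \<zeta> = fcontract c d f (base_pt c \<zeta>) (fibre_vec \<nu> \<zeta>) i"
proof -
  have "yd (holo (axis (Inl a) 1)) i \<zeta> = fdz c d f i a (base_coord \<zeta>)" for a
    unfolding yd_holo[OF assms] by (simp add: axis_def if_distrib sum.delta cong: if_cong)
  then show ?thesis by (simp add: lift_def fcontract_def total_point(3)[OF assms])
qed

lemma lift_vec_tangent:
  assumes "\<zeta> \<in> total_dom"
  shows "lift_vec A c \<nu> \<zeta> \<in> tangent_space A (base_pt c \<zeta>)" "lift_vec A c \<nu> \<zeta> c = fibre_vec \<nu> \<zeta>"
  unfolding lift_vec_def fibre_vec_def[symmetric]
  by (rule tvec_in_tangent_space[OF complex_atlas c total_point(1)[OF assms]])+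

lemma H_fun_lift:
  assumes "\<zeta> \<in> total_dom"
  shows "H_fun A h (base_pt c \<zeta>) (lift_vec A c \<nu> \<zeta>) = H \<zeta>"
  unfolding H_fun_eq[OF M c total_point(1)[OF assms] lift_vec_tangent(1)[OF assms]]
  by (simp add: lift_vec_tangent(2)[OF assms] total_point(3)[OF assms] H_def)

lemma Y_fun_lift:
  assumes z: "\<zeta> \<in> total_dom"
  shows "Y_fun A h B g f (proj_point A c \<nu> \<zeta>) = energy \<zeta> * of_real (inverse (H \<zeta>))"
proof -
  let ?v = "lift_vec A c \<nu> \<zeta>" and ?p = "base_pt c \<zeta>"
  have v0: "?v \<noteq> (\<lambda>_. 0)"
    using lift_vec_tangent(2)[OF z] fibre_vec_nonzero by (metis)
  have "?v = (\<lambda>c. 1 *s ?v c)" by simp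
  then have vL: "?v \<in> cline ?v" unfolding cline_def by blast
  have "(?p, cline ?v) \<in> proj_tangent_bundle A"
    using lift_vec_tangent(1)[OF z] v0 unfolding proj_tangent_bundle_def by blast
  from Y_fun_eq[OF M N smooth_f this c total_point(1)[OF z] d total_point(2)[OF z] vL v0]
  show ?thesis
    unfolding proj_point_def yform_fcontract lift_vec_tangent(2)[OF z] lift_eq[OF z, symmetric]
    by (simp add: pair_def lift_eq[OF z] total_point(3,4)[OF z] H_def divide_inverse)
qed

lemma fdzbar_cnj:
  assumes "z \<in> base_dom"
  shows "fdzbar c d f i \<beta> z = cnj (fdz c d f i \<beta> z)"
proof -
  note df = Cinf_on_differentiable[OF smooth_cmap assms]
  have "cderiv (antiholo V) (\<lambda>z. cnj (cmap c d f i z)) z = cnj (cderiv (holo V) (cmap c d f i) z)" for V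
    using cderiv_cnj[OF df, of "antiholo V"] by simp
  then show ?thesis unfolding dz_eq_cderiv[OF df] by (simp add: cmap_def[abs_def])
qed

text \<open>The vector \<open>v\<close> of the line need not be normalized.  The form is sesquilinear in \<open>v\<close>, so it
  scales by \<open>s * cnj s\<close>, as \<open>H\<close> does.\<close>

lemma curvature_form_contract:
  assumes z: "\<zeta> \<in> total_dom" and W: "v c = s *s fibre_vec \<nu> \<zeta>"
  shows "(\<Sum>I\<in>UNIV. \<Sum>J\<in>UNIV. curvature_form g f c d (base_pt c \<zeta>) v $ I $ J * V $ I * cnj (V $ J)) =
    s * cnj s * (\<Sum>i\<in>UNIV. \<Sum>j\<in>UNIV. \<Sum>k\<in>UNIV. \<Sum>l\<in>UNIV. of_real (curvature (g d) i l k j (y \<zeta>)) *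
      yd (holo V) i \<zeta> * yd (antiholo V) j \<zeta> * lift k \<zeta> * cnj (lift l \<zeta>))"
proof -
  let ?z = "base_coord \<zeta>" and ?p = "base_pt c \<zeta>"
  let ?R = "\<lambda>i j k l. complex_of_real (curvature (g d) i l k j (y \<zeta>))"
  let ?a = "\<lambda>i \<alpha>. fdz c d f i \<alpha> ?z" and ?b = "\<lambda>i \<beta>. fdzbar c d f i \<beta> ?z"
  have u: "(\<Sum>\<gamma>\<in>UNIV. ?a k \<gamma> * v c $ \<gamma>) = s * lift k \<zeta>" for k
    unfolding lift_eq[OF z] fcontract_def total_point(3)[OF z] W by (simp add: sum_distrib_left mult_ac)
  have ub: "(\<Sum>\<delta>\<in>UNIV. ?b l \<delta> * cnj (v c $ \<delta>)) = cnj (s * lift l \<zeta>)" for l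
    unfolding u[symmetric] fdzbar_cnj[OF total_point(5)[OF z]] by simp
  have inner: "(\<Sum>\<gamma>\<in>UNIV. \<Sum>\<delta>\<in>UNIV. r * ?a k \<gamma> * ?b l \<delta> * v c $ \<gamma> * cnj (v c $ \<delta>)) =
     r * ((s * lift k \<zeta>) * cnj (s * lift l \<zeta>))" for r k l
  proof -
    have "(\<Sum>\<gamma>\<in>UNIV. \<Sum>\<delta>\<in>UNIV. r * ?a k \<gamma> * ?b l \<delta> * v c $ \<gamma> * cnj (v c $ \<delta>)) =
      r * ((\<Sum>\<gamma>\<in>UNIV. ?a k \<gamma> * v c $ \<gamma>) * (\<Sum>\<delta>\<in>UNIV. ?b l \<delta> * cnj (v c $ \<delta>)))"
      unfolding sum_product by (simp add: sum_distrib_left mult_ac)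
    then show ?thesis unfolding u ub .
  qed
  have "(\<Sum>I\<in>UNIV. \<Sum>J\<in>UNIV. curvature_form g f c d ?p v $ I $ J * V $ I * cnj (V $ J)) =
    (\<Sum>\<alpha>\<in>UNIV. \<Sum>\<beta>\<in>UNIV. (\<Sum>i\<in>UNIV. \<Sum>j\<in>UNIV. \<Sum>k\<in>UNIV. \<Sum>l\<in>UNIV.
        ?R i j k l * ?a i \<alpha> * ?b j \<beta> * ((s * lift k \<zeta>) * cnj (s * lift l \<zeta>))) * V $ Inl \<alpha> * cnj (V $ Inl \<beta>))"
    unfolding sum_sum_type curvature_form_def
    by (simp add: total_point(3)[OF z] total_point(4)[OF z, symmetric] inner)
  also have "\<dots> = (\<Sum>\<alpha>\<in>UNIV. \<Sum>\<beta>\<in>UNIV. \<Sum>i\<in>UNIV. \<Sum>j\<in>UNIV. \<Sum>k\<in>UNIV. \<Sum>l\<in>UNIV.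
        s * cnj s * (?R i j k l * (?a i \<alpha> * V $ Inl \<alpha>) * (?b j \<beta> * cnj (V $ Inl \<beta>)) * lift k \<zeta> * cnj (lift l \<zeta>)))"
    by (simp add: sum_distrib_left sum_distrib_right mult_ac)
  also have "\<dots> = (\<Sum>i\<in>UNIV. \<Sum>j\<in>UNIV. \<Sum>k\<in>UNIV. \<Sum>l\<in>UNIV. \<Sum>\<alpha>\<in>UNIV. \<Sum>\<beta>\<in>UNIV.
        s * cnj s * (?R i j k l * (?a i \<alpha> * V $ Inl \<alpha>) * (?b j \<beta> * cnj (V $ Inl \<beta>)) * lift k \<zeta> * cnj (lift l \<zeta>)))"
    by (subst sum_swap4, subst sum_swap4) simp
  also have "\<dots> = (\<Sum>i\<in>UNIV. \<Sum>j\<in>UNIV. \<Sum>k\<in>UNIV. \<Sum>l\<in>UNIV. 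
        s * cnj s * (?R i j k l * yd (holo V) i \<zeta> * yd (antiholo V) j \<zeta> * lift k \<zeta> * cnj (lift l \<zeta>)))"
    unfolding yd_holo[OF z] by (simp add: sum_distrib_left sum_distrib_right mult_ac)
  finally show ?thesis by (simp add: sum_distrib_left)
qed

lemma form_inequality:
  assumes \<xi>: "(p, L) \<in> proj_chart_dom A c \<nu>" and fp: "f p \<in> cdom d" and v: "v \<in> L" "v \<noteq> (\<lambda>_. 0)"
  shows "form_ge \<nu> (ddbar_fun A c \<nu> (Y_fun A h B g f) (p, L))
        (\<chi> I J. ddbar_log_Hinv A h c \<nu> (p, L) $ I $ J * Y_fun A h B g f (p, L)
                - curvature_form g f c d p v $ I $ J / of_real (H_fun A h p v))"
  unfolding form_ge_def semipositive_def
proof (intro allI impI)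
  fix V :: "complex^('m + 'm)"
  let ?\<zeta> = "proj_coord c \<nu> (p, L)"
  let ?Y = "\<lambda>\<zeta>. energy \<zeta> * of_real (inverse (H \<zeta>))" and ?\<phi> = "\<lambda>\<zeta>. complex_of_real (ln (inverse (H \<zeta>)))"
  have p: "p \<in> cdom c" using \<xi> unfolding proj_chart_dom_def by auto
  note pc = proj_coord_eq[OF \<xi> v]
  have bc: "base_coord ?\<zeta> = coord c p" by (simp add: pc(2) base_coord_def vec_eq_iff)
  have z: "?\<zeta> \<in> total_dom"
    unfolding total_dom_def base_dom_def using p fp bc by auto
  have bp: "base_pt c ?\<zeta> = p"
    using chart_cinv[OF p charts(1)] bc by (simp add: base_pt_def base_coord_def)
  \<comment> \<open>the factor between \<open>v\<close> and the normalized vector of the same line\<close>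
  define s where "s = v c $ \<nu>"
  have s: "s \<noteq> 0" using pc(1) by (simp add: s_def)
  have W: "v c = s *s fibre_vec \<nu> ?\<zeta>"
    using s unfolding pc(2) by (auto simp: fibre_vec_def vec_eq_iff s_def)
  have "v \<in> tangent_space A p"
    using \<xi> v(1) cline_in_tangent_space[OF complex_atlas] unfolding proj_chart_dom_def proj_tangent_bundle_def by auto
  then have "H_fun A h p v = hform h c (coord c p) (v c)" by (rule H_fun_eq[OF M c p])
  also have "\<dots> = Re (of_real ((cmod s)\<^sup>2) * (\<Sum>\<gamma>\<in>UNIV. \<Sum>\<delta>\<in>UNIV. h c (coord c p) $ \<gamma> $ \<delta> * fibre_vec \<nu> ?\<zeta> $ \<gamma> * cnj (fibre_vec \<nu> ?\<zeta> $ \<delta>)))"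
    unfolding hform_def W complex_norm_square by (simp add: sum_distrib_left mult_ac)
  also have "\<dots> = (cmod s)\<^sup>2 * H ?\<zeta>"
    unfolding H_def hform_def bc by simp
  finally have Hv: "complex_of_real (H_fun A h p v) = s * cnj s * of_real (H ?\<zeta>)"
    by (simp add: complex_norm_square[symmetric])
  have inv: "Cinf_on (\<lambda>x. inverse (H x)) total_dom"
    using H_pos by (intro Cinf_on_inverse open_total_dom smooth_H) force
  have smY: "Cinf_on ?Y total_dom"
    by (intro Cinf_on_mult open_total_dom smooth_energy Cinf_on_of_real inv)
  have sm\<phi>: "Cinf_on ?\<phi> total_dom"
    using H_pos by (intro Cinf_on_of_real Cinf_on_ln open_total_dom inv) auto
  have dY: "ddbar_fun A c \<nu> (Y_fun A h B g f) (p, L) = ddbar_coeffs ?Y ?\<zeta>"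
    unfolding ddbar_fun_def
    by (rule ddbar_coeffs_cong[OF open_total_dom z smY]) (simp add: Y_fun_lift)
  have d\<phi>: "ddbar_log_Hinv A h c \<nu> (p, L) = ddbar_coeffs ?\<phi> ?\<zeta>"
    unfolding ddbar_log_Hinv_def
    by (rule ddbar_coeffs_cong[OF open_total_dom z sm\<phi>]) (simp add: H_fun_lift)
  have Y: "Y_fun A h B g f (p, L) = ?Y ?\<zeta>"
    using Y_fun_lift[OF z] unfolding proj_point_coord[OF complex_atlas c \<xi>] .
  let ?C = "curvature_form g f c d p v"
  let ?b = "\<chi> I J. ddbar_log_Hinv A h c \<nu> (p, L) $ I $ J * Y_fun A h B g f (p, L) - ?C $ I $ J / of_real (H_fun A h p v)"
  have "(\<Sum>I\<in>UNIV. \<Sum>J\<in>UNIV. (ddbar_fun A c \<nu> (Y_fun A h B g f) (p, L) - ?b) $ I $ J * V $ I * cnj (V $ J)) =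
    (\<Sum>I\<in>UNIV. \<Sum>J\<in>UNIV. ddbar_coeffs ?Y ?\<zeta> $ I $ J * V $ I * cnj (V $ J))
    - ?Y ?\<zeta> * (\<Sum>I\<in>UNIV. \<Sum>J\<in>UNIV. ddbar_coeffs ?\<phi> ?\<zeta> $ I $ J * V $ I * cnj (V $ J))
    + (\<Sum>I\<in>UNIV. \<Sum>J\<in>UNIV. ?C $ I $ J * V $ I * cnj (V $ J)) / of_real (H_fun A h p v)"
    unfolding dY d\<phi> Y by (simp only: vector_minus_component vec_lambda_beta contract_difference)
  also have "(\<Sum>I\<in>UNIV. \<Sum>J\<in>UNIV. ?C $ I $ J * V $ I * cnj (V $ J)) / of_real (H_fun A h p v) =
     of_real (inverse (H ?\<zeta>)) * (\<Sum>i\<in>UNIV. \<Sum>j\<in>UNIV. \<Sum>k\<in>UNIV. \<Sum>l\<in>UNIV. of_real (curvature (g d) i l k j (y ?\<zeta>)) *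
      yd (holo V) i ?\<zeta> * yd (antiholo V) j ?\<zeta> * lift k ?\<zeta> * cnj (lift l ?\<zeta>))"
    using curvature_form_contract[where v = v and s = s and V = V, OF z W] s unfolding bp Hv by (simp add: field_simps)
  finally show "(\<Sum>I\<in>UNIV. \<Sum>J\<in>UNIV. (ddbar_fun A c \<nu> (Y_fun A h B g f) (p, L) - ?b) $ I $ J * V $ I * cnj (V $ J)) \<in> \<real>\<^sub>\<ge>\<^sub>0"
    using bochner_nonneg[OF z smooth_H H_pos, of V]
    unfolding ddbar_coeffs_contract[OF open_total_dom z smY] ddbar_coeffs_contract[OF open_total_dom z sm\<phi>] by simp
qed

end

theorem theorem1p8:
  fixes A :: "('a::{t2_space, second_countable_topology}, complex^'m::finite) chart set"
    and h :: "('a, 'm) hmetric"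
    and B :: "('b::{t2_space, second_countable_topology}, real^'n::finite) chart set"
    and g :: "('b, 'n) rmetric"
    and f :: "'a \<Rightarrow> 'b"
  assumes "hermitian_manifold A h"
    and "riemannian_manifold B g"
    and "pluriharmonic A B g f"
  shows "\<forall>\<xi>\<in>proj_tangent_bundle A. \<forall>c\<in>A. \<forall>\<nu>. \<forall>d\<in>B. \<forall>v\<in>snd \<xi>.
      \<xi> \<in> proj_chart_dom A c \<nu> \<longrightarrow> f (fst \<xi>) \<in> cdom d \<longrightarrow> v \<noteq> (\<lambda>_. 0) \<longrightarrow>
      form_ge \<nu> (ddbar_fun A c \<nu> (Y_fun A h B g f) \<xi>)
        (\<chi> I J. ddbar_log_Hinv A h c \<nu> \<xi> $ I $ J * Y_fun A h B g f \<xi>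
                - curvature_form g f c d (fst \<xi>) v $ I $ J / of_real (H_fun A h (fst \<xi>) v))"
proof (intro ballI allI impI)
  fix \<xi> c \<nu> d v
  assume "\<xi> \<in> proj_tangent_bundle A" and c: "c \<in> A" and d: "d \<in> B" and v: "v \<in> snd \<xi>"
    and \<xi>: "\<xi> \<in> proj_chart_dom A c \<nu>" and fp: "f (fst \<xi>) \<in> cdom d" and v0: "v \<noteq> (\<lambda>_. 0)"
  interpret projective_chart A h B g f c \<nu> d
    using assms c d by unfold_locales
  show "form_ge \<nu> (ddbar_fun A c \<nu> (Y_fun A h B g f) \<xi>)
        (\<chi> I J. ddbar_log_Hinv A h c \<nu> \<xi> $ I $ J * Y_fun A h B g f \<xi>
                - curvature_form g f c d (fst \<xi>) v $ I $ J / of_real (H_fun A h (fst \<xi>) v))"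
    using form_inequality[of "fst \<xi>" "snd \<xi>" v] \<xi> fp v v0 by simp
qed

end
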